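(* Let $\ell\ge 3$, let $s_1\le s_2\le\dots\le s_\ell$ be positive integers, and let $\frac12\le p<1$ be a constant. Then with probability tending to $1$ as $n\to\infty$, $$\mathrm{sat}\left(G(n,p),K_{s_1,\ldots,s_\ell}\right)=\left(1+o(1)\right)n\log_{\frac{1}{1-p}}n.$$
   Context: $G(n,p)$ is the binomial random graph on $[n]$ with edge probability $p$. $K_{s_1,\ldots,s_\ell}$ is the complete $\ell$-partite graph with parts of sizes $s_1,\ldots,s_\ell$. For graphs $G,F$, a subgraph $H\subseteq G$ is $F$-saturated in $G$ if $H$ contains no copy of $F$, but adding any edge of $E(G)\setminus E(H)$ creates a copy of $F$; $\mathrm{sat}(G,F)$ is the minimum number of edges of an $F$-saturated subgraph of $G$. *)

theory Defs
  imports "HOL-Probability.Probability" "HOL-Probability.Product_PMF" "HOL-Library.Ramsey"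
begin

type_synonym 'a ugraph = "'a set \<times> 'a set set"

abbreviation verts :: "'a ugraph \<Rightarrow> 'a set" where "verts \<equiv> fst"
abbreviation edges :: "'a ugraph \<Rightarrow> 'a set set" where "edges \<equiv> snd"

definition simple_graph :: "'a ugraph \<Rightarrow> bool" where
  "simple_graph G \<longleftrightarrow> edges G \<subseteq> [verts G]\<^bsup>2\<^esup>"

definition subgraph :: "'a ugraph \<Rightarrow> 'a ugraph \<Rightarrow> bool" where
  "subgraph H G \<longleftrightarrow> simple_graph H \<and> verts H \<subseteq> verts G \<and> edges H \<subseteq> edges G"

text \<open>Subgraphs need not be spanning, so adding an edge also adds its end points.\<close>

definition add_edge :: "'a set \<Rightarrow> 'a ugraph \<Rightarrow> 'a ugraph" where
  "add_edge e H = (verts H \<union> e, insert e (edges H))"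

text \<open>A copy of \<open>F\<close> is a (not necessarily induced) subgraph isomorphic to \<open>F\<close>.\<close>

definition contains_copy :: "'a ugraph \<Rightarrow> 'b ugraph \<Rightarrow> bool" where
  "contains_copy H F \<longleftrightarrow>
     (\<exists>f. inj_on f (verts F) \<and> f ` verts F \<subseteq> verts H \<and> (\<forall>e\<in>edges F. f ` e \<in> edges H))"

definition saturated_in :: "'a ugraph \<Rightarrow> 'b ugraph \<Rightarrow> 'a ugraph \<Rightarrow> bool" where
  "saturated_in G F H \<longleftrightarrow>
     subgraph H G \<and> \<not> contains_copy H F \<and>
     (\<forall>e \<in> edges G - edges H. contains_copy (add_edge e H) F)"

text \<open>For finite \<open>G\<close> and \<open>F\<close> with at least one edge the set below is
  nonempty (take an edge-maximal \<open>F\<close>-free subgraph on all vertices), so the infimum is a minimum.\<close>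

definition sat :: "'a ugraph \<Rightarrow> 'b ugraph \<Rightarrow> nat" where
  "sat G F = (INF H \<in> {H. saturated_in G F H}. card (edges H))"

text \<open>The \<open>j\<close>-th vertex of the \<open>i\<close>-th part is encoded as the pair \<open>(i, j)\<close>, counting from 0.\<close>

definition complete_multipartite :: "nat list \<Rightarrow> (nat \<times> nat) ugraph" where
  "complete_multipartite s =
     (let V = (SIGMA i:{..<length s}. {..<s ! i})
      in (V, {{u, v} | u v. u \<in> V \<and> v \<in> V \<and> fst u \<noteq> fst v}))"

definition random_graph :: "nat \<Rightarrow> real \<Rightarrow> nat ugraph pmf" where
  "random_graph n p =
     map_pmf (\<lambda>c. ({1..n}, {e \<in> [{1..n}]\<^bsup>2\<^esup>. c e}))
       (Pi_pmf ([{1..n}]\<^bsup>2\<^esup>) False (\<lambda>_. bernoulli_pmf p))"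

end

theory Submission
  imports Defs "HOL-Real_Asymp.Real_Asymp"
begin

text \<open>
  Write \<open>F\<close> for the complete multipartite graph and \<open>log\<close> for the logarithm to base \<open>1 / (1 - p)\<close>.

  Lower bound. Every edge of \<open>F\<close> lies in a triangle, so in a saturated \<open>H\<close> the ends of every missing edge
  of \<open>G\<close> have a common \<open>H\<close>-neighbour. With high probability, for every set of at most \<open>(1 - \<epsilon>) log n\<close> vertices, every
  vertex has polynomially many \<open>G\<close>-neighbours without a \<open>G\<close>-neighbour in the set. Hence a vertex of polylogarithmic \<open>H\<close>-degree has more
  than \<open>(1 - \<epsilon>) log n\<close> \<open>H\<close>-neighbours of large degree, and almost all vertices are of this kind.

  Upper bound. Fix a set \<open>A\<^sub>1\<close> of about \<open>(1 / p) log n\<close> vertices, keep all edges of \<open>G\<close> between \<open>A\<^sub>1\<close> and the rest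
  \<open>B\<close>, and put inside \<open>A\<^sub>1\<close> a graph which does not contain \<open>F\<close> without its largest part, but such that
  every linear-sized subset contains the latter graph minus a vertex of its smallest part. If a vertex of \<open>B\<close> had many
  neighbours in \<open>B\<close> sharing with it a linear part of \<open>A\<^sub>1\<close>, pigeonhole would give a copy of \<open>F\<close>: so every \<open>F\<close>-free
  extension has bounded degree along such pairs, and it is enough to extend maximally. All but at most \<open>n\<close> pairs
  with an end in \<open>B - W\<close> share a linear part of \<open>A\<^sub>1\<close>, where \<open>W\<close> is the small set of vertices with few neighbours in \<open>A\<^sub>1\<close>.
  Pairs inside \<open>W\<close> are treated in the same way by a larger set \<open>A\<^sub>2\<close> joined to \<open>W\<close> but not to \<open>B - W\<close>, and the
  pairs between \<open>A\<^sub>2\<close> and \<open>B - W\<close> by sets \<open>A\<^sub>3 j\<close> of size \<open>o(log n)\<close>.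
\<close>

section \<open>Independent coordinates of a product distribution\<close>

text \<open>The edges at \<open>A\<^sub>1\<close> already use up the main term: a vertex of
  \<open>B\<close> has about log n neighbours in \<open>A\<^sub>1\<close>, and another vertex avoids
  all of these with probability about (1 - p)^(log n) = 1 / n. A slightly larger
  \<open>A\<^sub>1\<close> therefore leaves at most n failing pairs out of n^2, but there is no room
  to serve the vertices whose degree into \<open>A\<^sub>1\<close> is too small. For these,
  \<open>A\<^sub>2\<close> may be a large multiple of log n, since only the small set
  \<open>W\<close> is joined to it. This leaves the pairs between \<open>A\<^sub>2\<close> and
  \<open>B - W\<close>, of order n log n and hence too many to keep. There are few enough of them,
  however, that a failure probability o(1) per pair is affordable, and so sets
  \<open>A\<^sub>3 j\<close> of size o(log n) suffice, which are cheap even with all their edges.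
  The joined layers form a triangle-free pattern, so that apart from one part a copy cannot mix
  layers. The index \<open>j\<close> splits the third layer by positions in the blocks of
  \<open>A\<^sub>2\<close>: two adjacent vertices of a block then have no common neighbour in
  it.\<close>

definition depends_on :: "(('a \<Rightarrow> 'b) \<Rightarrow> 'c) \<Rightarrow> 'a set \<Rightarrow> bool" where
  "depends_on f J \<longleftrightarrow> (\<forall>c c'. (\<forall>x\<in>J. c x = c' x) \<longrightarrow> f c = f c')"

lemma depends_onI: "(\<And>c c'. (\<And>x. x \<in> J \<Longrightarrow> c x = c' x) \<Longrightarrow> f c = f c') \<Longrightarrow> depends_on f J"
  unfolding depends_on_def by blast

lemma depends_onD: "depends_on f J \<Longrightarrow> (\<And>x. x \<in> J \<Longrightarrow> c x = c' x) \<Longrightarrow> f c = f c'"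
  unfolding depends_on_def by blast

lemma prob_le_expectation:
  fixes f :: "'a \<Rightarrow> real"
  assumes fin: "finite (set_pmf M)" and nonneg: "\<And>c. c \<in> set_pmf M \<Longrightarrow> f c \<ge> 0"
    and ge1: "\<And>c. c \<in> set_pmf M \<Longrightarrow> c \<in> A \<Longrightarrow> f c \<ge> 1"
  shows "measure_pmf.prob M A \<le> measure_pmf.expectation M f"
proof -
  have "measure_pmf.prob M A = measure_pmf.expectation M (indicator A)"
    by simp
  also have "\<dots> \<le> measure_pmf.expectation M f"
    using fin nonneg ge1
    by (intro integral_mono_AE integrable_measure_pmf_finite)
       (auto simp: AE_measure_pmf_iff indicator_def)
  finally show ?thesis .
qed

text \<open>Markov's inequality for a count: only the probabilities of single events enter, so it
  also serves for dependent events such as the failures of pairs that share a vertex.\<close>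

lemma prob_count_gt_le:
  assumes fin: "finite (set_pmf M)" and "finite X" and "T > 0"
    and le: "\<And>x. x \<in> X \<Longrightarrow> measure_pmf.prob M {c. P x c} \<le> q"
  shows "measure_pmf.prob M {c. real (card {x\<in>X. P x c}) > T} \<le> real (card X) * q / T"
proof -
  have "measure_pmf.prob M {c. real (card {x\<in>X. P x c}) > T}
      \<le> measure_pmf.expectation M (\<lambda>c. (\<Sum>x\<in>X. indicator {c. P x c} c) / T)"
  proof (rule prob_le_expectation[OF fin])
    fix c
    have "(\<Sum>x\<in>X. indicator {c. P x c} c) = real (card {x\<in>X. P x c})"
      using \<open>finite X\<close> by (simp add: indicator_def sum.If_cases Int_def)
    then show "c \<in> {c. real (card {x\<in>X. P x c}) > T} \<Longrightarrow> 1 \<le> (\<Sum>x\<in>X. indicator {c. P x c} c) / T"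
      using \<open>T > 0\<close> by simp
  qed (use \<open>T > 0\<close> in \<open>auto intro!: divide_nonneg_pos sum_nonneg\<close>)
  also have "\<dots> = (\<Sum>x\<in>X. measure_pmf.prob M {c. P x c}) / T"
    by (simp add: integrable_measure_pmf_finite[OF fin])
  also have "\<dots> \<le> real (card X) * q / T"
    using \<open>T > 0\<close> sum_bounded_above[of X "\<lambda>x. measure_pmf.prob M {c. P x c}" q] le
    by (intro divide_right_mono) auto
  finally show ?thesis .
qed

lemma expectation_pair_mult:
  fixes f :: "'a \<Rightarrow> real" and g :: "'b \<Rightarrow> real"
  assumes "finite (set_pmf M)" "finite (set_pmf N)"
  shows "measure_pmf.expectation (pair_pmf M N) (\<lambda>x. f (fst x) * g (snd x))
       = measure_pmf.expectation M f * measure_pmf.expectation N g"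
proof -
  have "measure_pmf.expectation (pair_pmf M N) (\<lambda>x. f (fst x) * g (snd x))
      = (\<Sum>z\<in>set_pmf M \<times> set_pmf N. f (fst z) * g (snd z) * pmf (pair_pmf M N) z)"
    using assms by (intro integral_measure_pmf_real) auto
  also have "\<dots> = (\<Sum>x\<in>set_pmf M. \<Sum>y\<in>set_pmf N. (f x * pmf M x) * (g y * pmf N y))"
    unfolding sum.cartesian_product by (intro sum.cong) (auto simp: pmf_pair)
  also have "\<dots> = (\<Sum>x\<in>set_pmf M. f x * pmf M x) * (\<Sum>y\<in>set_pmf N. g y * pmf N y)"
    by (simp add: sum_product)
  also have "\<dots> = measure_pmf.expectation M f * measure_pmf.expectation N g"
    using assms by (subst (1 2) integral_measure_pmf_real) auto
  finally show ?thesis .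
qed

lemma finite_set_Pi_pmf:
  assumes "finite I" "\<And>x. x \<in> I \<Longrightarrow> finite (set_pmf (D x))"
  shows "finite (set_pmf (Pi_pmf I d D))"
  using assms by (subst set_Pi_pmf) (auto intro!: finite_PiE_dflt)

text \<open>The product distribution is the pair of its restrictions to \<open>J\<close> and to
  \<open>I - J\<close>; \<open>f\<close> reads only the first component and, since \<open>K\<close>
  avoids \<open>J\<close>, \<open>g\<close> only the second.\<close>

lemma expectation_mult_disjoint:
  fixes f g :: "('a \<Rightarrow> 'b) \<Rightarrow> real"
  assumes I: "finite I" "\<And>x. x \<in> I \<Longrightarrow> finite (set_pmf (D x))"
    and JK: "J \<subseteq> I" "K \<subseteq> I" "J \<inter> K = {}"
    and f: "depends_on f J" and g: "depends_on g K" and M: "M = Pi_pmf I d D"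
  shows "measure_pmf.expectation M (\<lambda>c. f c * g c)
       = measure_pmf.expectation M f * measure_pmf.expectation M g"
proof -
  let ?J = "Pi_pmf J d D" and ?K = "Pi_pmf (I - J) d D"
  let ?h = "\<lambda>(a, b) x. if x \<in> J then a x else b x"
  have fin: "finite J" "finite (I - J)" "finite (set_pmf ?J)" "finite (set_pmf ?K)"
    using I JK by (auto intro!: finite_set_Pi_pmf dest: finite_subset)
  have M': "M = map_pmf ?h (pair_pmf ?J ?K)"
    using Pi_pmf_union[of J "I - J" d D] fin JK unfolding M by (simp add: Un_absorb1)
  have fJ: "f (?h z) = f (fst z)" for z
    by (rule depends_onD[OF f]) (auto split: prod.splits)
  have gK: "g (?h z) = g (snd z)" for z
    by (rule depends_onD[OF g]) (use JK in \<open>auto split: prod.splits\<close>)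
  show ?thesis
    unfolding M' by (simp add: fJ gK expectation_pair_mult[OF fin(3,4)])
qed

lemma expectation_prod_disjoint:
  fixes f :: "'u \<Rightarrow> ('a \<Rightarrow> 'b) \<Rightarrow> real"
  assumes I: "finite I" "\<And>x. x \<in> I \<Longrightarrow> finite (set_pmf (D x))"
    and "finite U" "\<And>u. u \<in> U \<Longrightarrow> J u \<subseteq> I" "disjoint_family_on J U"
    and "\<And>u. u \<in> U \<Longrightarrow> depends_on (f u) (J u)" and M: "M = Pi_pmf I d D"
  shows "measure_pmf.expectation M (\<lambda>c. \<Prod>u\<in>U. f u c) = (\<Prod>u\<in>U. measure_pmf.expectation M (f u))"
  using assms(3-6)
proof (induction U rule: finite_induct)
  case (insert v U)
  have "measure_pmf.expectation M (\<lambda>c. \<Prod>u\<in>insert v U. f u c)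
      = measure_pmf.expectation M (\<lambda>c. f v c * (\<Prod>u\<in>U. f u c))"
    using insert by simp
  also have "\<dots> = measure_pmf.expectation M (f v) * measure_pmf.expectation M (\<lambda>c. \<Prod>u\<in>U. f u c)"
    unfolding M
  proof (rule expectation_mult_disjoint[OF I, where J = "J v" and K = "\<Union>(J ` U)"])
    show "J v \<inter> \<Union>(J ` U) = {}"
      using insert by (auto simp: disjoint_family_on_def)
    show "depends_on (\<lambda>c. \<Prod>u\<in>U. f u c) (\<Union>(J ` U))"
      by (intro depends_onI prod.cong refl, rule depends_onD[OF insert.prems(3)]) auto
  qed (use insert in auto)
  also have "\<dots> = (\<Prod>u\<in>insert v U. measure_pmf.expectation M (f u))"
    using insert by (simp add: disjoint_family_on_def)
  finally show ?case .
qed simp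

section \<open>Exponential moments and Chernoff bounds\<close>

lemma expectation_if:
  fixes a b :: real
  shows "measure_pmf.expectation M (\<lambda>c. if P c then a else b)
       = b + (a - b) * measure_pmf.prob M {c. P c}"
proof -
  have "measure_pmf.expectation M (\<lambda>c. if P c then a else b)
      = measure_pmf.expectation M (\<lambda>c. b + (a - b) * indicator {c. P c} c)"
    by (intro Bochner_Integration.integral_cong) auto
  also have "\<dots> = b + (a - b) * measure_pmf.prob M {c. P c}"
    by (subst Bochner_Integration.integral_add) (auto intro!: measure_pmf.integrable_const_bound[where B = 1])
  finally show ?thesis .
qed

text \<open>An event reads a block \<open>J u\<close> of coordinates instead of a single one,
  because being a common neighbour involves two edges and avoiding a set involves many. The tilt
  \<open>t\<close> stays free in both tail bounds: later it is 1 where constants do not matter and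
  proportional to the relative deviation for degrees.\<close>

locale independent_events =
  fixes I :: "'a set" and D :: "'a \<Rightarrow> 'b pmf" and d :: 'b
    and U :: "'u set" and J :: "'u \<Rightarrow> 'a set" and P :: "'u \<Rightarrow> ('a \<Rightarrow> 'b) \<Rightarrow> bool"
  assumes fin_I: "finite I" and fin_D: "\<And>x. x \<in> I \<Longrightarrow> finite (set_pmf (D x))"
    and fin_U: "finite U" and sub: "\<And>u. u \<in> U \<Longrightarrow> J u \<subseteq> I"
    and disj: "disjoint_family_on J U" and dep: "\<And>u. u \<in> U \<Longrightarrow> depends_on (P u) (J u)"
begin

abbreviation "M \<equiv> Pi_pmf I d D"

lemma fin_M: "finite (set_pmf M)"
  by (rule finite_set_Pi_pmf[OF fin_I fin_D])

lemma mgf_count: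
  fixes t :: real
  shows "measure_pmf.expectation M (\<lambda>c. exp (t * real (card {u\<in>U. P u c})))
       = (\<Prod>u\<in>U. 1 + (exp t - 1) * measure_pmf.prob M {c. P u c})"
proof -
  have "exp (t * real (card {u\<in>U. P u c})) = (\<Prod>u\<in>U. if P u c then exp t else 1)" for c
    using fin_U by (simp add: prod.If_cases exp_of_nat2_mult Int_def)
  then have "measure_pmf.expectation M (\<lambda>c. exp (t * real (card {u\<in>U. P u c})))
      = measure_pmf.expectation M (\<lambda>c. \<Prod>u\<in>U. if P u c then exp t else 1)"
    by simp
  also have "\<dots> = (\<Prod>u\<in>U. measure_pmf.expectation M (\<lambda>c. if P u c then exp t else 1))"
  proof (rule expectation_prod_disjoint[OF fin_I fin_D fin_U sub disj _ refl])
    fix u assume u: "u \<in> U"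
    show "depends_on (\<lambda>c. if P u c then exp t else 1) (J u)"
      by (rule depends_onI) (metis depends_onD[OF dep[OF u]])
  qed
  finally show ?thesis
    by (simp add: expectation_if)
qed

lemma prob_count_le:
  assumes "\<And>u. u \<in> U \<Longrightarrow> measure_pmf.prob M {c. P u c} \<ge> q" and "q \<le> 1" and "t \<ge> 0"
  shows "measure_pmf.prob M {c. real (card {u\<in>U. P u c}) \<le> T}
       \<le> exp (t * T) * (1 - q * (1 - exp (- t))) ^ card U"
proof -
  have "measure_pmf.prob M {c. real (card {u\<in>U. P u c}) \<le> T}
      \<le> measure_pmf.expectation M (\<lambda>c. exp (t * T) * exp (- t * real (card {u\<in>U. P u c})))"
    by (rule prob_le_expectation[OF fin_M]) (auto simp: exp_add[symmetric] assms mult_left_mono)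
  also have "\<dots> = exp (t * T) * (\<Prod>u\<in>U. 1 + (exp (- t) - 1) * measure_pmf.prob M {c. P u c})"
    by (subst integral_mult_right_zero) (simp add: mgf_count[of "- t", simplified])
  also have "\<dots> \<le> exp (t * T) * (\<Prod>u\<in>U. 1 - q * (1 - exp (- t)))"
  proof (intro mult_left_mono prod_mono conjI)
    fix u assume u: "u \<in> U"
    have "(1 - exp (- t)) * q \<le> (1 - exp (- t)) * measure_pmf.prob M {c. P u c}"
      using assms u by (intro mult_left_mono) auto
    then show "1 + (exp (- t) - 1) * measure_pmf.prob M {c. P u c} \<le> 1 - q * (1 - exp (- t))"
      by (simp add: algebra_simps)
    have "(1 - exp (- t)) * measure_pmf.prob M {c. P u c} \<le> 1 * 1"
      using assms by (intro mult_mono) auto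
    then show "0 \<le> 1 + (exp (- t) - 1) * measure_pmf.prob M {c. P u c}"
      by (simp add: algebra_simps)
  qed auto
  finally show ?thesis by simp
qed

lemma prob_count_ge:
  assumes "\<And>u. u \<in> U \<Longrightarrow> measure_pmf.prob M {c. P u c} \<le> q" and "t \<ge> 0"
  shows "measure_pmf.prob M {c. real (card {u\<in>U. P u c}) \<ge> T}
       \<le> exp (- t * T) * (1 + q * (exp t - 1)) ^ card U"
proof -
  have "measure_pmf.prob M {c. real (card {u\<in>U. P u c}) \<ge> T}
      \<le> measure_pmf.expectation M (\<lambda>c. exp (- t * T) * exp (t * real (card {u\<in>U. P u c})))"
    by (rule prob_le_expectation[OF fin_M]) (auto simp: exp_add[symmetric] assms mult_left_mono)
  also have "\<dots> = exp (- t * T) * (\<Prod>u\<in>U. 1 + (exp t - 1) * measure_pmf.prob M {c. P u c})"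
    by (subst integral_mult_right_zero) (simp add: mgf_count)
  also have "\<dots> \<le> exp (- t * T) * (\<Prod>u\<in>U. 1 + q * (exp t - 1))"
    using assms by (intro mult_left_mono prod_mono conjI)
      (auto simp: mult.commute[of q] intro!: mult_left_mono add_nonneg_nonneg)
  finally show ?thesis by simp
qed

end

lemma prob_UN_le:
  assumes "finite X" and "\<And>x. x \<in> X \<Longrightarrow> measure_pmf.prob M {c. P x c} \<le> q"
  shows "measure_pmf.prob M {c. \<exists>x\<in>X. P x c} \<le> real (card X) * q"
proof -
  have "{c. \<exists>x\<in>X. P x c} = (\<Union>x\<in>X. {c. P x c})" by auto
  then have "measure_pmf.prob M {c. \<exists>x\<in>X. P x c} \<le> (\<Sum>x\<in>X. measure_pmf.prob M {c. P x c})"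
    using measure_pmf.finite_measure_subadditive_finite[of X "\<lambda>x. {c. P x c}" M] assms(1) by simp
  also have "\<dots> \<le> real (card X) * q"
    using assms sum_bounded_above[of X "\<lambda>x. measure_pmf.prob M {c. P x c}" q] by auto
  finally show ?thesis .
qed

section \<open>Sparse uniform hypergraphs\<close>

lemma prob_less_1_imp_ex:
  assumes "measure_pmf.prob M A < 1"
  shows "\<exists>x\<in>set_pmf M. x \<notin> A"
proof (rule ccontr)
  assume "\<not> ?thesis"
  then have "AE x in measure_pmf M. x \<in> A" by (simp add: AE_measure_pmf_iff)
  then show False using assms measure_pmf.prob_eq_1[of A M] by simp
qed

lemma set_pmf_uniform: "k > (0::nat) \<Longrightarrow> set_pmf (pmf_of_set {..<k}) = {..<k}"
  by (subst set_pmf_of_set) auto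

lemma prob_uniform_Pi_subset:
  assumes "finite X" "S \<subseteq> X" "Y \<subseteq> {..<k}" "k > (0::nat)"
  shows "measure_pmf.prob (Pi_pmf X 0 (\<lambda>_. pmf_of_set {..<k})) {f. \<forall>x\<in>S. f x \<in> Y}
       = (real (card Y) / real k) ^ card S"
proof -
  let ?B = "\<lambda>x. if x \<in> S then Y else UNIV"
  have "{f. \<forall>x\<in>S. f x \<in> Y} = Pi X ?B"
    using assms by (auto simp: Pi_def)
  then have "measure_pmf.prob (Pi_pmf X 0 (\<lambda>_. pmf_of_set {..<k})) {f. \<forall>x\<in>S. f x \<in> Y}
      = (\<Prod>x\<in>X. measure_pmf.prob (pmf_of_set {..<k}) (?B x))"
    using assms by (simp add: measure_Pi_pmf_Pi)
  also have "\<dots> = (\<Prod>x\<in>X. if x \<in> S then real (card Y) / real k else 1)"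
  proof (intro prod.cong refl)
    fix x
    have "measure_pmf.prob (pmf_of_set {..<k}) Y = real (card ({..<k} \<inter> Y)) / real k"
      using assms by (subst measure_pmf_of_set) auto
    moreover have "{..<k} \<inter> Y = Y"
      using assms by blast
    ultimately show "measure_pmf.prob (pmf_of_set {..<k}) (?B x) = (if x \<in> S then real (card Y) / real k else 1)"
      by simp
  qed
  also have "\<dots> = (real (card Y) / real k) ^ card S"
    using assms by (simp add: prod.If_cases Int_absorb1)
  finally show ?thesis .
qed

lemma card_nsets_le_power:
  assumes "finite X" shows "real (card ([X]\<^bsup>j\<^esup>)) \<le> real (card X) ^ j"
proof -
  have "[X]\<^bsup>j\<^esup> = {T. T \<subseteq> X \<and> card T = j}"
    using assms by (auto simp: nsets_def dest: finite_subset)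
  then have "card ([X]\<^bsup>j\<^esup>) = card X choose j"
    using n_subsets[OF assms, of j] by simp
  moreover have "card X choose j \<le> card X ^ j"
    by (cases "j \<le> card X") (auto intro: binomial_le_pow simp: binomial_eq_0)
  ultimately show ?thesis
    by (metis of_nat_le_iff of_nat_power)
qed

text \<open>Union bound over the sets of exactly \<open>q\<close> values, at most k^q in number:
  since \<open>q \<le> k\<close>, a smaller image also lies in one of them, and each value falls
  into a fixed one with probability q / k.\<close>

lemma prob_small_image_le:
  fixes k :: nat
  assumes "finite X" "S \<subseteq> X" "k > 0" "q \<le> k"
  shows "measure_pmf.prob (Pi_pmf X 0 (\<lambda>_. pmf_of_set {..<k})) {f. card (f ` S) \<le> q}
       \<le> real k ^ q * (real q / real k) ^ card S"
proof -
  let ?M = "Pi_pmf X 0 (\<lambda>_. pmf_of_set {..<k})"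
  have "measure_pmf.prob ?M {f. card (f ` S) \<le> q}
      \<le> measure_pmf.prob ?M {f. \<exists>Y\<in>[{..<k}]\<^bsup>q\<^esup>. \<forall>x\<in>S. f x \<in> Y}"
  proof (intro measure_pmf.finite_measure_mono_AE AE_pmfI impI)
    fix f assume "f \<in> set_pmf ?M" and "f \<in> {f. card (f ` S) \<le> q}"
    then have sub: "f ` S \<subseteq> {..<k}" and le: "card (f ` S) \<le> q"
      using assms by (auto simp: set_Pi_pmf PiE_dflt_def set_pmf_uniform[OF \<open>k > 0\<close>])
    obtain Y where "f ` S \<subseteq> Y" "Y \<subseteq> {..<k}" "card Y = q"
      using exists_subset_between[OF le _ sub] assms by auto
    then show "f \<in> {f. \<exists>Y\<in>[{..<k}]\<^bsup>q\<^esup>. \<forall>x\<in>S. f x \<in> Y}"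
      by (auto simp: nsets_def dest: finite_subset intro!: bexI[of _ Y])
  qed auto
  also have "\<dots> \<le> real (card ([{..<k}]\<^bsup>q\<^esup>)) * (real q / real k) ^ card S"
    using assms by (intro prob_UN_le) (auto simp: finite_imp_finite_nsets nsets_def prob_uniform_Pi_subset)
  also have "\<dots> \<le> real k ^ q * (real q / real k) ^ card S"
    using card_nsets_le_power[of "{..<k}" q] by (intro mult_right_mono) auto
  finally show ?thesis .
qed

text \<open>A set of \<open>j\<close> edges of an \<open>r\<close>-uniform hypergraph containing a Berge cycle of length \<open>j\<close> spans
  at most \<open>j * (r - 1)\<close> vertices; the case \<open>j = 1\<close> says that the maps are injective.\<close>

lemma sparse_hypergraph_exists:
  fixes V :: "'v set" and \<delta> :: real
  assumes V: "finite V" "V \<noteq> {}" and \<delta>: "0 < \<delta>" "\<delta> \<le> 1"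
  obtains k :: nat and I :: "nat set" and \<phi> :: "nat \<Rightarrow> 'v \<Rightarrow> nat"
  where "k > 0" "finite I" "\<And>i. i \<in> I \<Longrightarrow> \<phi> i ` V \<subseteq> {..<k}"
    and "\<And>T. T \<subseteq> I \<Longrightarrow> T \<noteq> {} \<Longrightarrow> card T \<le> 4 \<Longrightarrow> card (\<Union>i\<in>T. \<phi> i ` V) > card T * (card V - 1)"
    and "\<And>D. D \<subseteq> {..<k} \<Longrightarrow> real (card D) \<ge> \<delta> * real k \<Longrightarrow> \<exists>i\<in>I. \<phi> i ` V \<subseteq> D"
proof -
  define r where "r = card V"
  have r: "r > 0" using V by (simp add: r_def card_gt_0_iff)
  \<comment> \<open>With \<open>C * k\<close> random edges, a set of density \<delta> contains at
    least 4 k of them on average. The lower tail exp (- 2 k) then beats the at most 2^k choices of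
    the set.\<close>
  define C where "C = nat \<lceil>4 / \<delta> ^ r\<rceil>"
  \<comment> \<open>\<open>c\<close> bounds the expected number of bad j-sets for every j \<le> 4,
    uniformly in \<open>k\<close>. The 160 is the product of four sizes j, the Markov threshold 10
    and at most four edges in a bad set, so \<open>T\<^sub>0\<close> bounds the number of edges
    deleted below.\<close>
  define c where "c = real C ^ 4 * real (4 * r) ^ (4 * r)"
  define T\<^sub>0 where "T\<^sub>0 = 160 * c"
  have C: "real C * \<delta> ^ r \<ge> 4" "C \<ge> 1"
  proof -
    have "real C \<ge> 4 / \<delta> ^ r" unfolding C_def by linarith
    then show "real C * \<delta> ^ r \<ge> 4" using \<delta> by (simp add: field_simps)
    then show "C \<ge> 1" using \<delta> by (cases "C = 0") auto
  qed
  have c: "c \<ge> 1"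
    unfolding c_def using C r by (intro mult_ge1_I one_le_power) auto
  obtain k :: nat where k: "k \<ge> 4 * r" "k > 0" "exp T\<^sub>0 * (2 * exp (-2)) ^ k < 1/2"
  proof -
    have "(2::real) < exp 2"
      using exp_ge_add_one_self[of "2::real"] by linarith
    then have lt: "2 * exp (-2) < (1::real)"
      by (simp add: exp_minus field_simps)
    have "(\<lambda>k. exp T\<^sub>0 * (2 * exp (-2)) ^ k) \<longlonglongrightarrow> exp T\<^sub>0 * 0"
      using lt by (intro tendsto_intros LIMSEQ_power_zero) auto
    then have "eventually (\<lambda>k. exp T\<^sub>0 * (2 * exp (-2)) ^ k < 1/2) sequentially"
      by (rule order_tendstoD) auto
    then obtain k0 where "\<And>k. k \<ge> k0 \<Longrightarrow> exp T\<^sub>0 * (2 * exp (-2)) ^ k < 1/2"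
      by (auto simp: eventually_sequentially)
    then show ?thesis
      using that[of "max k0 (4 * r)"] r by auto
  qed
  define m where "m = C * k"
  define X where "X = {..<m} \<times> V"
  define M where "M = Pi_pmf X 0 (\<lambda>_. pmf_of_set {..<k})"
  have finX: "finite X" using V by (simp add: X_def)
  have finM: "finite (set_pmf M)"
    unfolding M_def using finX k by (intro finite_set_Pi_pmf) (auto simp: set_pmf_uniform)
  define bad where "bad j f = {T \<in> [{..<m}]\<^bsup>j\<^esup>. card (f ` (T \<times> V)) \<le> j * (r - 1)}" for j and f :: "nat \<times> 'v \<Rightarrow> nat"
  have prob_bad: "measure_pmf.prob M {f. real (card (bad j f)) > 10 * c} \<le> 1 / 10" if j: "j \<in> {1..4}" for j
  proof -
    have "measure_pmf.prob M {f. card (f ` (T \<times> V)) \<le> j * (r - 1)} \<le> real (4 * r) ^ (4 * r) / real k ^ j"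
      if T: "T \<in> [{..<m}]\<^bsup>j\<^esup>" for T
    proof -
      have "j * (r - 1) \<le> 4 * r" using j by (intro mult_mono) auto
      then have le: "j * (r - 1) \<le> k" using k by linarith
      have card: "card (T \<times> V) = j * r" using T by (simp add: nsets_def r_def card_cartesian_product)
      have jr: "j * r = j * (r - 1) + j" using r by (metis Suc_pred' mult_Suc_right add.commute)
      have "measure_pmf.prob M {f. card (f ` (T \<times> V)) \<le> j * (r - 1)}
          \<le> real k ^ (j * (r - 1)) * (real (j * (r - 1)) / real k) ^ (j * r)"
        unfolding M_def card[symmetric]
        by (rule prob_small_image_le) (use finX T le k in \<open>auto simp: X_def nsets_def\<close>)
      also have "\<dots> = real (j * (r - 1)) ^ (j * r) / real k ^ j"
        using k(2) by (simp add: power_divide jr power_add)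
      also have "\<dots> \<le> real (4 * r) ^ (j * r) / real k ^ j"
        using \<open>j * (r - 1) \<le> 4 * r\<close> by (intro divide_right_mono power_mono of_nat_mono) auto
      also have "\<dots> \<le> real (4 * r) ^ (4 * r) / real k ^ j"
        using j r by (intro divide_right_mono power_increasing) auto
      finally show ?thesis .
    qed
    then have "measure_pmf.prob M {f. real (card (bad j f)) > 10 * c}
        \<le> real (card ([{..<m}]\<^bsup>j\<^esup>)) * (real (4 * r) ^ (4 * r) / real k ^ j) / (10 * c)"
      unfolding bad_def using c by (intro prob_count_gt_le finM) (auto simp: finite_imp_finite_nsets)
    also have "\<dots> \<le> real m ^ j * (real (4 * r) ^ (4 * r) / real k ^ j) / (10 * c)"
      using c card_nsets_le_power[of "{..<m}" j] by (intro divide_right_mono mult_right_mono) auto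
    also have "\<dots> = real C ^ j * real (4 * r) ^ (4 * r) / (10 * c)"
      using k(2) by (simp add: m_def power_mult_distrib)
    also have "\<dots> \<le> c / (10 * c)"
      unfolding c_def using C j by (intro divide_right_mono mult_right_mono power_increasing) auto
    also have "\<dots> = 1 / 10" using c by simp
    finally show ?thesis .
  qed
  define Ds where "Ds = {D. D \<subseteq> {..<k} \<and> real (card D) \<ge> \<delta> * real k}"
  define cnt where "cnt D f = real (card {i\<in>{..<m}. \<forall>x\<in>{i} \<times> V. f x \<in> D})" for D and f :: "nat \<times> 'v \<Rightarrow> nat"
  have "measure_pmf.prob M {f. cnt D f \<le> T\<^sub>0} \<le> exp T\<^sub>0 * exp (- 2 * real k)" if D: "D \<in> Ds" for D
  proof -
    interpret independent_events X "\<lambda>_. pmf_of_set {..<k}" 0 "{..<m}" "\<lambda>i. {i} \<times> V"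
      "\<lambda>i f. \<forall>x\<in>{i} \<times> V. f x \<in> D"
      by standard (use finX k in \<open>auto simp: X_def disjoint_family_on_def depends_on_def set_pmf_uniform\<close>)
    have "measure_pmf.prob M {f. cnt D f \<le> T\<^sub>0} \<le> exp (1 * T\<^sub>0) * (1 - \<delta> ^ r * (1 - exp (- 1))) ^ card {..<m}"
      unfolding M_def cnt_def
    proof (rule prob_count_le)
      fix i assume i: "i \<in> {..<m}"
      have "\<delta> ^ r \<le> (real (card D) / real k) ^ r"
        using D k \<delta> by (intro power_mono) (auto simp: Ds_def field_simps)
      also have "\<dots> = measure_pmf.prob (Pi_pmf X 0 (\<lambda>_. pmf_of_set {..<k})) {f. \<forall>x\<in>{i} \<times> V. f x \<in> D}"
        using i D k finX by (subst prob_uniform_Pi_subset) (auto simp: X_def Ds_def r_def card_cartesian_product)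
      finally show "\<delta> ^ r \<le> measure_pmf.prob (Pi_pmf X 0 (\<lambda>_. pmf_of_set {..<k})) {f. \<forall>x\<in>{i} \<times> V. f x \<in> D}" .
    qed (use \<delta> in \<open>auto intro: power_le_one\<close>)
    also have "\<dots> \<le> exp T\<^sub>0 * exp (- (\<delta> ^ r / 2)) ^ m"
    proof -
      have "exp (- 1) \<le> (1/2::real)"
        using exp_ge_add_one_self[of "1::real"] by (simp add: exp_minus field_simps)
      then have "\<delta> ^ r * (1/2) \<le> \<delta> ^ r * (1 - exp (- 1))"
        using \<delta> by (intro mult_left_mono) auto
      moreover have "1 - \<delta> ^ r / 2 \<le> exp (- (\<delta> ^ r / 2))"
        using exp_ge_add_one_self[of "- (\<delta> ^ r / 2)"] by simp
      moreover have "\<delta> ^ r * (1 - exp (- 1)) \<le> 1 * 1"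
        using \<delta> by (intro mult_mono power_le_one) auto
      ultimately show ?thesis
        by (simp add: power_mono)
    qed
    also have "exp (- (\<delta> ^ r / 2)) ^ m = exp (- (real C * \<delta> ^ r) / 2 * real k)"
      by (simp add: exp_of_nat_mult[symmetric] m_def field_simps)
    also have "\<dots> \<le> exp (- 2 * real k)"
      using C by (intro iffD2[OF exp_le_cancel_iff] mult_right_mono) auto
    finally show ?thesis by simp
  qed
  then have "measure_pmf.prob M {f. \<exists>D\<in>Ds. cnt D f \<le> T\<^sub>0} \<le> real (card Ds) * (exp T\<^sub>0 * exp (- 2 * real k))"
    by (intro prob_UN_le) (auto simp: Ds_def)
  also have "\<dots> \<le> 2 ^ k * (exp T\<^sub>0 * exp (- 2 * real k))"
  proof (intro mult_right_mono)
    have "card Ds \<le> card (Pow {..<k})" by (intro card_mono) (auto simp: Ds_def)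
    then show "real (card Ds) \<le> 2 ^ k"
      by (simp add: card_Pow)
  qed auto
  also have "\<dots> = exp T\<^sub>0 * (2 * exp (-2)) ^ k"
    by (simp add: power_mult_distrib exp_of_nat_mult[symmetric] mult_ac)
  also have "\<dots> < 1 / 2" by (rule k)
  finally have prob_D: "measure_pmf.prob M {f. \<exists>D\<in>Ds. cnt D f \<le> T\<^sub>0} < 1 / 2" .
  have "measure_pmf.prob M {f. \<exists>j\<in>{1..4}. real (card (bad j f)) > 10 * c} \<le> real (card {1..4::nat}) * (1 / 10)"
    by (intro prob_UN_le prob_bad) auto
  then have "measure_pmf.prob M ({f. \<exists>j\<in>{1..4}. real (card (bad j f)) > 10 * c} \<union> {f. \<exists>D\<in>Ds. cnt D f \<le> T\<^sub>0}) < 1"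
    using measure_Un_le[of "{f. \<exists>j\<in>{1..4}. real (card (bad j f)) > 10 * c}" M "{f. \<exists>D\<in>Ds. cnt D f \<le> T\<^sub>0}"]
      prob_D by simp
  then obtain f where "f \<in> set_pmf M"
      "f \<notin> {f. \<exists>j\<in>{1..4}. real (card (bad j f)) > 10 * c} \<union> {f. \<exists>D\<in>Ds. cnt D f \<le> T\<^sub>0}"
    using prob_less_1_imp_ex by blast
  then have f: "f \<in> set_pmf M" "\<And>j. j \<in> {1..4} \<Longrightarrow> real (card (bad j f)) \<le> 10 * c"
      "\<And>D. D \<in> Ds \<Longrightarrow> cnt D f > T\<^sub>0"
    unfolding Un_iff mem_Collect_eq by (meson not_less)+
  have fk: "f x < k" if "x \<in> X" for x
    using f(1) that finX k by (cases x) (auto simp: M_def set_Pi_pmf PiE_dflt_def set_pmf_uniform)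
  \<comment> \<open>Deletion method: every edge occurring in some bad set is discarded. This removes
    at most \<open>T\<^sub>0\<close> edges, while every dense \<open>D\<close> contains more than
    \<open>T\<^sub>0\<close>.\<close>
  define R where "R = (\<Union>j\<in>{1..4}. \<Union>(bad j f))"
  define I where "I = {..<m} - R"
  have finbad: "finite (bad j f)" for j
    by (auto simp: bad_def finite_imp_finite_nsets)
  have R: "real (card R) \<le> T\<^sub>0"
  proof -
    have "card (\<Union>(bad j f)) \<le> 4 * card (bad j f)" if "j \<in> {1..4}" for j
    proof -
      have "card (\<Union>(bad j f)) \<le> (\<Sum>T\<in>bad j f. card T)"
        using card_UN_le[OF finbad, of "\<lambda>T. T" j] by simp
      also have "\<dots> \<le> of_nat (card (bad j f)) * 4"
        by (rule sum_bounded_above) (use that in \<open>auto simp: bad_def nsets_def\<close>)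
      finally show ?thesis by simp
    qed
    then have "real (card (\<Union>(bad j f))) \<le> 40 * c" if "j \<in> {1..4}" for j
      using f(2)[OF that] of_nat_mono[of "card (\<Union>(bad j f))" "4 * card (bad j f)", where 'a = real] that
      by fastforce
    then have "(\<Sum>j\<in>{1..4::nat}. real (card (\<Union>(bad j f)))) \<le> real (card {1..4::nat}) * (40 * c)"
      by (intro sum_bounded_above) auto
    moreover have "card R \<le> (\<Sum>j\<in>{1..4::nat}. card (\<Union>(bad j f)))"
      unfolding R_def by (rule card_UN_le) auto
    then have "real (card R) \<le> (\<Sum>j\<in>{1..4::nat}. real (card (\<Union>(bad j f))))"
      by (metis of_nat_le_iff of_nat_sum)
    ultimately show ?thesis by (simp add: T\<^sub>0_def)
  qed
  show ?thesis
  proof (rule that[of k I "\<lambda>i v. f (i, v)"])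
    show "k > 0" "finite I" by (auto simp: k I_def)
    show "(\<lambda>v. f (i, v)) ` V \<subseteq> {..<k}" if "i \<in> I" for i
      using that fk by (auto simp: I_def X_def)
    show "card (\<Union>i\<in>T. (\<lambda>v. f (i, v)) ` V) > card T * (card V - 1)"
      if T: "T \<subseteq> I" "T \<noteq> {}" "card T \<le> 4" for T
    proof (rule ccontr)
      assume neg: "\<not> ?thesis"
      have "finite T" using T(1) by (auto simp: I_def intro: finite_subset)
      then have j: "card T \<in> {1..4}" using T by (auto simp: Suc_le_eq card_gt_0_iff)
      have "(\<Union>i\<in>T. (\<lambda>v. f (i, v)) ` V) = f ` (T \<times> V)" by auto
      then have "T \<in> bad (card T) f"
        using neg T \<open>finite T\<close> by (auto simp: bad_def nsets_def I_def r_def)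
      then have "T \<subseteq> R" using j by (auto simp: R_def)
      then show False using T by (auto simp: I_def)
    qed
    show "\<exists>i\<in>I. (\<lambda>v. f (i, v)) ` V \<subseteq> D" if "D \<subseteq> {..<k}" "real (card D) \<ge> \<delta> * real k" for D
    proof (rule ccontr)
      assume neg: "\<not> ?thesis"
      have "finite R" by (auto simp: R_def finbad) (auto simp: bad_def nsets_def)
      moreover have "{i\<in>{..<m}. \<forall>x\<in>{i} \<times> V. f x \<in> D} \<subseteq> R"
        using neg by (auto simp: I_def)
      ultimately have "cnt D f \<le> real (card R)"
        unfolding cnt_def by (intro of_nat_mono card_mono)
      then show False
        using f(3)[of D] that R by (auto simp: Ds_def)
    qed
  qed
qed

section \<open>Copies of complete multipartite graphs and Erdos-Rogers graphs\<close>

text \<open>Parts are sets instead of the image of an embedding, which makes it easy to shrink or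
  discard them. They are disjoint as soon as \<open>R\<close> is irreflexive. Parts of size 0 are
  allowed, so that \<open>s[0 := s ! 0 - 1]\<close> makes sense when the smallest part is a single
  vertex.\<close>

definition multipartite_copy :: "('a \<Rightarrow> 'a \<Rightarrow> bool) \<Rightarrow> 'a set \<Rightarrow> nat list \<Rightarrow> (nat \<Rightarrow> 'a set) \<Rightarrow> bool" where
  "multipartite_copy R D s Q \<longleftrightarrow>
     (\<forall>i<length s. Q i \<subseteq> D \<and> finite (Q i) \<and> card (Q i) = s ! i) \<and>
     (\<forall>i<length s. \<forall>j<length s. i \<noteq> j \<longrightarrow> (\<forall>x\<in>Q i. \<forall>y\<in>Q j. R x y))"

lemma contains_copy_multipartite_iff:
  assumes H: "simple_graph H"
  shows "contains_copy H (complete_multipartite s)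
     \<longleftrightarrow> (\<exists>Q. multipartite_copy (\<lambda>x y. {x, y} \<in> edges H) (verts H) s Q)"
proof
  let ?V = "SIGMA i:{..<length s}. {..<s ! i}"
  assume "contains_copy H (complete_multipartite s)"
  then obtain f where f: "inj_on f ?V" "f ` ?V \<subseteq> verts H"
      and fE: "\<forall>e\<in>edges (complete_multipartite s). f ` e \<in> edges H"
    by (auto simp: contains_copy_def complete_multipartite_def Let_def)
  have e: "f ` {u, v} \<in> edges H" if "u \<in> ?V" "v \<in> ?V" "fst u \<noteq> fst v" for u v
  proof -
    have "{u, v} \<in> edges (complete_multipartite s)"
      using that unfolding complete_multipartite_def Let_def snd_conv by blast
    then show ?thesis using fE by blast
  qed
  have "multipartite_copy (\<lambda>x y. {x, y} \<in> edges H) (verts H) s (\<lambda>i. f ` ({i} \<times> {..<s ! i}))"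
    unfolding multipartite_copy_def
  proof (intro conjI allI impI ballI)
    fix i assume i: "i < length s"
    show "f ` ({i} \<times> {..<s ! i}) \<subseteq> verts H" using f(2) i by auto
    have "inj_on f ({i} \<times> {..<s ! i})" by (rule inj_on_subset[OF f(1)]) (use i in auto)
    then show "card (f ` ({i} \<times> {..<s ! i})) = s ! i"
      by (simp add: card_image card_cartesian_product)
  next
    fix i j x y assume "i < length s" "j < length s" "i \<noteq> j" "x \<in> f ` ({i} \<times> {..<s ! i})" "y \<in> f ` ({j} \<times> {..<s ! j})"
    then show "{x, y} \<in> edges H" using e by auto
  qed auto
  then show "\<exists>Q. multipartite_copy (\<lambda>x y. {x, y} \<in> edges H) (verts H) s Q" by blast
next
  assume "\<exists>Q. multipartite_copy (\<lambda>x y. {x, y} \<in> edges H) (verts H) s Q"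
  then obtain Q where "multipartite_copy (\<lambda>x y. {x, y} \<in> edges H) (verts H) s Q"
    by blast
  then have Q: "\<And>i. i < length s \<Longrightarrow> Q i \<subseteq> verts H \<and> finite (Q i) \<and> card (Q i) = s ! i"
      and adj: "\<And>i j x y. i < length s \<Longrightarrow> j < length s \<Longrightarrow> i \<noteq> j \<Longrightarrow> x \<in> Q i \<Longrightarrow> y \<in> Q j \<Longrightarrow> {x, y} \<in> edges H"
    unfolding multipartite_copy_def by simp_all
  have irrefl: "{x, x} \<notin> edges H" for x
    using H unfolding simple_graph_def by (auto simp: nsets_def)
  have "\<exists>h. bij_betw h {..<s ! i} (Q i)" if "i < length s" for i
    using Q[OF that] ex_bij_betw_nat_finite[of "Q i"] by (auto simp: atLeast0LessThan)
  then obtain h where h: "\<And>i. i < length s \<Longrightarrow> bij_betw (h i) {..<s ! i} (Q i)" by metis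
  then have hQ: "h i j \<in> Q i" if "i < length s" "j < s ! i" for i j
    using that by (auto simp: bij_betw_def)
  define f where "f = (\<lambda>(i, j). h i j)"
  have "inj_on f (SIGMA i:{..<length s}. {..<s ! i})"
  proof (rule inj_onI)
    fix u v assume u: "u \<in> (SIGMA i:{..<length s}. {..<s ! i})" and v: "v \<in> (SIGMA i:{..<length s}. {..<s ! i})"
      and eq: "f u = f v"
    have "f u \<in> Q (fst u)" "f v \<in> Q (fst v)" using u v hQ by (auto simp: f_def)
    then have "fst u = fst v"
      using adj[of "fst u" "fst v" "f u" "f v"] irrefl[of "f u"] eq u v by force
    then show "u = v"
      using u v eq h[of "fst u"] by (auto simp: f_def bij_betw_def inj_on_def)
  qed
  then show "contains_copy H (complete_multipartite s)"
    unfolding contains_copy_def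
  proof (intro exI[of _ f] conjI ballI)
    show "f ` verts (complete_multipartite s) \<subseteq> verts H"
      using hQ Q by (fastforce simp: complete_multipartite_def Let_def f_def)
    fix e assume "e \<in> edges (complete_multipartite s)"
    then obtain i j i' j' where "e = {(i, j), (i', j')}" "i < length s" "j < s ! i" "i' < length s" "j' < s ! i'" "i \<noteq> i'"
      by (auto simp: complete_multipartite_def Let_def)
    then show "f ` e \<in> edges H"
      using adj[of i i' "h i j" "h i' j'"] hQ by (simp add: f_def)
  qed (simp add: complete_multipartite_def Let_def)
qed

text \<open>Discarding one part of a copy leaves parts of sizes dominating the \<open>l - 1\<close> smallest ones.\<close>

lemma multipartite_copy_drop_part:
  assumes copy: "multipartite_copy R D s Q" and "sorted s" and \<alpha>: "\<alpha> < length s"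
  obtains Q' where "multipartite_copy R (\<Union>i\<in>{..<length s} - {\<alpha>}. Q i) (butlast s) Q'"
proof -
  \<comment> \<open>The increasing enumeration of the indices other than \<alpha>. It never lowers
    an index, so by sortedness \<open>Q (\<iota> i)\<close> has at least \<open>s ! i\<close>
    elements.\<close>
  define \<iota> where "\<iota> i = (if i < \<alpha> then i else Suc i)" for i :: nat
  have \<iota>: "\<iota> i < length s" "\<iota> i \<noteq> \<alpha>" "s ! i \<le> s ! \<iota> i" if "i < length s - 1" for i
    using that \<open>sorted s\<close> by (auto simp: \<iota>_def sorted_nth_mono)
  have inj: "\<iota> i \<noteq> \<iota> j" if "i \<noteq> j" for i j
    using that by (auto simp: \<iota>_def split: if_splits)
  have "\<exists>Y. Y \<subseteq> Q (\<iota> i) \<and> finite Y \<and> card Y = s ! i" if i: "i < length s - 1" for i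
  proof -
    have "finite (Q (\<iota> i))" "card (Q (\<iota> i)) = s ! \<iota> i"
      using copy \<iota>[OF i] unfolding multipartite_copy_def by blast+
    then show ?thesis
      using obtain_subset_with_card_n[of "s ! i" "Q (\<iota> i)"] \<iota>[OF i] by metis
  qed
  then obtain Q' where Q': "\<And>i. i < length s - 1 \<Longrightarrow> Q' i \<subseteq> Q (\<iota> i) \<and> finite (Q' i) \<and> card (Q' i) = s ! i"
    by metis
  have "multipartite_copy R (\<Union>i\<in>{..<length s} - {\<alpha>}. Q i) (butlast s) Q'"
    unfolding multipartite_copy_def
  proof (intro conjI allI impI ballI)
    fix i assume "i < length (butlast s)"
    then show "Q' i \<subseteq> (\<Union>i\<in>{..<length s} - {\<alpha>}. Q i)" "finite (Q' i)" "card (Q' i) = butlast s ! i"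
      using Q'[of i] \<iota>[of i] by (auto simp: nth_butlast)
  next
    fix i j x y assume "i < length (butlast s)" "j < length (butlast s)" and ij: "i \<noteq> j" and xy: "x \<in> Q' i" "y \<in> Q' j"
    then have i: "i < length s - 1" and j: "j < length s - 1" by auto
    have "x \<in> Q (\<iota> i)" "y \<in> Q (\<iota> j)" using Q'[OF i] Q'[OF j] xy by auto
    then show "R x y"
      using copy \<iota>(1)[OF i] \<iota>(1)[OF j] inj[OF ij] unfolding multipartite_copy_def by blast
  qed
  then show ?thesis by (rule that)
qed

lemma multipartite_copy_mono:
  assumes "multipartite_copy R D s Q" "D \<subseteq> D'" "\<And>x y. x \<in> D \<Longrightarrow> y \<in> D \<Longrightarrow> R x y \<Longrightarrow> R' x y"
  shows "multipartite_copy R' D' s Q"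
  using assms unfolding multipartite_copy_def by (meson subset_iff)

lemma multipartite_copy_image:
  assumes "multipartite_copy R D s Q" "inj_on f D" "\<And>x y. x \<in> D \<Longrightarrow> y \<in> D \<Longrightarrow> R x y \<Longrightarrow> R' (f x) (f y)"
  shows "multipartite_copy R' (f ` D) s (\<lambda>i. f ` Q i)"
  unfolding multipartite_copy_def
proof (intro conjI allI impI ballI)
  fix i assume i: "i < length s"
  then have Q: "Q i \<subseteq> D" "finite (Q i)" "card (Q i) = s ! i"
    using assms(1) unfolding multipartite_copy_def by auto
  then show "f ` Q i \<subseteq> f ` D" "finite (f ` Q i)" by auto
  show "card (f ` Q i) = s ! i"
    using Q inj_on_subset[OF assms(2) Q(1)] by (simp add: card_image)
next
  fix i j x y assume "i < length s" "j < length s" "i \<noteq> j" "x \<in> f ` Q i" "y \<in> f ` Q j"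
  then show "R' x y"
    using assms(1,3) unfolding multipartite_copy_def by (smt (verit) imageE subset_iff)
qed

text \<open>Any two adjacent edges of a complete multipartite graph other than a star lie on a common cycle
  of length three or four, so a copy in a union of gadgets without short Berge cycles stays in one gadget.\<close>

lemma erdos_rogers_multipartite:
  fixes \<delta> :: real
  assumes len: "length s \<ge> 2" and "sorted s" and pos: "\<forall>a\<in>set s. 0 < a" and \<delta>: "0 < \<delta>" "\<delta> \<le> 1"
  obtains k :: nat and R :: "nat \<Rightarrow> nat \<Rightarrow> bool"
  where "k > 0" "symp R" "irreflp R" "\<And>Q. \<not> multipartite_copy R {..<k} s Q"
    and "\<And>D. D \<subseteq> {..<k} \<Longrightarrow> real (card D) \<ge> \<delta> * real k \<Longrightarrow> \<exists>Q. multipartite_copy R D (s[0 := s ! 0 - 1]) Q"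
proof (cases "length s = 2 \<and> s ! 0 = 1")
  case True
  \<comment> \<open>The star: its adjacent edges lie on no cycle. Without its centre it has no
    edges, however, so the empty relation on enough points does both jobs.\<close>
  define k where "k = nat \<lceil>real (s ! 1) / \<delta>\<rceil>"
  have s1: "s ! 1 > 0" using pos len by auto
  have k: "real (s ! 1) \<le> \<delta> * real k"
  proof -
    have "real (s ! 1) / \<delta> \<le> real k" unfolding k_def by linarith
    then show ?thesis using \<delta> by (simp add: field_simps)
  qed
  show ?thesis
  proof (rule that[of k "\<lambda>_ _. False"])
    show "k > 0" using k s1 by (cases "k = 0") auto
    show "\<not> multipartite_copy (\<lambda>_ _. False) {..<k} s Q" for Q
    proof
      assume *: "multipartite_copy (\<lambda>_ _. False) {..<k} s Q"
      then have "card (Q 0) > 0" "card (Q 1) > 0"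
        using True s1 unfolding multipartite_copy_def by auto
      then obtain x y where "x \<in> Q 0" "y \<in> Q 1" by (metis card.empty equals0I less_irrefl)
      then show False using * True unfolding multipartite_copy_def by (metis one_less_numeral_iff pos2 semiring_norm(76) zero_neq_one)
    qed
    show "\<exists>Q. multipartite_copy (\<lambda>_ _. False) D (s[0 := s ! 0 - 1]) Q"
      if "D \<subseteq> {..<k}" "real (card D) \<ge> \<delta> * real k" for D
    proof -
      have "s ! 1 \<le> card D" using k that by linarith
      then obtain Y where "Y \<subseteq> D" "card Y = s ! 1" "finite Y" by (rule obtain_subset_with_card_n)
      then have "multipartite_copy (\<lambda>_ _. False) D (s[0 := s ! 0 - 1]) (\<lambda>i. if i = 1 then Y else {})"
        using True unfolding multipartite_copy_def by (auto simp: nth_list_update less_2_cases_iff)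
      then show ?thesis by blast
    qed
  qed (auto simp: symp_def irreflp_def)
next
  case False
  \<comment> \<open>Part sizes of one gadget. A vertex of part 0 is missing, so a gadget has
    \<open>r\<close> points whereas a copy of \<open>s\<close> needs \<open>r + 1\<close>; a copy
    confined to one gadget is thus impossible.\<close>
  define g where "g = s[0 := s ! 0 - 1]"
  define V where "V = (SIGMA i:{..<length s}. {..<g ! i})"
  define r where "r = card V"
  have finV: "finite V" by (auto simp: V_def)
  have cardV: "r = (\<Sum>i<length s. g ! i)" by (simp add: r_def V_def card_SigmaI)
  have split: "{..<length s} = insert 0 {1..<length s}" using len by auto
  have gi: "g ! i = (if i = 0 then s ! 0 - 1 else s ! i)" if "i < length s" for i
    using that by (auto simp: g_def)
  have l0: "0 < length s" using len by linarith
  have l1: "1 < length s" using len by linarith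
  have g0: "g ! 0 = s ! 0 - 1" using gi[OF l0] by simp
  have sgt: "s ! i > 0" if "i < length s" for i using pos that by auto
  have sum_s: "(\<Sum>i<length s. s ! i) = Suc r"
  proof -
    have "(\<Sum>i<length s. g ! i) = (s ! 0 - 1) + (\<Sum>i\<in>{1..<length s}. s ! i)"
      unfolding split by (subst sum.insert) (use gi g0 in \<open>auto intro!: sum.cong\<close>)
    then show ?thesis
      using sgt[OF l0] unfolding cardV split by (subst sum.insert) auto
  qed
  have V: "V \<noteq> {}"
  proof -
    have "(1, 0) \<in> V" using len gi[of 1] sgt[of 1] by (auto simp: V_def)
    then show ?thesis by blast
  qed
  obtain k :: nat and I :: "nat set" and \<phi> :: "nat \<Rightarrow> nat \<times> nat \<Rightarrow> nat"
    where k: "k > 0" and I: "finite I" "\<And>i. i \<in> I \<Longrightarrow> \<phi> i ` V \<subseteq> {..<k}"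
    and sparse: "\<And>T. T \<subseteq> I \<Longrightarrow> T \<noteq> {} \<Longrightarrow> card T \<le> 4 \<Longrightarrow> card (\<Union>i\<in>T. \<phi> i ` V) > card T * (card V - 1)"
    and dense: "\<And>D. D \<subseteq> {..<k} \<Longrightarrow> real (card D) \<ge> \<delta> * real k \<Longrightarrow> \<exists>i\<in>I. \<phi> i ` V \<subseteq> D"
    using sparse_hypergraph_exists[OF finV V \<delta>] by blast
  define E where "E i = \<phi> i ` V" for i
  have finE: "finite (E i)" for i by (simp add: E_def finV)
  have rpos: "r > 0" using V finV by (simp add: r_def card_gt_0_iff)
  have cardE: "card (E i) = r" if "i \<in> I" for i
    using sparse[of "{i}"] that card_image_le[OF finV, of "\<phi> i"] by (simp add: E_def r_def)
  have inj: "inj_on (\<phi> i) V" if "i \<in> I" for i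
    using cardE[OF that] finV by (simp add: E_def r_def eq_card_imp_inj_on)
  have span: "card (\<Union>i\<in>T. E i) > card T * (r - 1)" if "T \<subseteq> I" "T \<noteq> {}" "card T \<le> 4" for T
    using sparse[OF that] by (simp add: E_def r_def)
  \<comment> \<open>Two gadgets with two common points would span at most 2 r - 2 points. Likewise,
    in the next claim, three distinct gadgets around a triangle would span at most 3 r - 3, because
    the last one meets the union of the others in two points.\<close>
  have two: "x = y" if "i \<in> I" "j \<in> I" "i \<noteq> j" "x \<in> E i" "x \<in> E j" "y \<in> E i" "y \<in> E j" for i j x y
  proof (rule ccontr)
    assume "x \<noteq> y"
    then have "card {x, y} \<le> card (E i \<inter> E j)" using that finE by (intro card_mono) auto
    moreover have "card (E i \<union> E j) > 2 * (r - 1)" using span[of "{i, j}"] that by simp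
    ultimately show False
      using card_Un_Int[OF finE finE, of i j] cardE that \<open>x \<noteq> y\<close> by simp
  qed
  have le_card: "card (Y \<union> E j) + card Z \<le> card Y + r" if "j \<in> I" "finite Y" "Z \<subseteq> Y \<inter> E j" for Y Z j
    using card_Un_Int[OF that(2) finE, of j] cardE[OF that(1)] card_mono[OF _ that(3)] that(2) by simp
  have tri: "z \<in> E i" if ijl: "i \<in> I" "j \<in> I" "l \<in> I" and x: "x \<in> E i" "x \<in> E l" and y: "y \<in> E i" "y \<in> E j"
      and z: "z \<in> E j" "z \<in> E l" and ne: "x \<noteq> y" "y \<noteq> z" "x \<noteq> z" for i j l x y z
  proof (rule ccontr)
    assume "z \<notin> E i"
    then have d: "i \<noteq> j" "i \<noteq> l" using z by auto
    then have d': "j \<noteq> l" using two[of i j x y] ijl x y ne by auto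
    have "card (E i \<union> E j \<union> E l) > 3 * (r - 1)"
      using span[of "{i, j, l}"] ijl d d' by (simp add: Un_assoc)
    moreover have "card (E i \<union> E j \<union> E l) + card {x, z} \<le> card (E i \<union> E j) + r"
      using ijl x z finE by (intro le_card) auto
    moreover have "card (E i \<union> E j) + card {y} \<le> card (E i) + r"
      using ijl y finE by (intro le_card) auto
    ultimately show False using cardE ijl ne rpos by simp
  qed
  \<comment> \<open>The same count with the bound 4 r - 4. The claims \<open>two\<close> and
    \<open>tri\<close> dispose of the degenerate cases in which some of the four gadgets
    coincide.\<close>
  have quad: "z \<in> E i" if ijlm: "i \<in> I" "j \<in> I" "l \<in> I" "m \<in> I" and x: "x \<in> E m" "x \<in> E i" and y: "y \<in> E i" "y \<in> E j"
      and z: "z \<in> E j" "z \<in> E l" and w: "w \<in> E l" "w \<in> E m"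
      and ne: "x \<noteq> y" "y \<noteq> z" "z \<noteq> w" "w \<noteq> x" "x \<noteq> z" "y \<noteq> w" for i j l m x y z w
  proof (rule ccontr)
    assume nz: "z \<notin> E i"
    then have d1: "i \<noteq> j" "i \<noteq> l" using z by auto
    have d2: "m \<noteq> i" using tri[of i j l w y z] ijlm y z w ne nz by auto
    have d3: "j \<noteq> m" using two[of i j x y] d1 ijlm x y ne by auto
    have d4: "l \<noteq> m" using tri[of i j l x y z] ijlm x y z ne nz by auto
    have d5: "j \<noteq> l"
    proof
      assume "j = l"
      then have "x \<in> E j" using tri[of j m i y w x] ijlm x y w ne by auto
      then show False using two[of i j x y] d1 ijlm x y ne by auto
    qed
    have "card (E i \<union> E j \<union> E l \<union> E m) > 4 * (r - 1)"
      using span[of "{i, j, l, m}"] ijlm d1 d2 d3 d4 d5 by (simp add: Un_assoc)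
    moreover have "card (E i \<union> E j \<union> E l \<union> E m) + card {x, w} \<le> card (E i \<union> E j \<union> E l) + r"
      using ijlm x w finE by (intro le_card) auto
    moreover have "card (E i \<union> E j \<union> E l) + card {z} \<le> card (E i \<union> E j) + r"
      using ijlm z finE by (intro le_card) auto
    moreover have "card (E i \<union> E j) + card {y} \<le> card (E i) + r"
      using ijlm y finE by (intro le_card) auto
    ultimately show False using cardE ijlm ne rpos by simp
  qed
  define R where "R x y \<longleftrightarrow> (\<exists>i\<in>I. \<exists>u\<in>V. \<exists>v\<in>V. fst u \<noteq> fst v \<and> x = \<phi> i u \<and> y = \<phi> i v)" for x y
  have RE: "\<exists>i\<in>I. x \<in> E i \<and> y \<in> E i" if "R x y" for x y
    using that unfolding R_def E_def by auto
  have sym: "symp R" unfolding symp_def R_def by metis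
  have irr: "irreflp R"
    unfolding irreflp_def R_def by (metis inj inj_onD)
  have no: "\<not> multipartite_copy R {..<k} s Q" for Q
  proof
    assume copy: "multipartite_copy R {..<k} s Q"
    then have Q: "\<And>i. i < length s \<Longrightarrow> finite (Q i) \<and> card (Q i) = s ! i"
      and adj: "\<And>i j x y. i < length s \<Longrightarrow> j < length s \<Longrightarrow> i \<noteq> j \<Longrightarrow> x \<in> Q i \<Longrightarrow> y \<in> Q j \<Longrightarrow> R x y"
      unfolding multipartite_copy_def by blast+
    have ne: "x \<noteq> y" if "R x y" for x y using that irr unfolding irreflp_def by blast
    have disj: "Q i \<inter> Q j = {}" if "i < length s" "j < length s" "i \<noteq> j" for i j
      using adj that ne by blast
    have card1: "\<exists>x. x \<in> Q i" if "i < length s" for i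
      using Q[OF that] sgt[OF that] by (metis card.empty ex_in_conv less_irrefl)
    obtain x y where xy: "x \<in> Q 0" "y \<in> Q 1" using card1[OF l0] card1[OF l1] by auto
    have "R x y" using adj[OF l0 l1] xy by auto
    then obtain i where i: "i \<in> I" "x \<in> E i" "y \<in> E i" using RE by blast
    \<comment> \<open>Once an edge of the copy lies in gadget \<open>i\<close>, so does every vertex
      that forms a triangle with it; with three parts this spreads to the whole copy.\<close>
    have step: "z \<in> E i" if "a < length s" "b < length s" "c < length s" "a \<noteq> b" "b \<noteq> c" "a \<noteq> c"
        "u \<in> Q a" "v \<in> Q b" "z \<in> Q c" "u \<in> E i" "v \<in> E i" for a b c u v z
    proof -
      have "R u v" "R v z" "R u z" using adj that by blast+
      then show ?thesis
        using RE[of v z] RE[of u z] tri[of i _ _ u v z] ne that i by metis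
    qed
    have third: "Q c \<subseteq> E i" if "c < length s" "c \<noteq> 0" "c \<noteq> 1" for c
      using step[OF l0 l1, of c x y] that xy i by auto
    have all: "Q a \<subseteq> E i" if a: "a < length s" for a
    proof (cases "length s \<ge> 3")
      case True
      obtain w where w: "w \<in> Q 2" using card1[of 2] True by auto
      have wE: "w \<in> E i" using third[of 2] True w by auto
      have "Q 0 \<subseteq> E i" using step[OF l1 _ l0, of 2 y w] True xy w wE i by auto
      moreover have "Q 1 \<subseteq> E i" using step[OF l0 _ l1, of 2 x w] True xy w wE i by auto
      ultimately show ?thesis using third a by (cases "a = 0"; cases "a = 1") auto
    next
      case False2: False
      then have len2: "length s = 2" using len by simp
      then have s0: "s ! 0 \<ge> 2" using False sgt[of 0] by auto
      moreover have "s ! 0 \<le> s ! 1" using \<open>sorted s\<close> len2 by (simp add: sorted_nth_mono)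
      ultimately have s1: "s ! 1 \<ge> 2" by simp
      have other: "\<exists>w'\<in>Q b. w' \<noteq> w" if "b < 2" for b w
      proof (rule ccontr)
        assume "\<not> ?thesis"
        then have "Q b \<subseteq> {w}" by blast
        then have "card (Q b) \<le> 1" using card_mono[of "{w}" "Q b"] by simp
        then show False using Q[of b] that s0 s1 len2 by (auto simp: less_2_cases_iff)
      qed
      \<comment> \<open>With only two parts there are no triangles, but outside the star case both
        have at least two vertices, and the 4-cycle \<open>u\<close>, \<open>v\<close>,
        \<open>z\<close>, \<open>w\<close> takes over.\<close>
      have cyc: "z \<in> E i" if ab: "a < 2" "b < 2" "a \<noteq> b" and uv: "u \<in> Q a" "v \<in> Q b" "u \<in> E i" "v \<in> E i" and z: "z \<in> Q a" for a b u v z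
      proof (cases "z = u")
        case False
        obtain w where w: "w \<in> Q b" "w \<noteq> v" using other ab by blast
        have R: "R u v" "R v z" "R z w" "R w u" using adj ab uv z w len2 by auto
        obtain j l m where "j \<in> I" "v \<in> E j" "z \<in> E j" "l \<in> I" "z \<in> E l" "w \<in> E l" "m \<in> I" "w \<in> E m" "u \<in> E m"
          using R RE by metis
        then show ?thesis using quad[of i j l m u v z w] R ne i uv w False by blast
      qed (use uv in simp)
      have "Q 0 \<subseteq> E i" using cyc[of 0 1 x y] xy i by auto
      moreover have "Q 1 \<subseteq> E i" using cyc[of 1 0 y x] xy i by auto
      ultimately show ?thesis using a len2 by (auto simp: less_2_cases_iff)
    qed
    have "card (\<Union>a<length s. Q a) = (\<Sum>a<length s. card (Q a))"
      using Q disj by (intro card_UN_disjoint) auto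
    also have "\<dots> = Suc r" using Q sum_s by simp
    finally have "card (\<Union>a<length s. Q a) = Suc r" .
    moreover have "card (\<Union>a<length s. Q a) \<le> card (E i)" using all finE by (intro card_mono) auto
    ultimately show False using cardE i by simp
  qed
  have dense': "\<exists>Q. multipartite_copy R D g Q" if D: "D \<subseteq> {..<k}" "real (card D) \<ge> \<delta> * real k" for D
  proof -
    obtain i where i: "i \<in> I" "\<phi> i ` V \<subseteq> D" using dense[OF D] by blast
    have "multipartite_copy R D g (\<lambda>a. \<phi> i ` ({a} \<times> {..<g ! a}))"
      unfolding multipartite_copy_def
    proof (intro conjI allI impI ballI)
      fix a assume a: "a < length g"
      then have sub: "{a} \<times> {..<g ! a} \<subseteq> V" by (auto simp: V_def g_def)
      then show "\<phi> i ` ({a} \<times> {..<g ! a}) \<subseteq> D" using i(2) by blast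
      show "card (\<phi> i ` ({a} \<times> {..<g ! a})) = g ! a"
        using inj_on_subset[OF inj[OF i(1)] sub] by (simp add: card_image card_cartesian_product)
    next
      fix a b x y assume "a < length g" "b < length g" "a \<noteq> b" "x \<in> \<phi> i ` ({a} \<times> {..<g ! a})" "y \<in> \<phi> i ` ({b} \<times> {..<g ! b})"
      then show "R x y" using i(1) unfolding R_def V_def g_def by fastforce
    qed auto
    then show ?thesis by blast
  qed
  show ?thesis
    using that[OF k sym irr no] dense' unfolding g_def by blast
qed

section \<open>The deterministic lower bound\<close>

lemma simple_graph_add_edge:
  assumes "simple_graph H" "u \<noteq> v"
  shows "simple_graph (add_edge {u, v} H)"
  using assms unfolding simple_graph_def add_edge_def nsets_def by auto

text \<open>The copy created by the edge uv must use it, since \<open>H\<close> has none, so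
  \<open>u\<close> and \<open>v\<close> lie in different parts. Any vertex of a third part is joined
  to both, and by edges other than uv, hence by edges of \<open>H\<close>.\<close>

lemma saturated_common_neighbour:
  assumes sat: "saturated_in G (complete_multipartite s) H"
    and len: "length s \<ge> 3" and pos: "\<forall>a\<in>set s. 0 < a"
    and uv: "{u, v} \<in> edges G" "{u, v} \<notin> edges H" "u \<noteq> v"
  shows "\<exists>x. {u, x} \<in> edges H \<and> {v, x} \<in> edges H"
proof -
  let ?H = "add_edge {u, v} H"
  have H: "simple_graph H" and no: "\<not> contains_copy H (complete_multipartite s)"
    and "contains_copy ?H (complete_multipartite s)"
    using sat uv unfolding saturated_in_def subgraph_def by auto
  then obtain Q where copy: "multipartite_copy (\<lambda>x y. {x, y} \<in> edges ?H) (verts ?H) s Q"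
    using contains_copy_multipartite_iff[OF simple_graph_add_edge[OF H uv(3)]] by blast
  have Q: "finite (Q i)" "card (Q i) = s ! i" if "i < length s" for i
    using copy that unfolding multipartite_copy_def by auto
  have adj: "{x, y} \<in> edges H \<or> {x, y} = {u, v}"
    if "i < length s" "j < length s" "i \<noteq> j" "x \<in> Q i" "y \<in> Q j" for i j x y
  proof -
    have "{x, y} \<in> edges ?H"
      using copy that unfolding multipartite_copy_def by blast
    then show ?thesis by (auto simp: add_edge_def)
  qed
  have ne: "\<exists>x. x \<in> Q i" if "i < length s" for i
  proof -
    have "card (Q i) > 0" using Q[OF that] pos that by auto
    then show ?thesis by (metis card.empty ex_in_conv less_irrefl)
  qed
  have dist: "x \<noteq> y" if "i < length s" "j < length s" "i \<noteq> j" "x \<in> Q i" "y \<in> Q j" for i j x y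
  proof -
    have "{x, y} \<in> [verts H]\<^bsup>2\<^esup> \<or> {x, y} = {u, v}"
      using adj[OF that] H unfolding simple_graph_def by blast
    then show ?thesis using uv(3) by (auto simp: nsets_def doubleton_eq_iff)
  qed
  have "\<exists>i j x y. i < length s \<and> j < length s \<and> i \<noteq> j \<and> x \<in> Q i \<and> y \<in> Q j \<and> {x, y} = {u, v}"
  proof (rule ccontr)
    assume neg: "\<not> ?thesis"
    have adjH: "{x, y} \<in> edges H"
      if "i < length s" "j < length s" "i \<noteq> j" "x \<in> Q i" "y \<in> Q j" for i j x y
      using adj[OF that] neg that by blast
    have "multipartite_copy (\<lambda>x y. {x, y} \<in> edges H) (verts H) s Q"
      unfolding multipartite_copy_def
    proof (intro conjI allI impI ballI)
      fix i assume i: "i < length s"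
      \<comment> \<open>\<open>add_edge\<close> may have introduced \<open>u\<close> or
        \<open>v\<close> as new vertices. But if no pair of the copy is {u, v}, each of its vertices
        has an incident edge in \<open>H\<close>.\<close>
      show "Q i \<subseteq> verts H"
      proof
        fix x assume x: "x \<in> Q i"
        define j where "j = (if i = 0 then 1 else 0 :: nat)"
        have j: "j < length s" "i \<noteq> j" using i len by (auto simp: j_def split: if_splits)
        then obtain y where "y \<in> Q j" using ne by blast
        then have "{x, y} \<in> [verts H]\<^bsup>2\<^esup>"
          using adjH[OF i j x] H unfolding simple_graph_def by blast
        then show "x \<in> verts H" by (auto simp: nsets_def)
      qed
    qed (use Q adjH in auto)
    then show False using no contains_copy_multipartite_iff[OF H] by blast
  qed
  then obtain i j x y where ij: "i < length s" "j < length s" "i \<noteq> j" "x \<in> Q i" "y \<in> Q j" "{x, y} = {u, v}"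
    by blast
  have "\<exists>l<length s. l \<noteq> i \<and> l \<noteq> j"
  proof -
    have "card {i, j} < card {0..<length s}" using ij(3) len by simp
    then have "\<not> {0..<length s} \<subseteq> {i, j}"
      by (meson card_mono finite.intros not_less)
    then show ?thesis by auto
  qed
  then obtain l z where l: "l < length s" "l \<noteq> i" "l \<noteq> j" "z \<in> Q l" using ne by blast
  have "z \<noteq> x" "z \<noteq> y" using dist[of l i z x] dist[of l j z y] ij l by auto
  then have "{x, z} \<noteq> {u, v}" "{y, z} \<noteq> {u, v}" unfolding ij(6)[symmetric] by (auto simp: doubleton_eq_iff)
  then have "{x, z} \<in> edges H" "{y, z} \<in> edges H"
    using adj[of i l x z] adj[of j l y z] ij l by auto
  then show ?thesis using ij(6) by (auto simp: doubleton_eq_iff)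
qed

lemma card_ordered_pairs_le:
  assumes "finite E"
  shows "card {(x, y). {x, y} \<in> E} \<le> 2 * card E" "finite {(x, y). {x, y} \<in> E}"
proof -
  define f where "f e = {(x, y). {x, y} = e}" for e :: "'a set"
  have eq: "{(x, y). {x, y} \<in> E} = (\<Union>e\<in>E. f e)" by (auto simp: f_def)
  have f: "finite (f e) \<and> card (f e) \<le> 2" for e
  proof (cases "\<exists>x y. e = {x, y}")
    case True
    then obtain x y where e: "e = {x, y}" by blast
    have "f e \<subseteq> {(x, y), (y, x)}" by (auto simp: f_def e doubleton_eq_iff)
    moreover have "card {(x, y), (y, x)} \<le> 2" by (cases "x = y") auto
    ultimately show ?thesis
      using card_mono[of "{(x, y), (y, x)}" "f e"] finite_subset[of "f e" "{(x, y), (y, x)}"] by auto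
  next
    case False
    then have "f e = {}" by (auto simp: f_def)
    then show ?thesis by simp
  qed
  then show "finite {(x, y). {x, y} \<in> E}" unfolding eq using assms by blast
  have "card (\<Union>e\<in>E. f e) \<le> (\<Sum>e\<in>E. card (f e))" using assms by (rule card_UN_le)
  also have "\<dots> \<le> of_nat (card E) * 2" using f by (intro sum_bounded_above) auto
  finally show "card {(x, y). {x, y} \<in> E} \<le> 2 * card E" by (simp add: eq)
qed

text \<open>A vertex \<open>v\<close> of small degree reaches only few vertices through neighbours of small degree, so almost
  all of its neighbours in \<open>G\<close> must be adjacent to one of its neighbours of large degree.\<close>

lemma saturated_edges_lower_bound:
  fixes V :: "'a set" and E :: "'a set set" and K d :: nat
  assumes V: "finite V" and E: "E \<subseteq> [V]\<^bsup>2\<^esup>"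
    and sat: "saturated_in (V, E) (complete_multipartite s) H"
    and len: "length s \<ge> 3" and pos: "\<forall>a\<in>set s. 0 < a" and d: "d > 0"
    and many: "\<And>v S. v \<in> V \<Longrightarrow> S \<subseteq> V - {v} \<Longrightarrow> card S \<le> K \<Longrightarrow>
        card {u \<in> V - S - {v}. {u, v} \<in> E \<and> (\<forall>x\<in>S. {u, x} \<notin> E)} > d + d * d"
  shows "real K * (real (card V) - 2 * real (card (edges H)) / real d) \<le> real (card (edges H))"
proof -
  have HE: "edges H \<subseteq> E" using sat by (auto simp: saturated_in_def subgraph_def)
  have finE: "finite E" using E V finite_imp_finite_nsets finite_subset by blast
  have finH: "finite (edges H)" using HE finE finite_subset by blast
  have edgeV: "x \<in> V \<and> y \<in> V \<and> x \<noteq> y" if "{x, y} \<in> edges H" for x y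
    using that HE E by (auto simp: nsets_def card_insert_if)
  define N where "N v = {u. {v, u} \<in> edges H}" for v
  have NV: "N v \<subseteq> V" for v using edgeV by (auto simp: N_def)
  have finN: "finite (N v)" for v using NV V finite_subset by blast
  define A where "A = {v\<in>V. card (N v) \<ge> d}"
  have finA: "finite A" "A \<subseteq> V" using V by (auto simp: A_def)
  have big: "card (N v \<inter> A) \<ge> K" if v: "v \<in> V - A" for v
  proof (rule ccontr)
    assume small: "\<not> card (N v \<inter> A) \<ge> K"
    define S where "S = N v \<inter> A"
    have dv: "card (N v) \<le> d" using v by (auto simp: A_def)
    have S: "S \<subseteq> V - {v}" "card S \<le> K"
      using NV v small by (auto simp: S_def)
    have "{u \<in> V - S - {v}. {u, v} \<in> E \<and> (\<forall>x\<in>S. {u, x} \<notin> E)} \<subseteq> N v \<union> (\<Union>x\<in>N v - A. N x)"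
    proof
      fix u assume u: "u \<in> {u \<in> V - S - {v}. {u, v} \<in> E \<and> (\<forall>x\<in>S. {u, x} \<notin> E)}"
      show "u \<in> N v \<union> (\<Union>x\<in>N v - A. N x)"
      proof (cases "{u, v} \<in> edges H")
        case False
        obtain x where x: "{u, x} \<in> edges H" "{v, x} \<in> edges H"
          using saturated_common_neighbour[OF sat len pos, of u v] u False by auto
        then have "x \<in> N v" "u \<in> N x" by (auto simp: N_def insert_commute)
        moreover have "x \<notin> A"
          using x(1) u HE \<open>x \<in> N v\<close> by (auto simp: S_def)
        ultimately show ?thesis by blast
      qed (auto simp: N_def insert_commute)
    qed
    then have "card {u \<in> V - S - {v}. {u, v} \<in> E \<and> (\<forall>x\<in>S. {u, x} \<notin> E)} \<le> card (N v \<union> (\<Union>x\<in>N v - A. N x))"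
      using finN by (intro card_mono) auto
    also have "\<dots> \<le> card (N v) + card (\<Union>x\<in>N v - A. N x)" by (rule card_Un_le)
    also have "card (\<Union>x\<in>N v - A. N x) \<le> (\<Sum>x\<in>N v - A. card (N x))" using finN by (intro card_UN_le) auto
    also have "\<dots> \<le> of_nat (card (N v - A)) * d"
      using NV by (intro sum_bounded_above) (auto simp: A_def)
    also have "\<dots> \<le> d * d"
      using dv card_mono[of "N v" "N v - A"] finN by (intro mult_right_mono) auto
    finally show False using many[OF _ S] v dv by fastforce
  qed
  \<comment> \<open>Edges of \<open>H\<close> leaving \<open>A\<close>, oriented towards
    \<open>A\<close>: the orientation is determined by the edge, so none is counted twice.\<close>
  define X where "X = (SIGMA v:V - A. N v \<inter> A)"
  have "K * card (V - A) \<le> (\<Sum>v\<in>V - A. card (N v \<inter> A))"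
    using sum_bounded_below[of "V - A" K "\<lambda>v. card (N v \<inter> A)"] big by (simp add: mult.commute)
  also have "\<dots> = card X" using V finN by (simp add: X_def card_SigmaI)
  also have "card X \<le> card (edges H)"
  proof (rule card_inj_on_le[of "\<lambda>(v, x). {v, x}"])
    show "inj_on (\<lambda>(v, x). {v, x}) X" by (auto simp: inj_on_def X_def doubleton_eq_iff)
  qed (use finH in \<open>auto simp: X_def N_def\<close>)
  finally have 1: "K * card (V - A) \<le> card (edges H)" .
  have "d * card A \<le> (\<Sum>v\<in>A. card (N v))"
    using sum_bounded_below[of A d "\<lambda>v. card (N v)"] by (simp add: A_def mult.commute)
  also have "\<dots> = card (SIGMA v:A. N v)" using finA finN by (simp add: card_SigmaI)
  also have "\<dots> \<le> card {(x, y). {x, y} \<in> edges H}"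
    using card_ordered_pairs_le[OF finH] by (intro card_mono) (auto simp: N_def)
  also have "\<dots> \<le> 2 * card (edges H)" by (rule card_ordered_pairs_le[OF finH])
  finally have "real (card A) \<le> 2 * real (card (edges H)) / real d"
    using d by (simp add: field_simps flip: of_nat_mult)
  then have "real K * (real (card V) - 2 * real (card (edges H)) / real d) \<le> real K * (real (card V) - real (card A))"
    by (intro mult_left_mono) auto
  also have "\<dots> = real (K * card (V - A))"
    using finA V by (simp add: card_Diff_subset of_nat_diff card_mono)
  also have "\<dots> \<le> real (card (edges H))" using 1 by (rule of_nat_mono)
  finally show ?thesis .
qed

text \<open>An edge set maximal among the copy-free ones between \<open>E\<^sub>0\<close> and
  \<open>E\<close>. It is taken on all of \<open>V\<close>, so adding an edge brings no new vertex
  and saturation is exactly maximality.\<close>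

lemma saturated_extension_exists:
  assumes V: "finite V" and E: "E \<subseteq> [V]\<^bsup>2\<^esup>" and E\<^sub>0: "E\<^sub>0 \<subseteq> E"
    and free\<^sub>0: "\<And>Q. \<not> multipartite_copy (\<lambda>x y. {x, y} \<in> E\<^sub>0) V s Q"
  obtains F where "E\<^sub>0 \<subseteq> F" "F \<subseteq> E" "saturated_in (V, E) (complete_multipartite s) (V, F)"
    "\<And>Q. \<not> multipartite_copy (\<lambda>x y. {x, y} \<in> F) V s Q"
proof -
  define \<F> where "\<F> = {F. E\<^sub>0 \<subseteq> F \<and> F \<subseteq> E \<and> (\<forall>Q. \<not> multipartite_copy (\<lambda>x y. {x, y} \<in> F) V s Q)}"
  have "finite E" using E V finite_imp_finite_nsets finite_subset by blast
  then have "finite \<F>" by (intro finite_subset[of \<F> "Pow E"]) (auto simp: \<F>_def)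
  moreover have "E\<^sub>0 \<in> \<F>"
    using free\<^sub>0 E\<^sub>0 by (auto simp: \<F>_def)
  ultimately obtain F where F: "F \<in> \<F>" and max: "\<And>F'. F' \<in> \<F> \<Longrightarrow> F \<subseteq> F' \<Longrightarrow> F = F'"
    using finite_has_maximal[of \<F>] by blast
  have sub: "E\<^sub>0 \<subseteq> F" "F \<subseteq> E" and free: "\<And>Q. \<not> multipartite_copy (\<lambda>x y. {x, y} \<in> F) V s Q"
    using F by (auto simp: \<F>_def)
  have simple: "simple_graph (V, F')" if "F' \<subseteq> E" for F'
    using that E by (auto simp: simple_graph_def)
  have "contains_copy (add_edge e (V, F)) (complete_multipartite s)" if e: "e \<in> E - F" for e
  proof (rule ccontr)
    assume neg: "\<not> ?thesis"
    have "e \<subseteq> V" using e E by (auto simp: nsets_def)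
    then have add: "add_edge e (V, F) = (V, insert e F)" by (auto simp: add_edge_def)
    have ins: "insert e F \<subseteq> E" using e sub by auto
    have "insert e F \<in> \<F>"
      using neg ins sub contains_copy_multipartite_iff[OF simple[OF ins], of s] unfolding add by (auto simp: \<F>_def)
    then show False using max[of "insert e F"] e by auto
  qed
  then have "saturated_in (V, E) (complete_multipartite s) (V, F)"
    using contains_copy_multipartite_iff[OF simple[OF sub(2)], of s] free sub simple[OF sub(2)]
    by (auto simp: saturated_in_def subgraph_def)
  then show ?thesis using that sub free by blast
qed

lemma sat_attained:
  assumes V: "finite V" and E: "E \<subseteq> [V]\<^bsup>2\<^esup>" and len: "length s \<ge> 3" and pos: "\<forall>a\<in>set s. 0 < a"
  obtains H where "saturated_in (V, E) (complete_multipartite s) H"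
    "sat (V, E) (complete_multipartite s) = card (edges H)"
proof -
  have l: "0 < length s" "1 < length s" using len by linarith+
  have "\<not> multipartite_copy (\<lambda>x y. {x, y} \<in> {}) V s Q" for Q
  proof
    assume copy: "multipartite_copy (\<lambda>x y. {x, y} \<in> {}) V s Q"
    have "card (Q 0) > 0" "card (Q 1) > 0"
      using copy pos l unfolding multipartite_copy_def by auto
    then obtain x y where "x \<in> Q 0" "y \<in> Q 1" by (metis card.empty ex_in_conv less_irrefl)
    then show False using copy l unfolding multipartite_copy_def by (metis empty_iff zero_neq_one)
  qed
  then obtain F where "saturated_in (V, E) (complete_multipartite s) (V, F)"
    using saturated_extension_exists[OF V E empty_subsetI] by metis
  then have "(\<lambda>H. card (edges H)) ` {H. saturated_in (V, E) (complete_multipartite s) H} \<noteq> {}" by blast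
  then have "sat (V, E) (complete_multipartite s) \<in> (\<lambda>H. card (edges H)) ` {H. saturated_in (V, E) (complete_multipartite s) H}"
    unfolding sat_def by (rule Inf_nat_def1)
  then show ?thesis using that by auto
qed

section \<open>Blocks of cliques\<close>

text \<open>Disjoint cliques of size \<open>k\<close>. A block is a function on positions rather
  than a set, so that a relation \<open>R\<close> on \<open>{..<k}\<close> can be transplanted into
  every block and positions in different blocks can be compared.\<close>

definition block_family :: "'a set set \<Rightarrow> nat \<Rightarrow> 'a set \<Rightarrow> (nat \<Rightarrow> 'a) set \<Rightarrow> bool" where
  "block_family E k X \<B> \<longleftrightarrow> finite \<B> \<and>
     (\<forall>b\<in>\<B>. inj_on b {..<k} \<and> b ` {..<k} \<subseteq> X \<and> (\<forall>i<k. \<forall>j<k. i \<noteq> j \<longrightarrow> {b i, b j} \<in> E)) \<and>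
     (\<forall>b\<in>\<B>. \<forall>b'\<in>\<B>. \<forall>i<k. \<forall>j<k. b i = b' j \<longrightarrow> b = b')"

definition block_cover :: "nat \<Rightarrow> (nat \<Rightarrow> 'a) set \<Rightarrow> 'a set" where
  "block_cover k \<B> = (\<Union>b\<in>\<B>. b ` {..<k})"

definition in_block :: "nat \<Rightarrow> (nat \<Rightarrow> nat \<Rightarrow> bool) \<Rightarrow> (nat \<Rightarrow> 'a) set \<Rightarrow> 'a \<Rightarrow> 'a \<Rightarrow> bool" where
  "in_block k R \<B> x y \<longleftrightarrow> (\<exists>b\<in>\<B>. \<exists>i<k. \<exists>j<k. R i j \<and> x = b i \<and> y = b j)"

definition clique_rich :: "'a set set \<Rightarrow> nat \<Rightarrow> real \<Rightarrow> 'a set \<Rightarrow> bool" where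
  "clique_rich E k \<eta> X \<longleftrightarrow>
     (\<forall>Y\<subseteq>X. real (card Y) \<ge> \<eta> * real (card X) \<longrightarrow> (\<exists>K\<subseteq>Y. card K = k \<and> [K]\<^bsup>2\<^esup> \<subseteq> E))"

lemma block_cover_subset: "block_family E k X \<B> \<Longrightarrow> block_cover k \<B> \<subseteq> X"
  by (auto simp: block_family_def block_cover_def)

lemma block_family_inj:
  assumes "block_family E k X \<B>" "b \<in> \<B>" "b' \<in> \<B>" "i < k" "j < k" "b i = b' j"
  shows "b = b' \<and> i = j"
proof -
  have eq: "b = b'" using assms unfolding block_family_def by blast
  have "inj_on b {..<k}" using assms unfolding block_family_def by blast
  then show ?thesis using assms eq by (auto simp: inj_on_def)
qed

lemma card_block_cover:
  assumes "block_family E k X \<B>"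
  shows "card (block_cover k \<B>) = k * card \<B>" "finite (block_cover k \<B>)"
proof -
  have "card (block_cover k \<B>) = (\<Sum>b\<in>\<B>. card (b ` {..<k}))"
    unfolding block_cover_def
  proof (rule card_UN_disjoint)
    show "\<forall>b\<in>\<B>. \<forall>b'\<in>\<B>. b \<noteq> b' \<longrightarrow> b ` {..<k} \<inter> b' ` {..<k} = {}"
      using block_family_inj[OF assms] by blast
  qed (use assms in \<open>auto simp: block_family_def\<close>)
  also have "\<dots> = (\<Sum>b\<in>\<B>. k)"
    using assms by (intro sum.cong) (auto simp: block_family_def card_image)
  finally show "card (block_cover k \<B>) = k * card \<B>" by simp
  show "finite (block_cover k \<B>)" using assms by (auto simp: block_family_def block_cover_def)
qed

text \<open>Greedy choice: as long as the part not yet covered has at least \<eta> |X| points, it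
  contains another clique. The induction is over this remaining part \<open>Y\<close>, while the
  threshold refers to the fixed \<open>X\<close>.\<close>

lemma block_family_exists:
  assumes X: "finite X" and rich: "clique_rich E k \<eta> X" and k: "k > 0"
    and \<eta>: "\<eta> * real (card X) > 0"
  shows "\<exists>\<B>. block_family E k X \<B> \<and> real (card (X - block_cover k \<B>)) < \<eta> * real (card X)"
proof -
  have "\<exists>\<B>. block_family E k Y \<B> \<and> real (card (Y - block_cover k \<B>)) < \<eta> * real (card X)" if "Y \<subseteq> X" for Y
    using that
  proof (induction "card Y" arbitrary: Y rule: less_induct)
    case less
    have finY: "finite Y" using less.prems X finite_subset by blast
    show ?case
    proof (cases "real (card Y) < \<eta> * real (card X)")
      case True
      then show ?thesis by (intro exI[of _ "{}"]) (auto simp: block_family_def block_cover_def)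
    next
      case False
      then obtain K where K: "K \<subseteq> Y" "card K = k" "[K]\<^bsup>2\<^esup> \<subseteq> E"
        using rich less.prems unfolding clique_rich_def by (meson not_less)
      have finK: "finite K" using K finY finite_subset by blast
      then obtain b where b: "bij_betw b {..<k} K"
        using ex_bij_betw_nat_finite[of K] K by (auto simp: atLeast0LessThan)
      have "card (Y - K) < card Y"
        using K k finY finK card_mono[OF finY K(1)] by (simp add: card_Diff_subset)
      then obtain \<B> where \<B>: "block_family E k (Y - K) \<B>"
          "real (card (Y - K - block_cover k \<B>)) < \<eta> * real (card X)"
        using less.hyps[of "Y - K"] less.prems by blast
      have bK: "b i \<in> K" if "i < k" for i using b that by (auto simp: bij_betw_def)
      have old: "b' i \<notin> K" if "b' \<in> \<B>" "i < k" for b' i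
        using \<B>(1) that by (auto simp: block_family_def)
      have old': "inj_on b' {..<k} \<and> b' ` {..<k} \<subseteq> Y - K" if "b' \<in> \<B>" for b'
        using \<B>(1) that unfolding block_family_def by blast
      have new: "inj_on b {..<k} \<and> b ` {..<k} \<subseteq> Y" using b K(1) by (auto simp: bij_betw_def)
      have "block_family E k Y (insert b \<B>)"
        unfolding block_family_def
      proof (intro conjI ballI allI impI)
        show "finite (insert b \<B>)" using \<B> by (auto simp: block_family_def)
      next
        fix b' assume "b' \<in> insert b \<B>"
        then show "inj_on b' {..<k}" "b' ` {..<k} \<subseteq> Y"
          using old'[of b'] new by blast+
      next
        fix b' i j assume b': "b' \<in> insert b \<B>" and ij: "i < k" "j < k" "i \<noteq> j"
        show "{b' i, b' j} \<in> E"
        proof (cases "b' = b")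
          case True
          have "b i \<noteq> b j" using b ij by (auto simp: bij_betw_def inj_on_def)
          then have "{b i, b j} \<in> [K]\<^bsup>2\<^esup>" using bK ij by auto
          then show ?thesis using True K by blast
        qed (use \<B> b' ij in \<open>auto simp: block_family_def\<close>)
      next
        fix b1 b2 i j assume "b1 \<in> insert b \<B>" "b2 \<in> insert b \<B>" "i < k" "j < k" "b1 i = b2 j"
        then show "b1 = b2"
          using bK old block_family_inj[OF \<B>(1), of b1 b2 i j] by auto metis+
      qed
      moreover have "Y - block_cover k (insert b \<B>) = Y - K - block_cover k \<B>"
        using b by (auto simp: block_cover_def bij_betw_def)
      ultimately show ?thesis using \<B>(2) by metis
    qed
  qed
  then show ?thesis by blast
qed

text \<open>A complete multipartite graph with at least two nonempty parts is connected, and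
  \<open>in_block\<close> has no edges between different blocks. A copy therefore lies in one block
  and pulls back to the positions.\<close>

lemma in_block_multipartite_free:
  assumes bf: "block_family E k X \<B>" and len: "length s \<ge> 2" and pos: "\<forall>a\<in>set s. 0 < a"
    and free: "\<And>Q. \<not> multipartite_copy R {..<k} s Q"
  shows "\<not> multipartite_copy (in_block k R \<B>) D s Q"
proof
  assume copy: "multipartite_copy (in_block k R \<B>) D s Q"
  have adj: "in_block k R \<B> x y" if "i < length s" "j < length s" "i \<noteq> j" "x \<in> Q i" "y \<in> Q j" for i j x y
    using copy that unfolding multipartite_copy_def by blast
  have ne: "\<exists>x. x \<in> Q i" if "i < length s" for i
  proof -
    have "card (Q i) > 0" using copy pos that unfolding multipartite_copy_def by auto
    then show ?thesis by (metis card.empty ex_in_conv less_irrefl)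
  qed
  have l: "0 < length s" "1 < length s" using len by linarith+
  obtain x y where xy: "x \<in> Q 0" "y \<in> Q 1" using ne l by blast
  obtain b where b: "b \<in> \<B>" "x \<in> b ` {..<k}" "y \<in> b ` {..<k}"
    using adj[OF l _ xy] unfolding in_block_def by auto
  have same: "v \<in> b ` {..<k}" if "in_block k R \<B> u v" "u \<in> b ` {..<k}" for u v
    using that block_family_inj[OF bf _ b(1)] unfolding in_block_def by blast
  have sub: "Q i \<subseteq> b ` {..<k}" if i: "i < length s" for i
  proof
    fix z assume z: "z \<in> Q i"
    show "z \<in> b ` {..<k}"
    proof (cases "i = 0")
      case True
      then show ?thesis using adj[OF l(2) i _ xy(2) z] same b by auto
    next
      case False
      then show ?thesis using adj[OF l(1) i _ xy(1) z] same b by auto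
    qed
  qed
  have inj: "inj_on b {..<k}" using bf b(1) by (auto simp: block_family_def)
  have "multipartite_copy (in_block k R \<B>) (b ` {..<k}) s Q"
    using copy sub unfolding multipartite_copy_def by blast
  then have "multipartite_copy R (the_inv_into {..<k} b ` (b ` {..<k})) s (\<lambda>i. the_inv_into {..<k} b ` Q i)"
  proof (rule multipartite_copy_image)
    show "inj_on (the_inv_into {..<k} b) (b ` {..<k})" using inj by (rule inj_on_the_inv_into)
    fix u v assume "u \<in> b ` {..<k}" "v \<in> b ` {..<k}" "in_block k R \<B> u v"
    then obtain b' i j where "b' \<in> \<B>" "i < k" "j < k" "R i j" "u = b' i" "v = b' j"
      unfolding in_block_def by blast
    moreover have "b' = b"
      using block_family_inj[OF bf \<open>b' \<in> \<B>\<close> b(1) \<open>i < k\<close>] \<open>u \<in> b ` {..<k}\<close> \<open>u = b' i\<close> by auto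
    ultimately show "R (the_inv_into {..<k} b u) (the_inv_into {..<k} b v)"
      using inj by (simp add: the_inv_into_f_f)
  qed
  moreover have "the_inv_into {..<k} b ` (b ` {..<k}) = {..<k}"
    using inj by (metis the_inv_into_onto)
  ultimately show False using free by metis
qed

text \<open>Pigeonhole over the pairs of a block and a subset of its positions: if the centre had many leaves, then
  \<open>last s\<close> of them would see the same gadget, which together with the centre and these leaves is a copy.\<close>

lemma star_leaves_bound:
  fixes \<delta> :: real
  assumes bf: "block_family E k X \<B>" and \<B>: "\<B> \<noteq> {}" and k: "k > 0" and \<delta>: "\<delta> > 0"
    and len: "length s \<ge> 3" and pos: "\<forall>a\<in>set s. 0 < a"
    and H: "F \<subseteq> [V]\<^bsup>2\<^esup>" and free: "\<And>Q. \<not> multipartite_copy (\<lambda>x y. {x, y} \<in> F) V s Q"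
    and gadget: "\<And>x y. in_block k R \<B> x y \<Longrightarrow> {x, y} \<in> F"
    and dense: "\<And>D. D \<subseteq> {..<k} \<Longrightarrow> real (card D) \<ge> \<delta> / 2 * real k \<Longrightarrow>
        \<exists>Q. multipartite_copy R D ((butlast s)[0 := butlast s ! 0 - 1]) Q"
    and L: "finite L" "\<And>v. v \<in> L \<Longrightarrow> {c, v} \<in> F"
    and common: "\<And>v. v \<in> L \<Longrightarrow> real (card {x \<in> block_cover k \<B>. {c, x} \<in> F \<and> {v, x} \<in> F}) \<ge> \<delta> * real (k * card \<B>)"
  shows "real (card L) \<le> 2 ^ (k + 1) * real (last s) / \<delta>"
proof -
  define D where "D v b = {i. i < k \<and> {c, b i} \<in> F \<and> {v, b i} \<in> F}" for v b
  have D: "D v b \<subseteq> {..<k}" "finite (D v b)" "card (D v b) \<le> k" for v b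
    using card_mono[of "{..<k}" "D v b"] by (auto simp: D_def)
  define rich where "rich v = {b\<in>\<B>. real (card (D v b)) \<ge> \<delta> / 2 * real k}" for v
  have finB: "finite \<B>" using bf by (simp add: block_family_def)
  \<comment> \<open>Averaging: if the common neighbourhood has density \<delta> in the cover, then a
    fraction of at least \<delta> / 2 of the blocks meet it in density at least \<delta> /
    2.\<close>
  have many: "real (card (rich v)) \<ge> \<delta> / 2 * real (card \<B>)" if v: "v \<in> L" for v
  proof -
    have "{x \<in> block_cover k \<B>. {c, x} \<in> F \<and> {v, x} \<in> F} \<subseteq> (\<Union>b\<in>\<B>. b ` D v b)"
      by (auto simp: block_cover_def D_def)
    then have "card {x \<in> block_cover k \<B>. {c, x} \<in> F \<and> {v, x} \<in> F} \<le> card (\<Union>b\<in>\<B>. b ` D v b)"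
      using finB D by (intro card_mono) auto
    also have "\<dots> \<le> (\<Sum>b\<in>\<B>. card (b ` D v b))" using finB by (rule card_UN_le)
    also have "\<dots> \<le> (\<Sum>b\<in>\<B>. card (D v b))" using D by (intro sum_mono card_image_le)
    finally have "\<delta> * real (k * card \<B>) \<le> real (\<Sum>b\<in>\<B>. card (D v b))"
      using common[OF v] of_nat_mono by (meson order_trans)
    also have "\<dots> = (\<Sum>b\<in>\<B>. real (card (D v b)))" by simp
    also have "\<dots> \<le> (\<Sum>b\<in>\<B>. (if b \<in> rich v then real k else 0) + \<delta> / 2 * real k)"
      using D \<delta> by (intro sum_mono) (auto simp: rich_def add_increasing2)
    also have "\<dots> = real (card (rich v)) * real k + real (card \<B>) * (\<delta> / 2 * real k)"
    proof -
      have "\<B> \<inter> {b. b \<in> rich v} = rich v" by (auto simp: rich_def)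
      then show ?thesis using finB by (simp add: sum.distrib sum.If_cases)
    qed
    finally have "\<delta> / 2 * real (card \<B>) * real k \<le> real (card (rich v)) * real k"
      by (simp add: algebra_simps)
    then show ?thesis using k by simp
  qed
  define P where "P = (SIGMA v:L. rich v)"
  \<comment> \<open>The pigeonhole key of a leaf and a rich block: the block together with the exact
    set of positions adjacent to both centre and leaf. There are at most |\<open>\<B>\<close>| 2^k
    keys, and |\<open>\<B>\<close>| cancels in the end, so the bound is independent of the number of
    blocks.\<close>
  define g where "g = (\<lambda>(v, b). (b, D v b))"
  have finr: "finite (rich v)" for v using finB by (auto simp: rich_def)
  then have finP: "finite P" using L by (auto simp: P_def)
  have "(\<Sum>v\<in>L. \<delta> / 2 * real (card \<B>)) \<le> (\<Sum>v\<in>L. real (card (rich v)))"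
    using many by (intro sum_mono)
  then have lower: "real (card L) * (\<delta> / 2 * real (card \<B>)) \<le> real (card P)"
    using L finr by (simp add: P_def card_SigmaI)
  have irr: "x \<noteq> y \<and> x \<in> V \<and> y \<in> V" if "{x, y} \<in> F" for x y using that H by (auto simp: nsets_def card_insert_if)
  have fibre: "card {z\<in>P. g z = w} \<le> last s" for w
  proof (rule ccontr)
    assume neg: "\<not> ?thesis"
    obtain b D\<^sub>0 where w: "w = (b, D\<^sub>0)" by (cases w)
    define L\<^sub>0 where "L\<^sub>0 = {v\<in>L. b \<in> rich v \<and> D v b = D\<^sub>0}"
    have "{z\<in>P. g z = w} = (\<lambda>v. (v, b)) ` L\<^sub>0" by (auto simp: P_def g_def w L\<^sub>0_def)
    then have "card {z\<in>P. g z = w} = card L\<^sub>0" by (simp add: card_image inj_on_def)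
    then have cl: "last s \<le> card L\<^sub>0" and "L\<^sub>0 \<noteq> {}" using neg by auto
    then obtain v0 where v0: "v0 \<in> L\<^sub>0" by blast
    obtain L1 where L1: "L1 \<subseteq> L\<^sub>0" "card L1 = last s" "finite L1"
      using obtain_subset_with_card_n[OF cl] by blast
    have bB: "b \<in> \<B>" and D0: "D\<^sub>0 \<subseteq> {..<k}" "real (card D\<^sub>0) \<ge> \<delta> / 2 * real k"
      using v0 D(1) by (auto simp: L\<^sub>0_def rich_def)
    obtain Q where Q: "multipartite_copy R D\<^sub>0 ((butlast s)[0 := butlast s ! 0 - 1]) Q" using dense[OF D0] by blast
    define l where "l = length s - 1"
    have l: "l \<ge> 2" "length s = Suc l" using len by (auto simp: l_def)
    have "s \<noteq> []" using len by auto
    then have ls: "last s = s ! l" by (simp add: last_conv_nth l_def)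
    have lb: "length (butlast s) = l" by (simp add: l_def)
    have Qi: "Q i \<subseteq> D\<^sub>0" "finite (Q i)" "card (Q i) = (if i = 0 then s ! 0 - 1 else s ! i)" if "i < l" for i
      using Q that unfolding multipartite_copy_def by (auto simp: lb nth_list_update nth_butlast simp del: length_butlast)
    have QR: "R x y" if "i < l" "j < l" "i \<noteq> j" "x \<in> Q i" "y \<in> Q j" for i j x y
      using Q that unfolding multipartite_copy_def by (simp add: lb del: length_butlast)
    have inj: "inj_on b {..<k}" using bf bB by (auto simp: block_family_def)
    have cb: "{c, b i} \<in> F" if "i \<in> D\<^sub>0" for i
      using that v0 by (auto simp: L\<^sub>0_def D_def)
    have vb: "{v, b i} \<in> F" if "i \<in> D\<^sub>0" "v \<in> L1" for i v
      using that L1 by (auto simp: L\<^sub>0_def D_def)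
    have cv: "{c, v} \<in> F" if "v \<in> L1" for v using that L1 L by (auto simp: L\<^sub>0_def)
    have bV: "b i \<in> V" "b i \<noteq> c" if "i \<in> D\<^sub>0" for i using irr[OF cb[OF that]] by auto
    have cV: "c \<in> V" using v0 L(2) irr by (auto simp: L\<^sub>0_def)
    \<comment> \<open>The centre replaces the vertex missing from part 0 of the gadget, and the
      leaves in \<open>L1\<close> form the last, largest part.\<close>
    define Q' where "Q' i = (if i = l then L1 else (if i = 0 then {c} else {}) \<union> b ` Q i)" for i
    have "multipartite_copy (\<lambda>x y. {x, y} \<in> F) V s Q'"
      unfolding multipartite_copy_def
    proof (intro conjI allI impI ballI)
      fix i assume i: "i < length s"
      show "Q' i \<subseteq> V"
      proof (cases "i = l")
        case True
        then show ?thesis using cv irr unfolding Q'_def by auto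
      next
        case False
        then have "i < l" using i l by auto
        then have "b ` Q i \<subseteq> V" using Qi(1) bV(1) by blast
        then show ?thesis using False cV by (simp add: Q'_def)
      qed
      show "finite (Q' i)" using i l Qi(2)[of i] L1 by (auto simp: Q'_def)
      show "card (Q' i) = s ! i"
      proof (cases "i = l")
        case True
        then show ?thesis using L1 ls by (simp add: Q'_def)
      next
        case False
        then have il: "i < l" using i l by auto
        have card: "card (b ` Q i) = card (Q i)"
          using Qi(1)[OF il] D0 inj by (intro card_image) (auto intro: inj_on_subset)
        show ?thesis
        proof (cases "i = 0")
          case True
          have "c \<notin> b ` Q i" using Qi(1)[OF il] bV by blast
          moreover have "s ! 0 > 0" using pos l by simp
          ultimately show ?thesis using True False card Qi(2,3)[OF il] by (simp add: Q'_def)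
        qed (use False card Qi(3)[OF il] in \<open>simp add: Q'_def\<close>)
      qed
    next
      have main: "{x, y} \<in> F" if ij: "i < j" "j < length s" and x: "x \<in> Q' i" and y: "y \<in> Q' j" for i j x y
      proof -
        have il: "i < l" using ij l by auto
        have jne: "j \<noteq> 0" using ij by auto
        consider "x = c" | a where "x = b a" "a \<in> Q i"
          using x il by (auto simp: Q'_def split: if_splits)
        then show ?thesis
        proof cases
          case 1
          then show ?thesis
            using y jne cv cb ij(2) l Qi(1)[of j] by (auto simp: Q'_def split: if_splits)
        next
          case 2
          then have a: "a \<in> D\<^sub>0" using Qi(1)[OF il] by blast
          show ?thesis
          proof (cases "j = l")
            case True
            then show ?thesis using y vb[OF a] 2 by (auto simp: Q'_def insert_commute)
          next
            case False
            then have jl: "j < l" using ij l by auto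
            obtain a' where a': "y = b a'" "a' \<in> Q j" using y False jne by (auto simp: Q'_def)
            have "in_block k R \<B> x y"
              unfolding in_block_def
              using QR[OF il jl _ 2(2) a'(2)] ij bB 2 a' a Qi(1)[OF jl] D0(1) by blast
            then show ?thesis by (rule gadget)
          qed
        qed
      qed
      fix i j x y assume "i < length s" "j < length s" "i \<noteq> j" "x \<in> Q' i" "y \<in> Q' j"
      then show "{x, y} \<in> F"
        using main[of i j x y] main[of j i y x] by (cases "i < j") (auto simp: insert_commute)
    qed
    then show False using free by blast
  qed
  have img: "g ` P \<subseteq> \<B> \<times> Pow {..<k}" using D(1) by (auto simp: g_def P_def rich_def)
  have "card P = (\<Sum>w\<in>\<B> \<times> Pow {..<k}. card {z\<in>P. g z = w})"
  proof -
    have "P = (\<Union>w\<in>\<B> \<times> Pow {..<k}. {z\<in>P. g z = w})" using img by auto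
    then have "card P = card (\<Union>w\<in>\<B> \<times> Pow {..<k}. {z\<in>P. g z = w})" by simp
    also have "\<dots> = (\<Sum>w\<in>\<B> \<times> Pow {..<k}. card {z\<in>P. g z = w})"
      using finB finP by (intro card_UN_disjoint) auto
    finally show ?thesis .
  qed
  also have "\<dots> \<le> of_nat (card (\<B> \<times> Pow {..<k})) * last s"
    using fibre by (intro sum_bounded_above)
  finally have "card P \<le> card \<B> * 2 ^ k * last s"
    by (simp add: card_cartesian_product card_Pow)
  then have "real (card P) \<le> real (card \<B>) * 2 ^ k * real (last s)"
    using of_nat_mono[of "card P" _, where 'a = real] by fastforce
  then have "(real (card L) * \<delta>) * real (card \<B>) \<le> (2 ^ (k + 1) * real (last s)) * real (card \<B>)"
    using lower by (simp add: algebra_simps)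
  moreover have "real (card \<B>) > 0" using \<B> finB by (simp add: card_gt_0_iff)
  ultimately have "real (card L) * \<delta> \<le> 2 ^ (k + 1) * real (last s)" by simp
  then show ?thesis using \<delta> by (simp add: field_simps)
qed

section \<open>Layers\<close>

text \<open>The first three are the block-covered vertices of \<open>A\<^sub>1\<close>,
  \<open>A\<^sub>2\<close> and the \<open>A\<^sub>3 j\<close>; \<open>Weak\<close> is
  \<open>W\<close> and \<open>Strong\<close> is \<open>B - W\<close>. \<open>Outside\<close>
  collects the uncovered vertices of the core, compatible with nothing.\<close>

datatype layer = First | Second | Third | Weak | Strong | Outside

text \<open>The layers form a 5-cycle \<open>Strong - Third - Second - Weak - First - Strong\<close>. The second argument is
  the position inside its block of a vertex of layer \<open>Second\<close>, and the index of its class for layer \<open>Third\<close>.\<close>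

fun layer_ok :: "layer \<Rightarrow> nat \<Rightarrow> layer \<Rightarrow> nat \<Rightarrow> bool" where
  "layer_ok First i First j = True"
| "layer_ok First i Weak j = True"
| "layer_ok First i Strong j = True"
| "layer_ok Weak i First j = True"
| "layer_ok Strong i First j = True"
| "layer_ok Second i Second j = (i \<noteq> j)"
| "layer_ok Second i Weak j = True"
| "layer_ok Weak i Second j = True"
| "layer_ok Second i Third j = (i = j)"
| "layer_ok Third i Second j = (i = j)"
| "layer_ok Third i Third j = (i = j)"
| "layer_ok Third i Strong j = True"
| "layer_ok Strong i Third j = True"
| "layer_ok _ _ _ _ = False"

lemma layer_ok_sym: "layer_ok a i b j \<longleftrightarrow> layer_ok b j a i"
  by (cases a; cases b) auto

text \<open>\<open>Weak\<close> and \<open>Strong\<close> vertices are pairwise incompatible, so all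
  of them lie in one part \<alpha>. In the other parts \<open>First\<close> is incompatible with
  \<open>Second\<close> and \<open>Third\<close>, which settles everything except a mixture of the
  latter two. There a \<open>Third\<close> vertex fixes the position of its \<open>Second\<close>
  neighbours, while \<open>Second\<close> vertices in different parts have different positions; so
  only one part contains \<open>Second\<close> vertices.\<close>

lemma layered_copy:
  assumes len: "l \<ge> (3::nat)" and ne: "\<And>i. i < l \<Longrightarrow> Q i \<noteq> {}"
    and ok: "\<And>i j x y. i < l \<Longrightarrow> j < l \<Longrightarrow> i \<noteq> j \<Longrightarrow> x \<in> Q i \<Longrightarrow> y \<in> Q j \<Longrightarrow> layer_ok (f x) (g x) (f y) (g y)"
  shows "\<exists>\<alpha><l. (\<forall>i<l. i \<noteq> \<alpha> \<longrightarrow> (\<forall>x\<in>Q i. f x = First)) \<or> (\<forall>i<l. i \<noteq> \<alpha> \<longrightarrow> (\<forall>x\<in>Q i. f x = Second))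
     \<or> (\<exists>j. \<forall>i<l. i \<noteq> \<alpha> \<longrightarrow> (\<forall>x\<in>Q i. f x = Third \<and> g x = j))"
proof -
  have third: "\<exists>c<l. c \<noteq> a \<and> c \<noteq> b" for a b
  proof -
    have "card {a, b} \<le> 2" by (cases "a = b") auto
    then have "card {a, b} < card {0..<l}" using len by simp
    then have "\<not> {0..<l} \<subseteq> {a, b}" by (meson card_mono finite.intros not_less)
    then show ?thesis by auto
  qed
  obtain \<alpha> where \<alpha>: "\<alpha> < l" and notB: "\<And>i x. i < l \<Longrightarrow> i \<noteq> \<alpha> \<Longrightarrow> x \<in> Q i \<Longrightarrow> f x \<noteq> Weak \<and> f x \<noteq> Strong"
  proof (cases "\<exists>a<l. \<exists>x\<in>Q a. f x = Weak \<or> f x = Strong")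
    case True
    then obtain a x where a: "a < l" "x \<in> Q a" "f x = Weak \<or> f x = Strong" by blast
    have "f y \<noteq> Weak \<and> f y \<noteq> Strong" if "i < l" "i \<noteq> a" "y \<in> Q i" for i y
      using ok[OF a(1) that(1) _ a(2) that(3)] a(3) that(2) by auto
    then show ?thesis using that a(1) by blast
  next
    case False
    then show ?thesis using that[of 0] len by auto
  qed
  have lay: "f x = First \<or> f x = Second \<or> f x = Third" if "i < l" "i \<noteq> \<alpha>" "x \<in> Q i" for i x
  proof -
    obtain y where "y \<in> Q \<alpha>" using ne \<alpha> by blast
    then have "layer_ok (f x) (g x) (f y) (g y)" using ok[of i \<alpha> x y] that \<alpha> by blast
    then show ?thesis using notB[OF that] by (cases "f x") auto
  qed
  consider (first) a x where "a < l" "a \<noteq> \<alpha>" "x \<in> Q a" "f x = First"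
    | (second) "\<forall>i<l. i \<noteq> \<alpha> \<longrightarrow> (\<forall>x\<in>Q i. f x = Second)"
    | (third) b y where "b < l" "b \<noteq> \<alpha>" "y \<in> Q b" "f y = Third" "\<forall>i<l. i \<noteq> \<alpha> \<longrightarrow> (\<forall>x\<in>Q i. f x = Third)"
    | (mixed) a b x y where "a < l" "a \<noteq> \<alpha>" "x \<in> Q a" "f x = Second" "b < l" "b \<noteq> \<alpha>" "y \<in> Q b" "f y = Third"
    using lay by metis
  then show ?thesis
  proof cases
    case first
    obtain c where c: "c < l" "c \<noteq> a" "c \<noteq> \<alpha>" using third by blast
    have step: "f z = First" if "i < l" "j < l" "i \<noteq> j" "i \<noteq> \<alpha>" "z \<in> Q i" "w \<in> Q j" "f w = First" for i j z w
      using ok[of i j z w] notB[of i z] that by (cases "f z") auto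
    have all: "f z = First" if "i < l" "i \<noteq> \<alpha>" "i \<noteq> a" "z \<in> Q i" for i z
      using step[of i a z x] that first by blast
    obtain w where w: "w \<in> Q c" using ne c by blast
    have "f z = First" if "z \<in> Q a" for z
      using step[of a c z w] that first c w all[of c w] by blast
    then show ?thesis using all \<alpha> by blast
  next
    case second
    then show ?thesis using \<alpha> by blast
  next
    case third': third
    obtain c where c: "c < l" "c \<noteq> b" "c \<noteq> \<alpha>" using third by blast
    have step: "g z = g w" if "i < l" "j < l" "i \<noteq> j" "i \<noteq> \<alpha>" "j \<noteq> \<alpha>" "z \<in> Q i" "w \<in> Q j" for i j z w
      using ok[of i j z w] third'(5) that by auto
    obtain w where w: "w \<in> Q c" using ne c by blast
    have all: "g z = g y" if "i < l" "i \<noteq> \<alpha>" "i \<noteq> b" "z \<in> Q i" for i z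
      using step[of i b z y] that third' by blast
    have "g z = g y" if "z \<in> Q b" for z
      using step[of b c z w] that third' c w all[of c w] by auto
    then show ?thesis using all \<alpha> third'(5) by blast
  next
    case mixed
    \<comment> \<open>\<open>Weak\<close> is incompatible with \<open>Third\<close> and
      \<open>Strong\<close> with \<open>Second\<close>, so in the mixed case not even part \<alpha>
      contains vertices of \<open>B\<close>. The part to discard is then \<open>a'\<close>, the one
      with a \<open>Second\<close> vertex, instead of \<alpha>.\<close>
    have \<alpha>lay: "f z = Second \<or> f z = Third" if "z \<in> Q \<alpha>" for z
      using ok[of \<alpha> a z x] ok[of \<alpha> b z y] that mixed \<alpha> by (cases "f z") auto
    have lay': "f z = Second \<or> f z = Third" if "i < l" "z \<in> Q i" for i z
    proof (cases "i = \<alpha>")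
      case False
      show ?thesis
      proof -
        obtain w where w: "w \<in> Q \<alpha>" using ne \<alpha> by blast
        then show ?thesis
          using ok[of i \<alpha> z w] \<alpha>lay[OF w] lay[OF that(1) False that(2)] that \<alpha> False by auto
      qed
    qed (use \<alpha>lay that in simp)
    obtain a' b' x' y' where ab: "a' < l" "b' < l" "a' \<noteq> b'" "x' \<in> Q a'" "f x' = Second" "y' \<in> Q b'" "f y' = Third"
    proof (cases "a = b")
      case True
      obtain c where c: "c < l" "c \<noteq> a" using third by blast
      obtain z where z: "z \<in> Q c" using ne c by blast
      show ?thesis using lay'[OF c(1) z] that[of c b z y] that[of a c x z] mixed c z True by blast
    next
      case False
      then show ?thesis using that mixed by blast
    qed
    have key: "f z = Third \<and> g z = g x'" if "b < l" "b \<noteq> a'" "c < l" "c \<noteq> a'" "c \<noteq> b" "y \<in> Q b" "f y = Third" "z \<in> Q c" for b y c z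
    proof -
      have "layer_ok (f x') (g x') (f y) (g y)" "layer_ok (f x') (g x') (f z) (g z)" "layer_ok (f y) (g y) (f z) (g z)"
        using ok that ab by blast+
      then show ?thesis using lay'[OF that(3,8)] ab(5) that(7) by auto
    qed
    have other: "f z = Third \<and> g z = g x'" if "c < l" "c \<noteq> a'" "c \<noteq> b'" "z \<in> Q c" for c z
      using key[of b' c y' z] ab that by blast
    obtain c where c: "c < l" "c \<noteq> a'" "c \<noteq> b'" using third by blast
    obtain w where w: "w \<in> Q c" using ne c by blast
    have "f z = Third \<and> g z = g x'" if "z \<in> Q b'" for z
      using key[of c b' w z] other[OF c w] ab c w that by blast
    then have "\<forall>i<l. i \<noteq> a' \<longrightarrow> (\<forall>x\<in>Q i. f x = Third \<and> g x = g x')" using other by blast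
    then show ?thesis using ab(1) by blast
  qed
qed

definition common_nbrs :: "'a set set \<Rightarrow> 'a set \<Rightarrow> 'a \<Rightarrow> 'a \<Rightarrow> nat" where
  "common_nbrs E X u v = card {x\<in>X. {u, x} \<in> E \<and> {v, x} \<in> E}"

text \<open>The vertices missed by the blocks cost at most \<delta> |X|. This is why codegree
  conditions carry the factor 2 \<delta> and the star bound the factor \<delta>.\<close>

lemma common_nbrs_block_cover:
  fixes \<delta> :: real
  assumes bf: "block_family E k X \<B>" and X: "finite X" and \<delta>: "\<delta> \<ge> 0"
    and left: "real (card (X - block_cover k \<B>)) \<le> \<delta> * real (card X)"
    and cn: "real (common_nbrs E X u v) \<ge> 2 * \<delta> * real (card X)"
    and F: "\<And>x. x \<in> block_cover k \<B> \<Longrightarrow> {u, x} \<in> E \<Longrightarrow> {u, x} \<in> F"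
           "\<And>x. x \<in> block_cover k \<B> \<Longrightarrow> {v, x} \<in> E \<Longrightarrow> {v, x} \<in> F"
  shows "real (card {x \<in> block_cover k \<B>. {u, x} \<in> F \<and> {v, x} \<in> F}) \<ge> \<delta> * real (k * card \<B>)"
proof -
  let ?C = "{x \<in> block_cover k \<B>. {u, x} \<in> F \<and> {v, x} \<in> F}"
  have "common_nbrs E X u v \<le> card (?C \<union> (X - block_cover k \<B>))"
    unfolding common_nbrs_def using F X card_block_cover(2)[OF bf] by (intro card_mono) auto
  also have "\<dots> \<le> card ?C + card (X - block_cover k \<B>)" by (rule card_Un_le)
  finally have "real (common_nbrs E X u v) \<le> real (card ?C) + real (card (X - block_cover k \<B>))" by linarith
  moreover have "k * card \<B> \<le> card X"
    using card_mono[OF X block_cover_subset[OF bf]] card_block_cover(1)[OF bf] by simp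
  then have "\<delta> * real (k * card \<B>) \<le> \<delta> * real (card X)" using \<delta> by (intro mult_left_mono of_nat_mono)
  ultimately show ?thesis using left cn by linarith
qed

lemma card_sparse_pairs_le:
  fixes m :: real
  assumes "finite C" "finite D" "\<And>c. c \<in> C \<Longrightarrow> real (card {v\<in>D. P c v}) \<le> m"
  shows "real (card {(c, v). c \<in> C \<and> v \<in> D \<and> P c v}) \<le> real (card C) * m"
proof -
  have "{(c, v). c \<in> C \<and> v \<in> D \<and> P c v} = (SIGMA c:C. {v\<in>D. P c v})" by auto
  then have "real (card {(c, v). c \<in> C \<and> v \<in> D \<and> P c v}) = (\<Sum>c\<in>C. real (card {v\<in>D. P c v}))"
    using assms by (simp add: card_SigmaI)
  also have "\<dots> \<le> real (card C) * m" using assms by (intro sum_bounded_above) auto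
  finally show ?thesis .
qed

section \<open>The deterministic upper bound\<close>

text \<open>The deterministic data of the construction. Nothing is required about degrees or common
  neighbourhoods: \<open>W\<close> is an arbitrary subset of \<open>B\<close>, and failing pairs are
  counted in the final bound. The \<delta> / 2 in \<open>denseR\<close> is the density left by the
  averaging over blocks in \<open>star_leaves_bound\<close>.\<close>

locale saturation_frame =
  fixes V :: "'a set" and E :: "'a set set" and s :: "nat list" and k :: nat
    and R :: "nat \<Rightarrow> nat \<Rightarrow> bool" and \<delta> :: real
    and A\<^sub>1 A\<^sub>2 :: "'a set" and A\<^sub>3 :: "nat \<Rightarrow> 'a set" and B W :: "'a set"
    and \<B>\<^sub>1 \<B>\<^sub>2 :: "(nat \<Rightarrow> 'a) set" and \<B>\<^sub>3 :: "nat \<Rightarrow> (nat \<Rightarrow> 'a) set"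
  assumes V: "finite V" and E: "E \<subseteq> [V]\<^bsup>2\<^esup>"
    and len: "length s \<ge> 3" and sorted: "sorted s" and pos: "\<forall>a\<in>set s. 0 < a"
    and k: "k > 0" and symR: "symp R" and irrR: "irreflp R" and \<delta>: "\<delta> > 0"
    and freeR: "\<And>Q. \<not> multipartite_copy R {..<k} (butlast s) Q"
    and denseR: "\<And>D. D \<subseteq> {..<k} \<Longrightarrow> real (card D) \<ge> \<delta> / 2 * real k \<Longrightarrow>
        \<exists>Q. multipartite_copy R D ((butlast s)[0 := butlast s ! 0 - 1]) Q"
    and V_eq: "V = A\<^sub>1 \<union> A\<^sub>2 \<union> (\<Union>j<k. A\<^sub>3 j) \<union> B"
    and disj: "A\<^sub>1 \<inter> A\<^sub>2 = {}" "A\<^sub>1 \<inter> (\<Union>j<k. A\<^sub>3 j) = {}" "A\<^sub>1 \<inter> B = {}" "A\<^sub>2 \<inter> (\<Union>j<k. A\<^sub>3 j) = {}"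
        "A\<^sub>2 \<inter> B = {}" "(\<Union>j<k. A\<^sub>3 j) \<inter> B = {}"
    and disj3: "\<And>i j. i < k \<Longrightarrow> j < k \<Longrightarrow> i \<noteq> j \<Longrightarrow> A\<^sub>3 i \<inter> A\<^sub>3 j = {}"
    and W: "W \<subseteq> B"
    and bf1: "block_family E k A\<^sub>1 \<B>\<^sub>1" and bf2: "block_family E k A\<^sub>2 \<B>\<^sub>2"
    and bf3: "\<And>j. j < k \<Longrightarrow> block_family E k (A\<^sub>3 j) (\<B>\<^sub>3 j)"
    and ne: "\<B>\<^sub>1 \<noteq> {}" "\<B>\<^sub>2 \<noteq> {}" "\<And>j. j < k \<Longrightarrow> \<B>\<^sub>3 j \<noteq> {}"
    and left1: "real (card (A\<^sub>1 - block_cover k \<B>\<^sub>1)) \<le> \<delta> * real (card A\<^sub>1)"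
    and left2: "real (card (A\<^sub>2 - block_cover k \<B>\<^sub>2)) \<le> \<delta> * real (card A\<^sub>2)"
    and left3: "\<And>j. j < k \<Longrightarrow> real (card (A\<^sub>3 j - block_cover k (\<B>\<^sub>3 j))) \<le> \<delta> * real (card (A\<^sub>3 j))"
begin

definition A where "A = A\<^sub>1 \<union> A\<^sub>2 \<union> (\<Union>j<k. A\<^sub>3 j)"

definition lay :: "'a \<Rightarrow> layer" where
  "lay x = (if x \<in> block_cover k \<B>\<^sub>1 then First else if x \<in> block_cover k \<B>\<^sub>2 then Second
     else if \<exists>j<k. x \<in> block_cover k (\<B>\<^sub>3 j) then Third else if x \<in> W then Weak
     else if x \<in> B then Strong else Outside)"

text \<open>The value matters for \<open>Second\<close> and \<open>Third\<close> only. There the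
  descriptions are unique because blocks are injective and disjoint and the sets
  \<open>A\<^sub>3 j\<close> are disjoint.\<close>

definition pos_in :: "'a \<Rightarrow> nat" where
  "pos_in x = (if lay x = Second then (THE i. i < k \<and> (\<exists>b\<in>\<B>\<^sub>2. x = b i)) else (THE j. j < k \<and> x \<in> A\<^sub>3 j))"

abbreviation "compatible x y \<equiv> layer_ok (lay x) (pos_in x) (lay y) (pos_in y)"

text \<open>Inside a layer only gadget edges are kept, between compatible layers every edge of the
  graph. The condition \<open>lay x \<noteq> lay y\<close> is what keeps the other edges inside
  \<open>First\<close>, \<open>Second\<close> and \<open>Third\<close> out.\<close>

definition base_adj :: "'a \<Rightarrow> 'a \<Rightarrow> bool" where
  "base_adj x y \<longleftrightarrow> in_block k R \<B>\<^sub>1 x y \<or> in_block k R \<B>\<^sub>2 x y \<or> (\<exists>j<k. in_block k R (\<B>\<^sub>3 j) x y) \<or>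
     ({x, y} \<in> E \<and> lay x \<noteq> lay y \<and> compatible x y)"

definition base_edges :: "'a set set" where
  "base_edges = {{x, y} | x y. base_adj x y}"

lemma cover1: "block_cover k \<B>\<^sub>1 \<subseteq> A\<^sub>1" and cover2: "block_cover k \<B>\<^sub>2 \<subseteq> A\<^sub>2"
  and cover3: "j < k \<Longrightarrow> block_cover k (\<B>\<^sub>3 j) \<subseteq> A\<^sub>3 j"
  using block_cover_subset bf1 bf2 bf3 by metis+

lemma cover3': "j < k \<Longrightarrow> x \<in> block_cover k (\<B>\<^sub>3 j) \<Longrightarrow> x \<in> (\<Union>j<k. A\<^sub>3 j)"
  using cover3 by blast

lemma lay_First: "x \<in> block_cover k \<B>\<^sub>1 \<Longrightarrow> lay x = First"
  by (simp add: lay_def)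

lemma lay_Second: "x \<in> block_cover k \<B>\<^sub>2 \<Longrightarrow> lay x = Second"
  using cover1 cover2 disj(1) by (auto simp: lay_def)

lemma lay_Third: "x \<in> block_cover k (\<B>\<^sub>3 j) \<Longrightarrow> j < k \<Longrightarrow> lay x = Third"
  using cover1 cover2 cover3'[of j x] disj(2,4) by (auto simp: lay_def)

lemma lay_B: "x \<in> B \<Longrightarrow> lay x = (if x \<in> W then Weak else Strong)"
proof -
  assume x: "x \<in> B"
  have "x \<notin> block_cover k \<B>\<^sub>1" "x \<notin> block_cover k \<B>\<^sub>2" using x cover1 cover2 disj(3,5) by blast+
  moreover have "\<not> (\<exists>j<k. x \<in> block_cover k (\<B>\<^sub>3 j))" using x cover3' disj(6) by blast
  ultimately show ?thesis using x by (simp add: lay_def)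
qed

lemma pos_Second:
  assumes "b \<in> \<B>\<^sub>2" "i < k" shows "pos_in (b i) = i"
proof -
  have "lay (b i) = Second" using assms by (intro lay_Second) (auto simp: block_cover_def)
  moreover have "(THE i'. i' < k \<and> (\<exists>b'\<in>\<B>\<^sub>2. b i = b' i')) = i"
    using assms block_family_inj[OF bf2] by (intro the_equality) blast+
  ultimately show ?thesis by (simp add: pos_in_def)
qed

lemma pos_Third:
  assumes "x \<in> block_cover k (\<B>\<^sub>3 j)" "j < k" shows "pos_in x = j"
proof -
  have "(THE j. j < k \<and> x \<in> A\<^sub>3 j) = j"
    using assms cover3 disj3 by (intro the_equality) blast+
  then show ?thesis using lay_Third[OF assms] by (simp add: pos_in_def)
qed

lemma in_block_cover: "in_block k R \<B> x y \<Longrightarrow> x \<in> block_cover k \<B> \<and> y \<in> block_cover k \<B>"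
  by (auto simp: in_block_def block_cover_def)

lemma in_block_sym: "in_block k R \<B> x y \<Longrightarrow> in_block k R \<B> y x"
  using symR unfolding in_block_def symp_def by blast

lemma in_block_edge:
  assumes "block_family E k X \<B>" "in_block k R \<B> x y" shows "{x, y} \<in> E"
proof -
  obtain b i j where "b \<in> \<B>" "i < k" "j < k" "R i j" "x = b i" "y = b j"
    using assms(2) unfolding in_block_def by blast
  moreover have "i \<noteq> j" using \<open>R i j\<close> irrR unfolding irreflp_def by blast
  ultimately show ?thesis using assms(1) unfolding block_family_def by blast
qed

lemma base_adj_sym:
  assumes "base_adj x y" shows "base_adj y x"
proof -
  have "compatible x y \<longleftrightarrow> compatible y x" by (rule layer_ok_sym)
  moreover have "{x, y} = {y, x}" by auto
  moreover have "in_block k R \<B> x y \<Longrightarrow> in_block k R \<B> y x" for \<B> by (rule in_block_sym)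
  ultimately show ?thesis using assms unfolding base_adj_def by auto
qed

lemma base_adj_edge: "base_adj x y \<Longrightarrow> {x, y} \<in> E"
  unfolding base_adj_def using in_block_edge bf1 bf2 bf3 by blast

lemma base_edges_iff: "{x, y} \<in> base_edges \<longleftrightarrow> base_adj x y"
  unfolding base_edges_def using base_adj_sym by (auto simp: doubleton_eq_iff)

lemma base_adj_compatible:
  assumes "base_adj x y" shows "compatible x y"
proof -
  consider "in_block k R \<B>\<^sub>1 x y" | "in_block k R \<B>\<^sub>2 x y" | j where "j < k" "in_block k R (\<B>\<^sub>3 j) x y" | "compatible x y"
    using assms unfolding base_adj_def by blast
  then show ?thesis
  proof cases
    case 2
    then obtain b i j where b: "b \<in> \<B>\<^sub>2" "i < k" "j < k" "R i j" "x = b i" "y = b j"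
      unfolding in_block_def by blast
    moreover have "i \<noteq> j" using \<open>R i j\<close> irrR unfolding irreflp_def by blast
    ultimately show ?thesis using pos_Second lay_Second in_block_cover[OF 2] by simp
  next
    case 1
    then show ?thesis using in_block_cover[OF 1] by (simp add: lay_First)
  next
    case 3
    then show ?thesis using in_block_cover[OF 3(2)] lay_Third[of _ j] pos_Third[of _ j] by auto
  qed
qed

lemma base_adj_same_layer:
  assumes "base_adj x y" "lay x = lay y"
  shows "lay x = First \<Longrightarrow> in_block k R \<B>\<^sub>1 x y" "lay x = Second \<Longrightarrow> in_block k R \<B>\<^sub>2 x y"
    "lay x = Third \<Longrightarrow> pos_in x < k \<and> in_block k R (\<B>\<^sub>3 (pos_in x)) x y"
proof -
  consider "in_block k R \<B>\<^sub>1 x y" | "in_block k R \<B>\<^sub>2 x y" | j where "j < k" "in_block k R (\<B>\<^sub>3 j) x y"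
    using assms unfolding base_adj_def by blast
  then have "(lay x = First \<longrightarrow> in_block k R \<B>\<^sub>1 x y) \<and> (lay x = Second \<longrightarrow> in_block k R \<B>\<^sub>2 x y) \<and>
      (lay x = Third \<longrightarrow> pos_in x < k \<and> in_block k R (\<B>\<^sub>3 (pos_in x)) x y)"
  proof cases
    case 1
    then show ?thesis using lay_First[of x] in_block_cover[OF 1] by simp
  next
    case 2
    then show ?thesis using lay_Second[of x] in_block_cover[OF 2] by simp
  next
    case 3
    then show ?thesis using lay_Third[of x j] pos_Third[of x j] in_block_cover[OF 3(2)] by simp
  qed
  then show "lay x = First \<Longrightarrow> in_block k R \<B>\<^sub>1 x y" "lay x = Second \<Longrightarrow> in_block k R \<B>\<^sub>2 x y"
    "lay x = Third \<Longrightarrow> pos_in x < k \<and> in_block k R (\<B>\<^sub>3 (pos_in x)) x y" by blast+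
qed

text \<open>By \<open>layered_copy\<close> all parts but one lie in a single layer, in one class of
  it for \<open>Third\<close>. There \<open>base_adj\<close> is the gadget relation of the blocks,
  and these parts contain a copy for \<open>butlast s\<close>, which the gadget excludes.\<close>

lemma base_free: "\<not> multipartite_copy (\<lambda>x y. {x, y} \<in> base_edges) V s Q"
proof
  assume "multipartite_copy (\<lambda>x y. {x, y} \<in> base_edges) V s Q"
  then have copy: "multipartite_copy base_adj V s Q" by (simp add: base_edges_iff)
  have adj: "base_adj x y" if "i < length s" "j < length s" "i \<noteq> j" "x \<in> Q i" "y \<in> Q j" for i j x y
    using copy that unfolding multipartite_copy_def by blast
  have neQ: "Q i \<noteq> {}" if "i < length s" for i
  proof -
    have "card (Q i) > 0" using copy pos that unfolding multipartite_copy_def by auto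
    then show ?thesis by auto
  qed
  have lb: "length (butlast s) \<ge> 2" using len by simp
  have pb: "\<forall>a\<in>set (butlast s). 0 < a" using pos by (meson in_set_butlastD)
  have ok: "compatible x y" if "i < length s" "j < length s" "i \<noteq> j" "x \<in> Q i" "y \<in> Q j" for i j x y
    using adj[OF that] by (rule base_adj_compatible)
  have "\<exists>\<alpha><length s. (\<forall>i<length s. i \<noteq> \<alpha> \<longrightarrow> (\<forall>x\<in>Q i. lay x = First)) \<or>
      (\<forall>i<length s. i \<noteq> \<alpha> \<longrightarrow> (\<forall>x\<in>Q i. lay x = Second)) \<or>
      (\<exists>j. \<forall>i<length s. i \<noteq> \<alpha> \<longrightarrow> (\<forall>x\<in>Q i. lay x = Third \<and> pos_in x = j))"
    using neQ ok by (rule layered_copy[OF len])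
  then obtain \<alpha> where \<alpha>: "\<alpha> < length s" and cases: "(\<forall>i<length s. i \<noteq> \<alpha> \<longrightarrow> (\<forall>x\<in>Q i. lay x = First)) \<or>
      (\<forall>i<length s. i \<noteq> \<alpha> \<longrightarrow> (\<forall>x\<in>Q i. lay x = Second)) \<or>
      (\<exists>j. \<forall>i<length s. i \<noteq> \<alpha> \<longrightarrow> (\<forall>x\<in>Q i. lay x = Third \<and> pos_in x = j))"
    by (elim exE conjE)
  define U where "U = (\<Union>i\<in>{..<length s} - {\<alpha>}. Q i)"
  obtain Q' where Q': "multipartite_copy base_adj U (butlast s) Q'"
    using multipartite_copy_drop_part[OF copy sorted \<alpha>] unfolding U_def by blast
  from cases consider "\<forall>x\<in>U. lay x = First" | "\<forall>x\<in>U. lay x = Second"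
    | j where "\<forall>x\<in>U. lay x = Third \<and> pos_in x = j"
    unfolding U_def by blast
  then show False
  proof cases
    case 1
    then have "multipartite_copy (in_block k R \<B>\<^sub>1) U (butlast s) Q'"
      using base_adj_same_layer(1) by (intro multipartite_copy_mono[OF Q' order_refl]) auto
    then show False using in_block_multipartite_free[OF bf1 lb pb freeR] by blast
  next
    case 2
    then have "multipartite_copy (in_block k R \<B>\<^sub>2) U (butlast s) Q'"
      using base_adj_same_layer(2) by (intro multipartite_copy_mono[OF Q' order_refl]) auto
    then show False using in_block_multipartite_free[OF bf2 lb pb freeR] by blast
  next
    case 3
    then have mono: "multipartite_copy (in_block k R (\<B>\<^sub>3 j)) U (butlast s) Q'"
      using base_adj_same_layer(3) by (intro multipartite_copy_mono[OF Q' order_refl]) metis+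
    \<comment> \<open>The case only provides a common value of \<open>pos_in\<close>; that it
      indexes an actual class follows from an edge inside the layer.\<close>
    have "j < k"
    proof -
      have l: "0 < length (butlast s)" "1 < length (butlast s)" using lb by linarith+
      have "card (Q' 0) > 0" "card (Q' 1) > 0"
        using Q' pb l nth_mem unfolding multipartite_copy_def by metis+
      then obtain x y where xy: "x \<in> Q' 0" "y \<in> Q' 1" by (metis card.empty ex_in_conv less_irrefl)
      then have "x \<in> U" "y \<in> U" "base_adj x y" using Q' l unfolding multipartite_copy_def by (blast, blast, metis zero_neq_one)
      then show ?thesis using 3 base_adj_same_layer(3) by metis
    qed
    then show False using in_block_multipartite_free[OF bf3 lb pb freeR] mono by blast
  qed
qed

text \<open>The four kinds of links that make centres and leaves see the blocks in any extension
  \<open>F\<close>. The last one concerns a vertex at position \<open>j\<close> of a block of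
  \<open>A\<^sub>2\<close>, which sees only the class \<open>A\<^sub>3 j\<close>.\<close>

lemma link_edges:
  assumes "base_edges \<subseteq> F"
  shows "u \<in> B \<Longrightarrow> x \<in> block_cover k \<B>\<^sub>1 \<Longrightarrow> {u, x} \<in> E \<Longrightarrow> {u, x} \<in> F"
    and "u \<in> W \<Longrightarrow> x \<in> block_cover k \<B>\<^sub>2 \<Longrightarrow> {u, x} \<in> E \<Longrightarrow> {u, x} \<in> F"
    and "u \<in> B - W \<Longrightarrow> j < k \<Longrightarrow> x \<in> block_cover k (\<B>\<^sub>3 j) \<Longrightarrow> {u, x} \<in> E \<Longrightarrow> {u, x} \<in> F"
    and "u = b j \<Longrightarrow> b \<in> \<B>\<^sub>2 \<Longrightarrow> j < k \<Longrightarrow> x \<in> block_cover k (\<B>\<^sub>3 j) \<Longrightarrow> {u, x} \<in> E \<Longrightarrow> {u, x} \<in> F"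
proof -
  have F: "{u, x} \<in> F" if "{u, x} \<in> E" "lay u \<noteq> lay x" "compatible u x" for u x
  proof -
    have "base_adj u x" using that unfolding base_adj_def by blast
    then show ?thesis using assms base_edges_iff by blast
  qed
  show "u \<in> B \<Longrightarrow> x \<in> block_cover k \<B>\<^sub>1 \<Longrightarrow> {u, x} \<in> E \<Longrightarrow> {u, x} \<in> F"
    by (rule F) (simp_all add: lay_B lay_First)
  show "u \<in> W \<Longrightarrow> x \<in> block_cover k \<B>\<^sub>2 \<Longrightarrow> {u, x} \<in> E \<Longrightarrow> {u, x} \<in> F"
    using W by (intro F) (auto simp: lay_B lay_Second)
  show "u \<in> B - W \<Longrightarrow> j < k \<Longrightarrow> x \<in> block_cover k (\<B>\<^sub>3 j) \<Longrightarrow> {u, x} \<in> E \<Longrightarrow> {u, x} \<in> F"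
    by (rule F) (auto simp: lay_B lay_Third)
  show "{u, x} \<in> F" if "u = b j" "b \<in> \<B>\<^sub>2" "j < k" "x \<in> block_cover k (\<B>\<^sub>3 j)" "{u, x} \<in> E"
  proof (rule F)
    have "u \<in> block_cover k \<B>\<^sub>2" using that by (auto simp: block_cover_def)
    then show "lay u \<noteq> lay x" "compatible u x"
      using that lay_Second lay_Third[OF that(4,3)] pos_Third[OF that(4,3)] pos_Second by auto
  qed (rule that)
qed

lemma block_edges:
  assumes "base_edges \<subseteq> F"
  shows "in_block k R \<B>\<^sub>1 x y \<Longrightarrow> {x, y} \<in> F" "in_block k R \<B>\<^sub>2 x y \<Longrightarrow> {x, y} \<in> F"
    "j < k \<Longrightarrow> in_block k R (\<B>\<^sub>3 j) x y \<Longrightarrow> {x, y} \<in> F"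
  using assms base_edges_iff[of x y] unfolding base_adj_def by blast+

definition leaf_bound :: real where "leaf_bound = 2 ^ (k + 1) * real (last s) / \<delta>"

definition "bad_first = {(u, v). u \<in> B - W \<and> v \<in> B \<and> u \<noteq> v \<and> real (common_nbrs E A\<^sub>1 u v) < 2 * \<delta> * real (card A\<^sub>1)}"
definition "bad_second = {(u, v). u \<in> B \<and> v \<in> B \<and> u \<noteq> v \<and> real (common_nbrs E A\<^sub>2 u v) < 2 * \<delta> * real (card A\<^sub>2)}"
text \<open>Failure for any class \<open>j\<close> counts, although only the class of the position
  of \<open>a\<close> is at stake: that position depends on blocks chosen after the graph is known,
  whereas this condition refers to fixed sets.\<close>

definition "bad_third = {(a, v). a \<in> A\<^sub>2 \<and> v \<in> B \<and> (\<exists>j<k. real (common_nbrs E (A\<^sub>3 j) a v) < 2 * \<delta> * real (card (A\<^sub>3 j)))}"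
definition "first_edges = {(a, v). a \<in> A\<^sub>1 \<and> v \<in> B \<and> {a, v} \<in> E}"

text \<open>Any saturated extension of the base graph will do. Each of its edges is charged to a
  cheap region, to a failing pair, or to a pair that shares many neighbours in the cover of the
  relevant layer; in the last case its ends are centre and leaf of a star, so there are at most
  \<open>leaf_bound\<close> per centre.\<close>

theorem sat_upper_bound:
  "real (sat (V, E) (complete_multipartite s)) \<le>
     real (card first_edges) + \<delta> * real (card A) * real (card V) + real (card A) ^ 2
     + real (card A\<^sub>2) * real (card W) + real (card (\<Union>j<k. A\<^sub>3 j)) * real (card V)
     + leaf_bound * (real (card A) + 2 * real (card V))
     + real (card bad_first) + real (card bad_second) + real (card bad_third)"
proof -
  obtain F where F: "base_edges \<subseteq> F" "F \<subseteq> E" and satF: "saturated_in (V, E) (complete_multipartite s) (V, F)"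
    and free: "\<And>Q. \<not> multipartite_copy (\<lambda>x y. {x, y} \<in> F) V s Q"
  proof (rule saturated_extension_exists[OF V E _ base_free])
    show "base_edges \<subseteq> E" using base_adj_edge by (auto simp: base_edges_def)
  qed blast
  have F2: "F \<subseteq> [V]\<^bsup>2\<^esup>" using F E by blast
  define C\<^sub>2 where "C\<^sub>2 = block_cover k \<B>\<^sub>2"
  let ?A3 = "\<Union>j<k. A\<^sub>3 j"
  have fin: "finite A\<^sub>1" "finite A\<^sub>2" "finite ?A3" "finite B" "finite W" "finite A" "finite (B - W)"
    using V W unfolding V_eq A_def by (auto dest: finite_subset)
  have fin3: "finite (A\<^sub>3 j)" if "j < k" for j using fin(3) that by auto
  have leafb: "0 \<le> leaf_bound" using \<delta> by (simp add: leaf_bound_def)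
  define G1 where "G1 = {(u, v). u \<in> B \<and> v \<in> B \<and> {u, v} \<in> F \<and> real (common_nbrs E A\<^sub>1 u v) \<ge> 2 * \<delta> * real (card A\<^sub>1)}"
  define G2 where "G2 = {(u, v). u \<in> W \<and> v \<in> W \<and> {u, v} \<in> F \<and> real (common_nbrs E A\<^sub>2 u v) \<ge> 2 * \<delta> * real (card A\<^sub>2)}"
  define G3 where "G3 = {(a, v). a \<in> C\<^sub>2 \<and> v \<in> B - W \<and> {a, v} \<in> F \<and> (\<forall>j<k. real (common_nbrs E (A\<^sub>3 j) a v) \<ge> 2 * \<delta> * real (card (A\<^sub>3 j)))}"
  have G1: "real (card G1) \<le> real (card B) * leaf_bound"
    unfolding G1_def
  proof (rule card_sparse_pairs_le[OF fin(4) fin(4)])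
    fix u assume u: "u \<in> B"
    let ?L = "{v \<in> B. {u, v} \<in> F \<and> 2 * \<delta> * real (card A\<^sub>1) \<le> real (common_nbrs E A\<^sub>1 u v)}"
    show "real (card ?L) \<le> leaf_bound"
      unfolding leaf_bound_def
    proof (rule star_leaves_bound[OF bf1 ne(1) k \<delta> len pos F2 free block_edges(1)[OF F(1)] denseR])
      show "\<delta> * real (k * card \<B>\<^sub>1) \<le> real (card {x \<in> block_cover k \<B>\<^sub>1. {u, x} \<in> F \<and> {v, x} \<in> F})" if "v \<in> ?L" for v
        using that u \<delta> left1 fin link_edges(1)[OF F(1)] by (intro common_nbrs_block_cover[OF bf1]) auto
    qed (use fin in auto)
  qed
  have G2: "real (card G2) \<le> real (card W) * leaf_bound"
    unfolding G2_def
  proof (rule card_sparse_pairs_le[OF fin(5) fin(5)])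
    fix u assume u: "u \<in> W"
    let ?L = "{v \<in> W. {u, v} \<in> F \<and> 2 * \<delta> * real (card A\<^sub>2) \<le> real (common_nbrs E A\<^sub>2 u v)}"
    show "real (card ?L) \<le> leaf_bound"
      unfolding leaf_bound_def
    proof (rule star_leaves_bound[OF bf2 ne(2) k \<delta> len pos F2 free block_edges(2)[OF F(1)] denseR])
      show "\<delta> * real (k * card \<B>\<^sub>2) \<le> real (card {x \<in> block_cover k \<B>\<^sub>2. {u, x} \<in> F \<and> {v, x} \<in> F})" if "v \<in> ?L" for v
        using that u \<delta> left2 fin link_edges(2)[OF F(1)] by (intro common_nbrs_block_cover[OF bf2]) auto
    qed (use fin in auto)
  qed
  have C2: "C\<^sub>2 \<subseteq> A\<^sub>2" "finite C\<^sub>2" using cover2 fin finite_subset unfolding C\<^sub>2_def by blast+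
  have G3: "real (card G3) \<le> real (card C\<^sub>2) * leaf_bound"
    unfolding G3_def
  proof (rule card_sparse_pairs_le[OF C2(2) fin(7)])
    fix u assume u: "u \<in> C\<^sub>2"
    then obtain b j where bj: "b \<in> \<B>\<^sub>2" "j < k" "u = b j" unfolding C\<^sub>2_def block_cover_def by auto
    let ?L = "{v \<in> B - W. {u, v} \<in> F \<and> (\<forall>j<k. 2 * \<delta> * real (card (A\<^sub>3 j)) \<le> real (common_nbrs E (A\<^sub>3 j) u v))}"
    show "real (card ?L) \<le> leaf_bound"
      unfolding leaf_bound_def
    proof (rule star_leaves_bound[OF bf3[OF bj(2)] ne(3)[OF bj(2)] k \<delta> len pos F2 free block_edges(3)[OF F(1) bj(2)] denseR])
      show "\<delta> * real (k * card (\<B>\<^sub>3 j)) \<le> real (card {x \<in> block_cover k (\<B>\<^sub>3 j). {u, x} \<in> F \<and> {v, x} \<in> F})" if "v \<in> ?L" for v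
        using that \<delta> left3[OF bj(2)] fin3[OF bj(2)] link_edges(3)[OF F(1) _ bj(2)] link_edges(4)[OF F(1) bj(3,1,2)] bj(2)
        by (intro common_nbrs_block_cover[OF bf3[OF bj(2)]]) auto
    qed (use fin in auto)
  qed
  define lft where "lft = (A\<^sub>2 - C\<^sub>2)"
  \<comment> \<open>Uncovered vertices need a term of their own only in \<open>A\<^sub>2\<close>:
    edges from \<open>A\<^sub>1\<close> to \<open>B\<close> are counted in
    \<open>first_edges\<close> and edges at the third layer in full.\<close>
  define P where "P = lft \<times> V \<union> A \<times> A \<union> first_edges \<union> A\<^sub>2 \<times> W \<union> ?A3 \<times> V \<union> G3 \<union> bad_third \<union> G1 \<union> bad_first \<union> G2 \<union> bad_second"
  have finPs: "finite first_edges" "finite G3" "finite bad_third" "finite G1" "finite bad_first" "finite G2" "finite bad_second"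
    by (rule finite_subset[of _ "V \<times> V"]; use V W C2 V_eq in \<open>auto simp: first_edges_def G3_def bad_third_def G1_def bad_first_def G2_def bad_second_def\<close>)+
  have finP: "finite P" using finPs fin V unfolding P_def lft_def by auto
  have cover: "F \<subseteq> (\<lambda>(x, y). {x, y}) ` P"
  proof
    fix e assume e: "e \<in> F"
    then obtain x y where xy: "e = {x, y}" "x \<in> V" "y \<in> V" "x \<noteq> y" using F2 by (auto simp: nsets_def card_2_iff)
    have half: "(x, y) \<in> P \<or> (y, x) \<in> P" if xA: "x \<in> A" and "{x, y} \<in> F" "y \<in> V" for x y
    proof (cases "y \<in> A")
      case True
      then show ?thesis using xA by (auto simp: P_def)
    next
      case False
      then have yB: "y \<in> B" using that(3) by (auto simp: V_eq A_def)
      consider "x \<in> A\<^sub>1" | "x \<in> A\<^sub>2" | "x \<in> ?A3" using xA by (auto simp: A_def)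
      then show ?thesis
      proof cases
        case 1
        then have "(x, y) \<in> first_edges" using that F yB by (auto simp: first_edges_def)
        then show ?thesis by (auto simp: P_def)
      next
        case 2
        consider "x \<notin> C\<^sub>2" | "y \<in> W" | "x \<in> C\<^sub>2" "y \<notin> W" by blast
        then show ?thesis
        proof cases
          case 3
          have "(x, y) \<in> G3 \<or> (x, y) \<in> bad_third"
            using 2 3 yB that(2) by (auto simp: G3_def bad_third_def not_le)
          then show ?thesis by (auto simp: P_def)
        qed (use 2 that in \<open>auto simp: P_def lft_def\<close>)
      next
        case 3
        then show ?thesis using that by (auto simp: P_def)
      qed
    qed
    have "(x, y) \<in> P \<or> (y, x) \<in> P"
    proof (cases "x \<in> A \<or> y \<in> A")
      case True
      then show ?thesis using half[of x y] half[of y x] e xy by (auto simp: insert_commute)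
    next
      case False
      then have B: "x \<in> B" "y \<in> B" using xy by (auto simp: V_eq A_def)
      have exy: "{x, y} \<in> F" using e xy by simp
      consider "x \<notin> W" | "y \<notin> W" | "x \<in> W" "y \<in> W" by blast
      then show ?thesis
      proof cases
        case 1
        then have "(x, y) \<in> G1 \<or> (x, y) \<in> bad_first" using B exy xy by (auto simp: G1_def bad_first_def)
        then show ?thesis by (auto simp: P_def)
      next
        case 2
        then have "(y, x) \<in> G1 \<or> (y, x) \<in> bad_first" using B exy xy by (auto simp: G1_def bad_first_def insert_commute)
        then show ?thesis by (auto simp: P_def)
      next
        case 3
        then have "(x, y) \<in> G2 \<or> (x, y) \<in> bad_second" using B exy xy by (auto simp: G2_def bad_second_def)
        then show ?thesis by (auto simp: P_def)
      qed
    qed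
    then show "e \<in> (\<lambda>(x, y). {x, y}) ` P" using xy(1) by (auto simp: insert_commute)
  qed
  have "sat (V, E) (complete_multipartite s) \<le> card (edges (V, F))"
    unfolding sat_def using satF by (intro cINF_lower) auto
  also have "\<dots> \<le> card ((\<lambda>(x, y). {x, y}) ` P)" using cover finP by (auto intro: card_mono)
  also have "\<dots> \<le> card P" using finP by (rule card_image_le)
  also have "\<dots> \<le> card (lft \<times> V) + card (A \<times> A) + card first_edges + card (A\<^sub>2 \<times> W) + card (?A3 \<times> V) + card G3 + card bad_third
      + card G1 + card bad_first + card G2 + card bad_second"
    unfolding P_def by (intro order_trans[OF card_Un_le] add_mono order_refl)
  finally have "real (sat (V, E) (complete_multipartite s)) \<le> real (card lft) * real (card V) + real (card A) ^ 2 + real (card first_edges)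
      + real (card A\<^sub>2) * real (card W) + real (card ?A3) * real (card V) + real (card G3) + real (card bad_third)
      + real (card G1) + real (card bad_first) + real (card G2) + real (card bad_second)"
    by (simp add: card_cartesian_product power2_eq_square flip: of_nat_mult of_nat_add)
  moreover have "real (card lft) * real (card V) \<le> \<delta> * real (card A) * real (card V)"
  proof (intro mult_right_mono)
    have "real (card lft) \<le> \<delta> * real (card A\<^sub>2)" using left2 by (simp add: lft_def C\<^sub>2_def)
    also have "\<dots> \<le> \<delta> * real (card A)" using \<delta> fin by (intro mult_left_mono of_nat_mono card_mono) (auto simp: A_def)
    finally show "real (card lft) \<le> \<delta> * real (card A)" .
  qed auto
  moreover have "real (card G1) + real (card G2) + real (card G3) \<le> leaf_bound * (real (card A) + 2 * real (card V))"
  proof -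
    have "card B \<le> card V" "card W \<le> card V" "card C\<^sub>2 \<le> card A"
      using V W C2 fin by (auto intro!: card_mono simp: V_eq A_def)
    then have "real (card B) * leaf_bound \<le> real (card V) * leaf_bound" "real (card W) * leaf_bound \<le> real (card V) * leaf_bound"
        "real (card C\<^sub>2) * leaf_bound \<le> real (card A) * leaf_bound"
      using leafb by (auto intro: mult_right_mono)
    then show ?thesis using G1 G2 G3 by (simp add: algebra_simps)
  qed
  ultimately show ?thesis by linarith
qed

end

section \<open>Edges of the random graph\<close>

definition edge_pmf :: "'a set \<Rightarrow> real \<Rightarrow> ('a set \<Rightarrow> bool) pmf" where
  "edge_pmf V p = Pi_pmf ([V]\<^bsup>2\<^esup>) False (\<lambda>_. bernoulli_pmf p)"

definition graph_edges :: "'a set \<Rightarrow> ('a set \<Rightarrow> bool) \<Rightarrow> 'a set set" where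
  "graph_edges V c = {e \<in> [V]\<^bsup>2\<^esup>. c e}"

lemma random_graph_eq: "random_graph n p = map_pmf (\<lambda>c. ({1..n}, graph_edges {1..n} c)) (edge_pmf {1..n} p)"
  by (simp add: random_graph_def graph_edges_def edge_pmf_def)

lemma exp_minus_one_le_half: "exp (- 1) \<le> (1/2::real)"
  using exp_ge_add_one_self[of "1::real"] by (simp add: exp_minus field_simps)

locale random_edges =
  fixes V :: "'a set" and p :: real
  assumes V: "finite V" and p: "0 < p" "p < 1"
begin

abbreviation "M \<equiv> edge_pmf V p"
abbreviation "GE \<equiv> graph_edges V"

lemma finite_pairs: "finite ([V]\<^bsup>2\<^esup>)"
  using V by (rule finite_imp_finite_nsets)

lemma finite_M: "finite (set_pmf M)"
  unfolding edge_pmf_def using finite_pairs by (intro finite_set_Pi_pmf) auto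

lemma GE_iff: "u \<in> V \<Longrightarrow> v \<in> V \<Longrightarrow> u \<noteq> v \<Longrightarrow> {u, v} \<in> GE c \<longleftrightarrow> c {u, v}"
  by (simp add: graph_edges_def)

lemma prob_pattern:
  assumes "T \<subseteq> [V]\<^bsup>2\<^esup>" "S \<subseteq> [V]\<^bsup>2\<^esup>" "T \<inter> S = {}"
  shows "measure_pmf.prob M {c. (\<forall>e\<in>T. c e) \<and> (\<forall>e\<in>S. \<not> c e)} = p ^ card T * (1 - p) ^ card S"
proof -
  let ?B = "\<lambda>e. if e \<in> T then {True} else if e \<in> S then {False} else UNIV"
  have "{c. (\<forall>e\<in>T. c e) \<and> (\<forall>e\<in>S. \<not> c e)} = Pi ([V]\<^bsup>2\<^esup>) ?B"
    using assms by (auto simp: Pi_def split: if_splits)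
  then have "measure_pmf.prob M {c. (\<forall>e\<in>T. c e) \<and> (\<forall>e\<in>S. \<not> c e)}
      = (\<Prod>e\<in>[V]\<^bsup>2\<^esup>. measure_pmf.prob (bernoulli_pmf p) (?B e))"
    by (simp add: edge_pmf_def measure_Pi_pmf_Pi finite_pairs)
  also have "\<dots> = (\<Prod>e\<in>[V]\<^bsup>2\<^esup>. (if e \<in> T then p else 1) * (if e \<in> S then 1 - p else 1))"
    using assms(3) p by (intro prod.cong refl) (auto simp: measure_pmf_single)
  also have "\<dots> = p ^ card T * (1 - p) ^ card S"
    using assms finite_pairs by (simp add: prod.distrib prod.If_cases Int_absorb1)
  finally show ?thesis .
qed

section \<open>Concentration of degrees and codegrees\<close>

lemma prob_degree:
  assumes X: "X \<subseteq> V" and v: "v \<in> V - X" and t: "t \<ge> 0"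
  shows "measure_pmf.prob M {c. real (card {x\<in>X. {v, x} \<in> GE c}) \<le> T} \<le> exp (t * T) * (1 - p * (1 - exp (- t))) ^ card X"
    and "measure_pmf.prob M {c. real (card {x\<in>X. {v, x} \<in> GE c}) \<ge> T} \<le> exp (- t * T) * (1 + p * (exp t - 1)) ^ card X"
proof -
  interpret ev: independent_events "[V]\<^bsup>2\<^esup>" "\<lambda>_. bernoulli_pmf p" False X "\<lambda>x. {{v, x}}" "\<lambda>x c. c {v, x}"
    using X v V finite_pairs
    by unfold_locales (auto simp: disjoint_family_on_def depends_on_def doubleton_eq_iff intro: finite_subset)
  have eq: "{x\<in>X. {v, x} \<in> GE c} = {x\<in>X. c {v, x}}" for c
    using X v GE_iff by auto
  have pr: "measure_pmf.prob (Pi_pmf ([V]\<^bsup>2\<^esup>) False (\<lambda>_. bernoulli_pmf p)) {c. c {v, x}} = p" if "x \<in> X" for x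
    using prob_pattern[of "{{v, x}}" "{}"] that X v by (auto simp: edge_pmf_def)
  show "measure_pmf.prob M {c. real (card {x\<in>X. {v, x} \<in> GE c}) \<le> T} \<le> exp (t * T) * (1 - p * (1 - exp (- t))) ^ card X"
    unfolding eq edge_pmf_def using pr p t by (intro ev.prob_count_le) auto
  show "measure_pmf.prob M {c. real (card {x\<in>X. {v, x} \<in> GE c}) \<ge> T} \<le> exp (- t * T) * (1 + p * (exp t - 1)) ^ card X"
    unfolding eq edge_pmf_def using pr t by (intro ev.prob_count_ge) auto
qed

text \<open>Chernoff with tilt \<epsilon> and exp (- \<epsilon>) \<le> 1 - \<epsilon> + \<epsilon>^2
  / 2, which keeps the exponent quadratic in the deviation. The upper tail below uses the tilt
  \<epsilon> / 2 and exp y \<le> 1 + y + y^2 for y \<le> 1.\<close>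

lemma prob_degree_small:
  assumes X: "X \<subseteq> V" and v: "v \<in> V - X" and \<epsilon>: "0 \<le> \<epsilon>"
  shows "measure_pmf.prob M {c. real (card {x\<in>X. {v, x} \<in> GE c}) \<le> (1 - \<epsilon>) * p * real (card X)}
       \<le> exp (- (p * \<epsilon>\<^sup>2 / 2) * real (card X))"
proof -
  have "measure_pmf.prob M {c. real (card {x\<in>X. {v, x} \<in> GE c}) \<le> (1 - \<epsilon>) * p * real (card X)}
      \<le> exp (\<epsilon> * ((1 - \<epsilon>) * p * real (card X))) * (1 - p * (1 - exp (- \<epsilon>))) ^ card X"
    by (rule prob_degree(1)[OF X v \<epsilon>])
  also have "\<dots> \<le> exp (\<epsilon> * ((1 - \<epsilon>) * p * real (card X))) * exp (- p * (\<epsilon> - \<epsilon>\<^sup>2 / 2)) ^ card X"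
  proof (intro mult_left_mono power_mono)
    have "exp (- \<epsilon>) \<le> 1 - \<epsilon> + \<epsilon>\<^sup>2 / 2"
    proof -
      have "1 - \<epsilon> + \<epsilon>\<^sup>2 / 2 - exp (- \<epsilon>) \<ge> 1 - 0 + 0\<^sup>2 / 2 - exp (- 0)"
      proof (rule DERIV_nonneg_imp_nondecreasing[OF \<epsilon>])
        fix x :: real assume "0 \<le> x" "x \<le> \<epsilon>"
        have "((\<lambda>x. 1 - x + x\<^sup>2 / 2 - exp (- x)) has_real_derivative (- 1 + x + exp (- x))) (at x)"
          by (auto intro!: derivative_eq_intros)
        moreover have "- 1 + x + exp (- x) \<ge> 0" using exp_ge_add_one_self[of "- x"] by simp
        ultimately show "\<exists>y. ((\<lambda>x. 1 - x + x\<^sup>2 / 2 - exp (- x)) has_real_derivative y) (at x) \<and> y \<ge> 0" by blast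
      qed
      then show ?thesis by simp
    qed
    then have "p * (\<epsilon> - \<epsilon>\<^sup>2 / 2) \<le> p * (1 - exp (- \<epsilon>))" using p by (intro mult_left_mono) auto
    moreover have "1 - p * (\<epsilon> - \<epsilon>\<^sup>2 / 2) \<le> exp (- p * (\<epsilon> - \<epsilon>\<^sup>2 / 2))"
      using exp_ge_add_one_self[of "- p * (\<epsilon> - \<epsilon>\<^sup>2 / 2)"] by simp
    ultimately show "1 - p * (1 - exp (- \<epsilon>)) \<le> exp (- p * (\<epsilon> - \<epsilon>\<^sup>2 / 2))" by linarith
    have "p * (1 - exp (- \<epsilon>)) \<le> 1 * 1" using p \<epsilon> by (intro mult_mono) auto
    then show "0 \<le> 1 - p * (1 - exp (- \<epsilon>))" by simp
  qed auto
  also have "\<dots> = exp (- (p * \<epsilon>\<^sup>2 / 2) * real (card X))"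
    by (simp add: exp_of_nat_mult[symmetric] exp_add[symmetric] algebra_simps power2_eq_square)
  finally show ?thesis .
qed

lemma prob_degree_large:
  assumes X: "X \<subseteq> V" and v: "v \<in> V - X" and \<epsilon>: "0 \<le> \<epsilon>" "\<epsilon> \<le> 1"
  shows "measure_pmf.prob M {c. real (card {x\<in>X. {v, x} \<in> GE c}) \<ge> (1 + \<epsilon>) * p * real (card X)}
       \<le> exp (- (p * \<epsilon>\<^sup>2 / 4) * real (card X))"
proof -
  have "measure_pmf.prob M {c. real (card {x\<in>X. {v, x} \<in> GE c}) \<ge> (1 + \<epsilon>) * p * real (card X)}
      \<le> exp (- (\<epsilon> / 2) * ((1 + \<epsilon>) * p * real (card X))) * (1 + p * (exp (\<epsilon> / 2) - 1)) ^ card X"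
    using \<epsilon> by (intro prob_degree(2)[OF X v]) auto
  also have "\<dots> \<le> exp (- (\<epsilon> / 2) * ((1 + \<epsilon>) * p * real (card X))) * exp (p * (\<epsilon> / 2 + (\<epsilon> / 2)\<^sup>2)) ^ card X"
  proof (intro mult_left_mono power_mono)
    have "exp (\<epsilon> / 2) - 1 \<le> \<epsilon> / 2 + (\<epsilon> / 2)\<^sup>2" using exp_bound[of "\<epsilon> / 2"] \<epsilon> by simp
    then have "p * (exp (\<epsilon> / 2) - 1) \<le> p * (\<epsilon> / 2 + (\<epsilon> / 2)\<^sup>2)" using p by (intro mult_left_mono) auto
    then show "1 + p * (exp (\<epsilon> / 2) - 1) \<le> exp (p * (\<epsilon> / 2 + (\<epsilon> / 2)\<^sup>2))"
      using exp_ge_add_one_self[of "p * (\<epsilon> / 2 + (\<epsilon> / 2)\<^sup>2)"] by linarith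
    show "0 \<le> 1 + p * (exp (\<epsilon> / 2) - 1)" using p \<epsilon> by (intro add_nonneg_nonneg mult_nonneg_nonneg) auto
  qed auto
  also have "\<dots> = exp (- (p * \<epsilon>\<^sup>2 / 4) * real (card X))"
    by (simp add: exp_of_nat_mult[symmetric] exp_add[symmetric] field_simps power2_eq_square)
  finally show ?thesis .
qed

text \<open>The mean is p^2 |X|, and 2 \<delta> \<le> p^2 / 4 puts the threshold at no more than a
  quarter of it, so the crude tilt 1 is enough.\<close>

lemma prob_common_small:
  assumes X: "X \<subseteq> V" and uv: "u \<in> V - X" "v \<in> V - X" "u \<noteq> v" and \<delta>: "\<delta> \<le> p\<^sup>2 / 8"
  shows "measure_pmf.prob M {c. real (common_nbrs (GE c) X u v) < 2 * \<delta> * real (card X)}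
       \<le> exp (- (p\<^sup>2 / 4) * real (card X))"
proof -
  interpret ev: independent_events "[V]\<^bsup>2\<^esup>" "\<lambda>_. bernoulli_pmf p" False X "\<lambda>x. {{u, x}, {v, x}}" "\<lambda>x c. c {u, x} \<and> c {v, x}"
    using X uv V finite_pairs
    by unfold_locales (auto simp: disjoint_family_on_def depends_on_def doubleton_eq_iff intro: finite_subset)
  have eq: "common_nbrs (GE c) X u v = card {x\<in>X. c {u, x} \<and> c {v, x}}" for c
    unfolding common_nbrs_def using X uv GE_iff by (intro arg_cong[where f = card]) blast
  have pr: "measure_pmf.prob (Pi_pmf ([V]\<^bsup>2\<^esup>) False (\<lambda>_. bernoulli_pmf p)) {c. c {u, x} \<and> c {v, x}} = p\<^sup>2" if "x \<in> X" for x
    using prob_pattern[of "{{u, x}, {v, x}}" "{}"] that X uv by (auto simp: edge_pmf_def doubleton_eq_iff power2_eq_square)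
  have "measure_pmf.prob M {c. real (common_nbrs (GE c) X u v) < 2 * \<delta> * real (card X)}
      \<le> measure_pmf.prob M {c. real (common_nbrs (GE c) X u v) \<le> 2 * \<delta> * real (card X)}"
    by (intro measure_pmf.finite_measure_mono) auto
  also have "\<dots> \<le> exp (1 * (2 * \<delta> * real (card X))) * (1 - p\<^sup>2 * (1 - exp (- 1))) ^ card X"
    unfolding eq edge_pmf_def using pr p by (intro ev.prob_count_le) (auto simp: power_le_one)
  also have "\<dots> \<le> exp (p\<^sup>2 / 4 * real (card X)) * exp (- (p\<^sup>2 / 2)) ^ card X"
  proof (intro mult_mono power_mono)
    show "exp (1 * (2 * \<delta> * real (card X))) \<le> exp (p\<^sup>2 / 4 * real (card X))"
      using mult_right_mono[OF \<delta>, of "real (card X)"] by simp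
    have "p\<^sup>2 * (1 / 2) \<le> p\<^sup>2 * (1 - exp (- 1))" using exp_minus_one_le_half by (intro mult_left_mono) auto
    then show "1 - p\<^sup>2 * (1 - exp (- 1)) \<le> exp (- (p\<^sup>2 / 2))"
      using exp_ge_add_one_self[of "- (p\<^sup>2 / 2)"] by linarith
    have "p\<^sup>2 * (1 - exp (- 1)) \<le> 1 * 1" using p by (intro mult_mono) (auto simp: power_le_one)
    then show "0 \<le> 1 - p\<^sup>2 * (1 - exp (- 1))" by simp
    then show "0 \<le> (1 - p\<^sup>2 * (1 - exp (- 1))) ^ card X" by simp
  qed auto
  also have "\<dots> = exp (- (p\<^sup>2 / 4) * real (card X))"
    by (simp add: exp_of_nat_mult[symmetric] exp_add[symmetric] algebra_simps)
  finally show ?thesis .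
qed

text \<open>Exponential tilting: with \<open>exp \<mu> = 1 / y\<close> the factor of every \<open>x \<in> X\<close> has expectation exactly 1.\<close>

lemma prob_degree_large_common_small:
  assumes X: "X \<subseteq> V" and uv: "u \<in> V - X" "v \<in> V - X" "u \<noteq> v" and t: "t \<ge> 0"
  defines "y \<equiv> 1 - p * (1 - exp (- t))"
  shows "measure_pmf.prob M {c. card {x\<in>X. {u, x} \<in> GE c} \<ge> L \<and> real (common_nbrs (GE c) X u v) < T}
       \<le> exp (t * T) * y ^ L"
proof -
  \<comment> \<open>\<open>y\<close> is the expectation of exp (- t) or 1 according to whether
    \<open>v\<close> is adjacent to a given neighbour of \<open>u\<close>. It tends to 1 - p for
    large \<open>t\<close>, the factor by which each neighbour of \<open>u\<close> should lower the
    probability.\<close>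
  have e1: "exp (- t) \<le> 1" using t by simp
  have "p * (1 - exp (- t)) \<le> p * 1" using p e1 by (intro mult_left_mono) auto
  then have y0: "0 < y" using p unfolding y_def by linarith
  have y1: "y \<le> 1" using p e1 by (simp add: y_def)
  define \<mu> where "\<mu> = - ln y"
  have \<mu>: "\<mu> \<ge> 0" "exp \<mu> = 1 / y" using y0 y1 by (auto simp: \<mu>_def exp_minus divide_inverse)
  \<comment> \<open>The product over \<open>X\<close> is exp (\<mu> d - t m), where d is the degree
    of \<open>u\<close> into \<open>X\<close> and m the number of common neighbours. On the event in
    question it is at least exp (\<mu> L - t T), so its inverse is the required prefactor.\<close>
  define f where "f x c = (if c {u, x} \<and> c {v, x} then exp (\<mu> - t) else if c {u, x} then exp \<mu> else 1)" for x and c :: "'a set \<Rightarrow> bool"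
  have finX: "finite X" using X V finite_subset by blast
  have cnt: "(\<Sum>x\<in>X. a * (if P x then 1 else 0)) = a * real (card {x\<in>X. P x})" for a and P :: "'a \<Rightarrow> bool"
    unfolding sum_distrib_left[symmetric] using finX by (simp add: sum.If_cases Int_def)
  have "measure_pmf.prob M {c. card {x\<in>X. {u, x} \<in> GE c} \<ge> L \<and> real (common_nbrs (GE c) X u v) < T}
      \<le> measure_pmf.expectation M (\<lambda>c. (exp (t * T) * exp (- \<mu> * real L)) * (\<Prod>x\<in>X. f x c))"
  proof (rule prob_le_expectation[OF finite_M])
    show "0 \<le> exp (t * T) * exp (- \<mu> * real L) * (\<Prod>x\<in>X. f x c)" for c
      by (intro mult_nonneg_nonneg prod_nonneg) (auto simp: f_def)
    fix c assume "c \<in> {c. card {x\<in>X. {u, x} \<in> GE c} \<ge> L \<and> real (common_nbrs (GE c) X u v) < T}"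
    moreover have "{x\<in>X. {u, x} \<in> GE c} = {x\<in>X. c {u, x}}" using X uv GE_iff by auto
    moreover have "common_nbrs (GE c) X u v = card {x\<in>X. c {u, x} \<and> c {v, x}}"
      unfolding common_nbrs_def using X uv GE_iff by (intro arg_cong[where f = card]) blast
    ultimately have c: "real L \<le> real (card {x\<in>X. c {u, x}})" "real (card {x\<in>X. c {u, x} \<and> c {v, x}}) \<le> T" by auto
    have "f x c = exp (\<mu> * (if c {u, x} then 1 else 0)) * exp (- t * (if c {u, x} \<and> c {v, x} then 1 else 0))" for x
      by (auto simp: f_def exp_add[symmetric])
    then have "(\<Prod>x\<in>X. f x c) = exp (\<Sum>x\<in>X. \<mu> * (if c {u, x} then 1 else 0)) * exp (\<Sum>x\<in>X. - t * (if c {u, x} \<and> c {v, x} then 1 else 0))"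
      using finX by (simp add: prod.distrib exp_sum)
    also have "\<dots> = exp (\<mu> * real (card {x\<in>X. c {u, x}})) * exp (- t * real (card {x\<in>X. c {u, x} \<and> c {v, x}}))"
      unfolding cnt ..
    finally have "exp (t * T) * exp (- \<mu> * real L) * (\<Prod>x\<in>X. f x c)
        = exp (\<mu> * (real (card {x\<in>X. c {u, x}}) - real L) + t * (T - real (card {x\<in>X. c {u, x} \<and> c {v, x}})))"
      by (simp add: exp_add[symmetric] algebra_simps)
    also have "\<dots> \<ge> 1" using c \<mu> t by simp
    finally show "1 \<le> exp (t * T) * exp (- \<mu> * real L) * (\<Prod>x\<in>X. f x c)" .
  qed
  also have "\<dots> = exp (t * T) * exp (- \<mu> * real L) * measure_pmf.expectation M (\<lambda>c. \<Prod>x\<in>X. f x c)" by simp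
  also have "measure_pmf.expectation M (\<lambda>c. \<Prod>x\<in>X. f x c) = (\<Prod>x\<in>X. measure_pmf.expectation M (f x))"
  proof (rule expectation_prod_disjoint[where J = "\<lambda>x. {{u, x}, {v, x}}"])
    show "disjoint_family_on (\<lambda>x. {{u, x}, {v, x}}) X"
      using X uv by (auto simp: disjoint_family_on_def doubleton_eq_iff)
    show "depends_on (f x) {{u, x}, {v, x}}" for x by (auto simp: depends_on_def f_def)
  qed (use X uv finX finite_pairs in \<open>auto simp: edge_pmf_def\<close>)
  also have "\<dots> = (\<Prod>x\<in>X. 1)"
  proof (intro prod.cong refl)
    fix x assume x: "x \<in> X"
    have pr1: "measure_pmf.prob M {c. c {u, x}} = p"
      using prob_pattern[of "{{u, x}}" "{}"] x X uv by auto
    have pr2: "measure_pmf.prob M {c. c {u, x} \<and> c {v, x}} = p\<^sup>2"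
      using prob_pattern[of "{{u, x}, {v, x}}" "{}"] x X uv by (auto simp: doubleton_eq_iff power2_eq_square)
    have fx: "f x = (\<lambda>c. (if c {u, x} \<and> c {v, x} then exp (\<mu> - t) - exp \<mu> else 0) + (if c {u, x} then exp \<mu> else 1))"
      by (auto simp: f_def fun_eq_iff)
    have "measure_pmf.expectation M (f x)
        = measure_pmf.expectation M (\<lambda>c. if c {u, x} \<and> c {v, x} then exp (\<mu> - t) - exp \<mu> else 0)
        + measure_pmf.expectation M (\<lambda>c. if c {u, x} then exp \<mu> else 1)"
      unfolding fx by (intro Bochner_Integration.integral_add integrable_measure_pmf_finite[OF finite_M])
    also have "\<dots> = (exp (\<mu> - t) - exp \<mu>) * p\<^sup>2 + (1 + (exp \<mu> - 1) * p)"
      by (simp add: expectation_if pr1 pr2)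
    also have "\<dots> = 1"
    proof -
      have "exp (\<mu> - t) = exp (- t) / y" using \<mu> by (simp add: exp_diff exp_minus divide_inverse mult.commute)
      then have "(exp (\<mu> - t) - exp \<mu>) * p\<^sup>2 + (1 + (exp \<mu> - 1) * p) - 1 = (p / y) * ((exp (- t) - 1) * p + (1 - y))"
        using y0 \<mu> by (simp add: field_simps power2_eq_square)
      also have "(exp (- t) - 1) * p + (1 - y) = 0" by (simp add: y_def algebra_simps)
      finally show ?thesis by simp
    qed
    finally show "measure_pmf.expectation M (f x) = 1" .
  qed
  also have "exp (- \<mu> * real L) = y ^ L"
    using y0 by (simp add: \<mu>_def exp_of_nat2_mult)
  finally show ?thesis by simp
qed

lemma prob_few_edges:
  assumes Y: "Y \<subseteq> V" and y: "card Y \<ge> 2"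
  shows "measure_pmf.prob M {c. real (card {e\<in>[Y]\<^bsup>2\<^esup>. e \<in> GE c}) \<le> p / 16 * real (card Y) ^ 2}
       \<le> exp (- (p / 16) * real (card Y) ^ 2)"
proof -
  have finY: "finite Y" using Y V finite_subset by blast
  have sub: "[Y]\<^bsup>2\<^esup> \<subseteq> [V]\<^bsup>2\<^esup>" using Y by (rule nsets_mono)
  interpret ev: independent_events "[V]\<^bsup>2\<^esup>" "\<lambda>_. bernoulli_pmf p" False "[Y]\<^bsup>2\<^esup>" "\<lambda>e. {e}" "\<lambda>e c. c e"
    using sub finite_pairs
    by unfold_locales (auto simp: disjoint_family_on_def depends_on_def finY finite_imp_finite_nsets)
  have eq: "{e\<in>[Y]\<^bsup>2\<^esup>. e \<in> GE c} = {e\<in>[Y]\<^bsup>2\<^esup>. c e}" for c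
    using sub by (auto simp: graph_edges_def)
  have pr: "measure_pmf.prob (Pi_pmf ([V]\<^bsup>2\<^esup>) False (\<lambda>_. bernoulli_pmf p)) {c. c e} = p" if "e \<in> [Y]\<^bsup>2\<^esup>" for e
    using prob_pattern[of "{e}" "{}"] that sub by (auto simp: edge_pmf_def)
  have "[Y]\<^bsup>2\<^esup> = {T. T \<subseteq> Y \<and> card T = 2}"
    using finY by (auto simp: nsets_def dest: finite_subset)
  then have "card ([Y]\<^bsup>2\<^esup>) = card Y choose 2" using n_subsets[OF finY, of 2] by simp
  also have "real \<dots> = real (card Y) * (real (card Y) - 1) / 2"
    using y by (simp add: choose_two real_of_nat_div of_nat_diff)
  also have "\<dots> \<ge> real (card Y) * (real (card Y) / 2) / 2"
    using y by (intro divide_right_mono mult_left_mono) auto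
  finally have c2: "real (card ([Y]\<^bsup>2\<^esup>)) \<ge> real (card Y) ^ 2 / 4" by (simp add: power2_eq_square)
  have "measure_pmf.prob M {c. real (card {e\<in>[Y]\<^bsup>2\<^esup>. e \<in> GE c}) \<le> p / 16 * real (card Y) ^ 2}
      \<le> exp (1 * (p / 16 * real (card Y) ^ 2)) * (1 - p * (1 - exp (- 1))) ^ card ([Y]\<^bsup>2\<^esup>)"
    unfolding eq edge_pmf_def using pr p by (intro ev.prob_count_le) auto
  also have "\<dots> \<le> exp (1 * (p / 16 * real (card Y) ^ 2)) * exp (- (p / 2)) ^ card ([Y]\<^bsup>2\<^esup>)"
  proof (intro mult_left_mono power_mono)
    have "p * (1 / 2) \<le> p * (1 - exp (- 1))" using exp_minus_one_le_half p by (intro mult_left_mono) auto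
    then show "1 - p * (1 - exp (- 1)) \<le> exp (- (p / 2))"
      using exp_ge_add_one_self[of "- (p / 2)"] by linarith
    have "p * (1 - exp (- 1)) \<le> 1 * 1" using p by (intro mult_mono) auto
    then show "0 \<le> 1 - p * (1 - exp (- 1))" by simp
  qed auto
  also have "\<dots> = exp (p / 16 * real (card Y) ^ 2 - p / 2 * real (card ([Y]\<^bsup>2\<^esup>)))"
    by (simp add: exp_of_nat_mult[symmetric] exp_add[symmetric] algebra_simps)
  also have "\<dots> \<le> exp (p / 16 * real (card Y) ^ 2 - p / 2 * (real (card Y) ^ 2 / 4))"
    using c2 p by (simp add: mult_left_mono)
  also have "\<dots> = exp (- (p / 16) * real (card Y) ^ 2)" by (simp add: algebra_simps)
  finally show ?thesis .
qed

end

text \<open>Some vertex of \<open>Y\<close> is adjacent to a fraction \<rho> of \<open>Y\<close>;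
  the search continues in its neighbourhood. Each of the \<open>j\<close> rounds costs a factor
  \<rho>, and the sets stay above \<theta>, where the density hypothesis applies.\<close>

lemma dense_subsets_imp_clique:
  fixes \<rho> \<theta> :: real
  assumes X: "finite X" and \<rho>: "0 < \<rho>" "\<rho> \<le> 1" and \<theta>: "\<theta> > 0"
    and dense: "\<And>Y. Y \<subseteq> X \<Longrightarrow> real (card Y) \<ge> \<theta> \<Longrightarrow> real (card {e\<in>[Y]\<^bsup>2\<^esup>. e \<in> E}) > \<rho> * real (card Y) ^ 2"
  shows "Y \<subseteq> X \<Longrightarrow> \<rho> ^ j * real (card Y) \<ge> \<theta> \<Longrightarrow> \<exists>K\<subseteq>Y. card K = j \<and> [K]\<^bsup>2\<^esup> \<subseteq> E"
proof (induction j arbitrary: Y)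
  case 0
  show ?case by (intro exI[of _ "{}"]) (auto simp: nsets_def)
next
  case (Suc j)
  have finY: "finite Y" using Suc.prems X finite_subset by blast
  define N where "N v = {u\<in>Y. u \<noteq> v \<and> {v, u} \<in> E}" for v
  have "\<rho> ^ Suc j * real (card Y) \<le> 1 * real (card Y)"
    using \<rho> by (intro mult_right_mono power_le_one) auto
  then have "real (card Y) \<ge> \<theta>" using Suc.prems by linarith
  then have big: "real (card {e\<in>[Y]\<^bsup>2\<^esup>. e \<in> E}) > \<rho> * real (card Y) ^ 2" using dense Suc.prems by blast
  have "\<exists>v\<in>Y. real (card (N v)) \<ge> \<rho> * real (card Y)"
  proof (rule ccontr)
    assume neg: "\<not> ?thesis"
    have "{e\<in>[Y]\<^bsup>2\<^esup>. e \<in> E} \<subseteq> (\<lambda>(v, u). {v, u}) ` (SIGMA v:Y. N v)"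
      by (auto simp: nsets_def card_2_iff N_def image_iff)
    then have "card {e\<in>[Y]\<^bsup>2\<^esup>. e \<in> E} \<le> card (SIGMA v:Y. N v)"
      using finY by (intro surj_card_le) (auto simp: N_def)
    also have "\<dots> = (\<Sum>v\<in>Y. card (N v))" using finY by (intro card_SigmaI) (auto simp: N_def)
    finally have "real (card {e\<in>[Y]\<^bsup>2\<^esup>. e \<in> E}) \<le> (\<Sum>v\<in>Y. real (card (N v)))" by (metis of_nat_le_iff of_nat_sum)
    also have "\<dots> \<le> real (card Y) * (\<rho> * real (card Y))"
      using neg by (intro sum_bounded_above) (auto simp: not_le less_imp_le)
    finally show False using big by (simp add: power2_eq_square algebra_simps)
  qed
  then obtain v where v: "v \<in> Y" "real (card (N v)) \<ge> \<rho> * real (card Y)" by blast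
  have "\<theta> \<le> \<rho> ^ j * (\<rho> * real (card Y))" using Suc.prems by (simp add: algebra_simps)
  also have "\<dots> \<le> \<rho> ^ j * real (card (N v))" using v \<rho> by (intro mult_left_mono) auto
  finally obtain K where K: "K \<subseteq> N v" "card K = j" "[K]\<^bsup>2\<^esup> \<subseteq> E"
    using Suc.IH[of "N v"] Suc.prems by (auto simp: N_def)
  have finK: "finite K" by (rule finite_subset[OF _ finY]) (use K(1) in \<open>auto simp: N_def\<close>)
  have "v \<notin> K" using K(1) by (auto simp: N_def)
  moreover have "[insert v K]\<^bsup>2\<^esup> \<subseteq> E"
  proof
    fix e assume "e \<in> [insert v K]\<^bsup>2\<^esup>"
    then obtain a b where ab: "e = {a, b}" "a \<in> insert v K" "b \<in> insert v K" "a \<noteq> b" by (auto simp: nsets_def card_2_iff)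
    consider "a = v" "b \<in> K" | "b = v" "a \<in> K" | "a \<in> K" "b \<in> K" using ab by blast
    then show "e \<in> E"
    proof cases
      case 3
      then have "{a, b} \<in> [K]\<^bsup>2\<^esup>" using ab by auto
      then show ?thesis using K ab by blast
    qed (use K(1) ab in \<open>auto simp: N_def insert_commute\<close>)
  qed
  ultimately show ?case
    using v K finK by (intro exI[of _ "insert v K"]) (auto simp: N_def)
qed

text \<open>At most 2^|X| subsets compete with an error exponential in |X|^2, so the bound vanishes
  as soon as |X| tends to infinity, however slowly; this allows the third layer to be of size o(log
  n).\<close>

lemma (in random_edges) prob_not_clique_rich:
  assumes X: "X \<subseteq> V" and \<eta>: "0 < \<eta>" and big: "(p / 16) ^ k * \<eta> * real (card X) \<ge> 2"
  shows "measure_pmf.prob M {c. \<not> clique_rich (GE c) k \<eta> X}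
       \<le> 2 ^ card X * exp (- (p / 16) * ((p / 16) ^ k * \<eta> * real (card X)) ^ 2)"
proof -
  define \<theta> where "\<theta> = (p / 16) ^ k * \<eta> * real (card X)"
  have finX: "finite X" using X V finite_subset by blast
  define Ys where "Ys = {Y. Y \<subseteq> X \<and> real (card Y) \<ge> \<theta>}"
  have "measure_pmf.prob M {c. \<not> clique_rich (GE c) k \<eta> X}
      \<le> measure_pmf.prob M {c. \<exists>Y\<in>Ys. real (card {e\<in>[Y]\<^bsup>2\<^esup>. e \<in> GE c}) \<le> p / 16 * real (card Y) ^ 2}"
  proof (intro measure_pmf.finite_measure_mono subsetI CollectI)
    fix c assume c: "c \<in> {c. \<not> clique_rich (GE c) k \<eta> X}"
    show "\<exists>Y\<in>Ys. real (card {e\<in>[Y]\<^bsup>2\<^esup>. e \<in> GE c}) \<le> p / 16 * real (card Y) ^ 2"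
    proof (rule ccontr)
      assume neg: "\<not> ?thesis"
      have "clique_rich (GE c) k \<eta> X"
        unfolding clique_rich_def
      proof (intro allI impI)
        fix Y assume Y: "Y \<subseteq> X" "real (card Y) \<ge> \<eta> * real (card X)"
        show "\<exists>K\<subseteq>Y. card K = k \<and> [K]\<^bsup>2\<^esup> \<subseteq> GE c"
        proof (rule dense_subsets_imp_clique[OF finX, of "p / 16" \<theta>])
          show "\<theta> \<le> (p / 16) ^ k * real (card Y)"
            using Y p unfolding \<theta>_def mult.assoc by (intro mult_left_mono) auto
        qed (use neg Y p big in \<open>auto simp: Ys_def \<theta>_def not_le\<close>)
      qed
      then show False using c by simp
    qed
  qed auto
  also have "\<dots> \<le> real (card Ys) * exp (- (p / 16) * \<theta> ^ 2)"
  proof (rule prob_UN_le)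
    show "finite Ys" using finX by (auto simp: Ys_def)
    fix Y assume Y: "Y \<in> Ys"
    then have "real (card Y) \<ge> 2" using big by (auto simp: Ys_def \<theta>_def)
    then have "measure_pmf.prob M {c. real (card {e\<in>[Y]\<^bsup>2\<^esup>. e \<in> GE c}) \<le> p / 16 * real (card Y) ^ 2}
        \<le> exp (- (p / 16) * real (card Y) ^ 2)"
      using Y X by (intro prob_few_edges) (auto simp: Ys_def)
    also have "\<dots> \<le> exp (- (p / 16) * \<theta> ^ 2)"
      using Y p big by (auto simp: Ys_def \<theta>_def intro!: mult_left_mono power_mono)
    finally show "measure_pmf.prob M {c. real (card {e\<in>[Y]\<^bsup>2\<^esup>. e \<in> GE c}) \<le> p / 16 * real (card Y) ^ 2} \<le> exp (- (p / 16) * \<theta> ^ 2)" .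
  qed
  also have "\<dots> \<le> 2 ^ card X * exp (- (p / 16) * \<theta> ^ 2)"
  proof (intro mult_right_mono)
    have "card Ys \<le> card (Pow X)" using finX by (intro card_mono) (auto simp: Ys_def)
    then show "real (card Ys) \<le> 2 ^ card X" using finX by (simp add: card_Pow)
  qed auto
  finally show ?thesis unfolding \<theta>_def .
qed

text \<open>A union bound over sets of size exactly \<open>K\<close>: enlarging \<open>S\<close> only removes such vertices.\<close>

lemma (in random_edges) prob_few_nonneighbours:
  fixes K :: nat and T :: real
  assumes K: "K < card V"
  shows "measure_pmf.prob M {c. \<exists>v\<in>V. \<exists>S\<subseteq>V - {v}. card S \<le> K \<and>
            real (card {u \<in> V - S - {v}. {u, v} \<in> GE c \<and> (\<forall>x\<in>S. {u, x} \<notin> GE c)}) \<le> T}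
       \<le> real (card V) * real (card V) ^ K * exp (T - p * (1 - p) ^ K / 2 * (real (card V) - real K - 1))"
proof -
  define Z where "Z = {(v, S). v \<in> V \<and> S \<subseteq> V - {v} \<and> card S = K}"
  define few where "few = (\<lambda>(v, S) c. real (card {u \<in> V - S - {v}. {u, v} \<in> GE c \<and> (\<forall>x\<in>S. {u, x} \<notin> GE c)}) \<le> T)"
  have finZ: "finite Z" by (rule finite_subset[of _ "V \<times> Pow V"]) (use V in \<open>auto simp: Z_def\<close>)
  have "measure_pmf.prob M {c. \<exists>v\<in>V. \<exists>S\<subseteq>V - {v}. card S \<le> K \<and>
            real (card {u \<in> V - S - {v}. {u, v} \<in> GE c \<and> (\<forall>x\<in>S. {u, x} \<notin> GE c)}) \<le> T}
      \<le> measure_pmf.prob M {c. \<exists>z\<in>Z. few z c}"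
  proof (intro measure_pmf.finite_measure_mono subsetI CollectI)
    fix c assume "c \<in> {c. \<exists>v\<in>V. \<exists>S\<subseteq>V - {v}. card S \<le> K \<and>
            real (card {u \<in> V - S - {v}. {u, v} \<in> GE c \<and> (\<forall>x\<in>S. {u, x} \<notin> GE c)}) \<le> T}"
    then obtain v S where vS: "v \<in> V" "S \<subseteq> V - {v}" "card S \<le> K"
        "real (card {u \<in> V - S - {v}. {u, v} \<in> GE c \<and> (\<forall>x\<in>S. {u, x} \<notin> GE c)}) \<le> T" by blast
    have "K \<le> card (V - {v})" using K vS V by simp
    then obtain S' where S': "S \<subseteq> S'" "S' \<subseteq> V - {v}" "card S' = K"
      using exists_subset_between[OF vS(3) _ vS(2)] V by auto
    have "card {u \<in> V - S' - {v}. {u, v} \<in> GE c \<and> (\<forall>x\<in>S'. {u, x} \<notin> GE c)}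
        \<le> card {u \<in> V - S - {v}. {u, v} \<in> GE c \<and> (\<forall>x\<in>S. {u, x} \<notin> GE c)}"
      using S' V by (intro card_mono) auto
    then have "few (v, S') c" using vS(4) by (auto simp: few_def)
    moreover have "(v, S') \<in> Z" using vS S' by (auto simp: Z_def)
    ultimately show "\<exists>z\<in>Z. few z c" by blast
  qed auto
  also have "\<dots> \<le> real (card Z) * exp (T - p * (1 - p) ^ K / 2 * (real (card V) - real K - 1))"
  proof (rule prob_UN_le[OF finZ])
    fix z assume "z \<in> Z"
    then obtain v S where z: "z = (v, S)" and v: "v \<in> V" and S: "S \<subseteq> V - {v}" "card S = K" by (auto simp: Z_def)
    have finS: "finite S" using S V finite_subset by blast
    define U where "U = V - S - {v}"
    define q where "q = p * (1 - p) ^ K"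
    have q: "0 \<le> q" "q \<le> 1" using p by (auto simp: q_def intro!: mult_le_one power_le_one)
    \<comment> \<open>For different \<open>u\<close> outside \<open>S\<close> and \<open>v\<close>,
      the pairs joining \<open>u\<close> to \<open>v\<close> and to \<open>S\<close> are disjoint
      sets of coordinates.\<close>
    interpret ev: independent_events "[V]\<^bsup>2\<^esup>" "\<lambda>_. bernoulli_pmf p" False U "\<lambda>u. insert {u, v} ((\<lambda>x. {u, x}) ` S)"
      "\<lambda>u c. c {u, v} \<and> (\<forall>x\<in>S. \<not> c {u, x})"
      using v S V finite_pairs
      by unfold_locales (auto simp: U_def disjoint_family_on_def depends_on_def doubleton_eq_iff)
    have pr: "measure_pmf.prob (Pi_pmf ([V]\<^bsup>2\<^esup>) False (\<lambda>_. bernoulli_pmf p)) {c. c {u, v} \<and> (\<forall>x\<in>S. \<not> c {u, x})} = q" if u: "u \<in> U" for u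
    proof -
      have "card ((\<lambda>x. {u, x}) ` S) = K"
        using S by (subst card_image) (auto simp: inj_on_def doubleton_eq_iff)
      moreover have "{{u, v}} \<subseteq> [V]\<^bsup>2\<^esup>" "(\<lambda>x. {u, x}) ` S \<subseteq> [V]\<^bsup>2\<^esup>" "{{u, v}} \<inter> (\<lambda>x. {u, x}) ` S = {}"
        using u v S by (auto simp: U_def doubleton_eq_iff)
      ultimately show ?thesis
        using prob_pattern[of "{{u, v}}" "(\<lambda>x. {u, x}) ` S"] by (simp add: edge_pmf_def q_def)
    qed
    have eq: "{u \<in> V - S - {v}. {u, v} \<in> GE c \<and> (\<forall>x\<in>S. {u, x} \<notin> GE c)} = {u\<in>U. c {u, v} \<and> (\<forall>x\<in>S. \<not> c {u, x})}" for c
      using v S GE_iff unfolding U_def by blast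
    have "measure_pmf.prob M {c. few z c} \<le> exp (1 * T) * (1 - q * (1 - exp (- 1))) ^ card U"
      unfolding few_def z prod.case eq edge_pmf_def using pr q by (intro ev.prob_count_le) auto
    also have "\<dots> \<le> exp (1 * T) * exp (- (q / 2)) ^ card U"
    proof (intro mult_left_mono power_mono)
      have "q * (1 / 2) \<le> q * (1 - exp (- 1))" using exp_minus_one_le_half q by (intro mult_left_mono) auto
      then show "1 - q * (1 - exp (- 1)) \<le> exp (- (q / 2))"
        using exp_ge_add_one_self[of "- (q / 2)"] by linarith
      have "q * (1 - exp (- 1)) \<le> 1 * 1" using q by (intro mult_mono) auto
      then show "0 \<le> 1 - q * (1 - exp (- 1))" by simp
    qed auto
    also have "\<dots> = exp (T - q / 2 * real (card U))"
      by (simp add: exp_of_nat_mult[symmetric] exp_add[symmetric] algebra_simps)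
    also have "real (card U) = real (card V) - real K - 1"
    proof -
      have "U = V - insert v S" by (auto simp: U_def)
      then have "card U = card V - Suc K"
        using v S V finS by (simp add: card_Diff_subset card_insert_if subset_Diff_insert)
      then show ?thesis using K by simp
    qed
    finally show "measure_pmf.prob M {c. few z c} \<le> exp (T - p * (1 - p) ^ K / 2 * (real (card V) - real K - 1))"
      by (simp add: q_def)
  qed
  also have "\<dots> \<le> real (card V) * real (card V) ^ K * exp (T - p * (1 - p) ^ K / 2 * (real (card V) - real K - 1))"
  proof (intro mult_right_mono)
    have "Z \<subseteq> V \<times> [V]\<^bsup>K\<^esup>" using V by (auto simp: Z_def nsets_def intro: finite_subset)
    then have "card Z \<le> card (V \<times> [V]\<^bsup>K\<^esup>)" using V by (intro card_mono) (auto simp: finite_imp_finite_nsets)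
    then have "real (card Z) \<le> real (card V) * real (card ([V]\<^bsup>K\<^esup>))"
      by (simp add: card_cartesian_product flip: of_nat_mult)
    also have "\<dots> \<le> real (card V) * real (card V) ^ K" using card_nsets_le_power[OF V] by (intro mult_left_mono) auto
    finally show "real (card Z) \<le> real (card V) * real (card V) ^ K" .
  qed auto
  finally show ?thesis .
qed

section \<open>The random frame\<close>

lemma exists_disjoint_subsets:
  assumes "finite V" "k * m \<le> card V"
  shows "\<exists>A. (\<forall>j<k. A j \<subseteq> V \<and> card (A j) = m) \<and> (\<forall>i<k. \<forall>j<k. i \<noteq> j \<longrightarrow> A i \<inter> A j = {})"
  using assms
proof (induction k arbitrary: V)
  case (Suc k)
  then have "m \<le> card V" by simp
  then obtain X where X: "X \<subseteq> V" "card X = m" "finite X" by (rule obtain_subset_with_card_n)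
  have "k * m \<le> card (V - X)" using X Suc.prems by (simp add: card_Diff_subset)
  then obtain A where A: "\<And>j. j < k \<Longrightarrow> A j \<subseteq> V - X \<and> card (A j) = m" "\<And>i j. i < k \<Longrightarrow> j < k \<Longrightarrow> i \<noteq> j \<Longrightarrow> A i \<inter> A j = {}"
    using Suc.IH[of "V - X"] Suc.prems by blast
  show ?case
  proof (intro exI[of _ "A(k := X)"] conjI allI impI)
    fix j assume "j < Suc k"
    then show "(A(k := X)) j \<subseteq> V" "card ((A(k := X)) j) = m"
      using A(1)[of j] X by (auto simp: less_Suc_eq)
  next
    fix i j assume "i < Suc k" "j < Suc k" "i \<noteq> j"
    then show "(A(k := X)) i \<inter> (A(k := X)) j = {}"
      using A(1)[of i] A(1)[of j] A(2)[of i j] by (auto simp: less_Suc_eq)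
  qed
qed auto

lemma exists_layers:
  assumes V: "finite V" "N\<^sub>1 + N\<^sub>2 + k * N\<^sub>3 \<le> card V"
  obtains A\<^sub>1 A\<^sub>2 :: "'a set" and A\<^sub>3 :: "nat \<Rightarrow> 'a set" and B :: "'a set"
  where "V = A\<^sub>1 \<union> A\<^sub>2 \<union> (\<Union>j<k. A\<^sub>3 j) \<union> B"
    "A\<^sub>1 \<inter> A\<^sub>2 = {}" "A\<^sub>1 \<inter> (\<Union>j<k. A\<^sub>3 j) = {}" "A\<^sub>1 \<inter> B = {}" "A\<^sub>2 \<inter> (\<Union>j<k. A\<^sub>3 j) = {}"
    "A\<^sub>2 \<inter> B = {}" "(\<Union>j<k. A\<^sub>3 j) \<inter> B = {}"
    "\<And>i j. i < k \<Longrightarrow> j < k \<Longrightarrow> i \<noteq> j \<Longrightarrow> A\<^sub>3 i \<inter> A\<^sub>3 j = {}"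
    "card A\<^sub>1 = N\<^sub>1" "card A\<^sub>2 = N\<^sub>2" "\<And>j. j < k \<Longrightarrow> card (A\<^sub>3 j) = N\<^sub>3"
proof -
  have "N\<^sub>1 \<le> card V" using V by simp
  then obtain A\<^sub>1 where A1: "A\<^sub>1 \<subseteq> V" "card A\<^sub>1 = N\<^sub>1" "finite A\<^sub>1" by (rule obtain_subset_with_card_n)
  have c1: "card (V - A\<^sub>1) = card V - N\<^sub>1" using A1 by (simp add: card_Diff_subset)
  then have "N\<^sub>2 \<le> card (V - A\<^sub>1)" using V by simp
  then obtain A\<^sub>2 where A2: "A\<^sub>2 \<subseteq> V - A\<^sub>1" "card A\<^sub>2 = N\<^sub>2" "finite A\<^sub>2" by (rule obtain_subset_with_card_n)
  have "card (V - A\<^sub>1 - A\<^sub>2) = card V - N\<^sub>1 - N\<^sub>2" using A2 c1 by (simp add: card_Diff_subset)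
  then have "k * N\<^sub>3 \<le> card (V - A\<^sub>1 - A\<^sub>2)" using V by simp
  then obtain A\<^sub>3 where A3: "\<forall>j<k. A\<^sub>3 j \<subseteq> V - A\<^sub>1 - A\<^sub>2 \<and> card (A\<^sub>3 j) = N\<^sub>3" "\<forall>i<k. \<forall>j<k. i \<noteq> j \<longrightarrow> A\<^sub>3 i \<inter> A\<^sub>3 j = {}"
    using exists_disjoint_subsets[of "V - A\<^sub>1 - A\<^sub>2" k N\<^sub>3] V by auto
  have sub3: "(\<Union>j<k. A\<^sub>3 j) \<subseteq> V - A\<^sub>1 - A\<^sub>2" using A3(1) by blast
  show ?thesis
    by (rule that[of A\<^sub>1 A\<^sub>2 A\<^sub>3 "V - A\<^sub>1 - A\<^sub>2 - (\<Union>j<k. A\<^sub>3 j)"]) (use A1 A2 A3 sub3 in blast)+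
qed

text \<open>The layers are fixed vertex sets; only the blocks and the weak set
  \<open>light c\<close> depend on the graph. \<epsilon> is the relative deviation of degrees into
  \<open>A\<^sub>1\<close>, \<gamma> the tolerated fraction of light vertices, \<open>t\<close> the
  tilt for \<open>bad\<^sub>1\<close>, and \<open>z\<close>, later ln n, the scale of the allowance
  for \<open>bad\<^sub>3\<close>. The bound on \<open>L\<close> puts the threshold for being light
  below the typical degree.\<close>

locale random_frame = random_edges V p
  for V :: "'a set" and p :: real +
  fixes s :: "nat list" and k :: nat and R :: "nat \<Rightarrow> nat \<Rightarrow> bool" and \<delta> :: real
    and N\<^sub>1 N\<^sub>2 N\<^sub>3 L :: nat and \<epsilon> \<gamma> t z :: real
    and A\<^sub>1 A\<^sub>2 :: "'a set" and A\<^sub>3 :: "nat \<Rightarrow> 'a set" and B :: "'a set"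
  assumes len: "length s \<ge> 3" and sorted: "sorted s" and pos: "\<forall>a\<in>set s. 0 < a"
    and k: "k > 0" and symR: "symp R" and irrR: "irreflp R"
    and freeR: "\<And>Q. \<not> multipartite_copy R {..<k} (butlast s) Q"
    and denseR: "\<And>D. D \<subseteq> {..<k} \<Longrightarrow> real (card D) \<ge> \<delta> / 2 * real k \<Longrightarrow>
        \<exists>Q. multipartite_copy R D ((butlast s)[0 := butlast s ! 0 - 1]) Q"
    and \<delta>: "0 < \<delta>" "\<delta> \<le> p\<^sup>2 / 8" and \<epsilon>: "0 < \<epsilon>" "\<epsilon> \<le> 1" and \<gamma>: "\<gamma> > 0" and t: "t \<ge> 0" and z: "z > 0"
    and V_eq: "V = A\<^sub>1 \<union> A\<^sub>2 \<union> (\<Union>j<k. A\<^sub>3 j) \<union> B"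
    and disj: "A\<^sub>1 \<inter> A\<^sub>2 = {}" "A\<^sub>1 \<inter> (\<Union>j<k. A\<^sub>3 j) = {}" "A\<^sub>1 \<inter> B = {}" "A\<^sub>2 \<inter> (\<Union>j<k. A\<^sub>3 j) = {}"
        "A\<^sub>2 \<inter> B = {}" "(\<Union>j<k. A\<^sub>3 j) \<inter> B = {}"
    and disj3: "\<And>i j. i < k \<Longrightarrow> j < k \<Longrightarrow> i \<noteq> j \<Longrightarrow> A\<^sub>3 i \<inter> A\<^sub>3 j = {}"
    and card1: "card A\<^sub>1 = N\<^sub>1" and card2: "card A\<^sub>2 = N\<^sub>2" and card3: "\<And>j. j < k \<Longrightarrow> card (A\<^sub>3 j) = N\<^sub>3"
    and Npos: "N\<^sub>1 > 0" "N\<^sub>2 > 0" "N\<^sub>3 > 0" and V_ne: "card V > 0"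
    and big: "(p / 16) ^ k * \<delta> * real N\<^sub>1 \<ge> 2" "(p / 16) ^ k * \<delta> * real N\<^sub>2 \<ge> 2" "(p / 16) ^ k * \<delta> * real N\<^sub>3 \<ge> 2"
    and L: "real L \<le> (1 - \<epsilon> / 8) * p * real N\<^sub>1"
begin

abbreviation "n \<equiv> real (card V)"

definition deg :: "('a set \<Rightarrow> bool) \<Rightarrow> 'a \<Rightarrow> nat" where "deg c v = card {x\<in>A\<^sub>1. {v, x} \<in> GE c}"
text \<open>Needed for counting the edges at \<open>A\<^sub>1\<close>: a heavy vertex is charged all
  of \<open>A\<^sub>1\<close>, any other one less than (1 + \<epsilon>) times the mean
  degree.\<close>

definition "heavy c = {v\<in>B. real (deg c v) \<ge> (1 + \<epsilon>) * p * real N\<^sub>1}"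
definition "light c = {v\<in>B. deg c v < L}"
definition "pairs = {z \<in> B \<times> B. fst z \<noteq> snd z}"
definition "bad\<^sub>1 c = {z\<in>pairs. deg c (fst z) \<ge> L \<and> real (common_nbrs (GE c) A\<^sub>1 (fst z) (snd z)) < 2 * \<delta> * real N\<^sub>1}"
definition "bad\<^sub>2 c = {z\<in>pairs. real (common_nbrs (GE c) A\<^sub>2 (fst z) (snd z)) < 2 * \<delta> * real N\<^sub>2}"
definition "bad\<^sub>3 c = {z\<in>A\<^sub>2 \<times> B. \<exists>j\<in>{..<k}. real (common_nbrs (GE c) (A\<^sub>3 j) (fst z) (snd z)) < 2 * \<delta> * real N\<^sub>3}"

definition good :: "('a set \<Rightarrow> bool) \<Rightarrow> bool" where
  "good c \<longleftrightarrow> real (card (heavy c)) \<le> \<epsilon> * n \<and> real (card (light c)) \<le> \<gamma> * n \<and>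
     real (card (bad\<^sub>1 c)) \<le> n \<and> real (card (bad\<^sub>2 c)) \<le> n \<and> real (card (bad\<^sub>3 c)) \<le> \<gamma> * z * n \<and>
     clique_rich (GE c) k \<delta> A\<^sub>1 \<and> clique_rich (GE c) k \<delta> A\<^sub>2 \<and> (\<forall>j\<in>{..<k}. clique_rich (GE c) k \<delta> (A\<^sub>3 j))"

definition "core_size = real N\<^sub>1 + real N\<^sub>2 + real k * real N\<^sub>3"

definition "upper = n * ((1 + \<epsilon>) * p * real N\<^sub>1) + \<epsilon> * n * real N\<^sub>1 + \<delta> * core_size * n + core_size ^ 2
     + real N\<^sub>2 * (\<gamma> * n) + real k * real N\<^sub>3 * n + 2 ^ (k + 1) * real (last s) / \<delta> * (core_size + 2 * n)
     + n + n + \<gamma> * z * n"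

lemma fin: "finite A\<^sub>1" "finite A\<^sub>2" "finite B" "finite (\<Union>j<k. A\<^sub>3 j)" "j < k \<Longrightarrow> finite (A\<^sub>3 j)"
  using V unfolding V_eq by auto

lemma sub: "A\<^sub>1 \<subseteq> V" "A\<^sub>2 \<subseteq> V" "B \<subseteq> V" "j < k \<Longrightarrow> A\<^sub>3 j \<subseteq> V"
  unfolding V_eq by auto

lemma card_B: "real (card B) \<le> n"
  using card_mono[OF V sub(3)] by simp

lemma \<delta>_less_1: "\<delta> < 1"
proof -
  have "p\<^sup>2 \<le> 1" using p by (simp add: power_le_one)
  then show ?thesis using \<delta> by linarith
qed

lemma good_blocks:
  assumes "finite X" "card X > 0" "clique_rich (GE c) k \<delta> X"
  obtains \<B> where "block_family (GE c) k X \<B>" "\<B> \<noteq> {}" "real (card (X - block_cover k \<B>)) \<le> \<delta> * real (card X)"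
proof -
  obtain \<B> where b: "block_family (GE c) k X \<B>" "real (card (X - block_cover k \<B>)) < \<delta> * real (card X)"
    using block_family_exists[OF assms(1,3) k] \<delta> assms(2) by auto
  have "\<delta> * real (card X) \<le> 1 * real (card X)" using \<delta>_less_1 by (intro mult_right_mono) auto
  then have "\<B> \<noteq> {}" using b(2) by (auto simp: block_cover_def)
  then show ?thesis using that b by simp
qed

lemma good_imp_sat_le:
  assumes c: "good c"
  shows "real (sat (V, GE c) (complete_multipartite s)) \<le> upper"
proof -
  have cr: "clique_rich (GE c) k \<delta> A\<^sub>1" "clique_rich (GE c) k \<delta> A\<^sub>2" "\<And>j. j < k \<Longrightarrow> clique_rich (GE c) k \<delta> (A\<^sub>3 j)"
    using c by (auto simp: good_def)
  obtain \<B>\<^sub>1 where b1: "block_family (GE c) k A\<^sub>1 \<B>\<^sub>1" "\<B>\<^sub>1 \<noteq> {}" "real (card (A\<^sub>1 - block_cover k \<B>\<^sub>1)) \<le> \<delta> * real (card A\<^sub>1)"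
    using good_blocks[OF fin(1) _ cr(1)] Npos card1 by metis
  obtain \<B>\<^sub>2 where b2: "block_family (GE c) k A\<^sub>2 \<B>\<^sub>2" "\<B>\<^sub>2 \<noteq> {}" "real (card (A\<^sub>2 - block_cover k \<B>\<^sub>2)) \<le> \<delta> * real (card A\<^sub>2)"
    using good_blocks[OF fin(2) _ cr(2)] Npos card2 by metis
  have "\<exists>\<B>. block_family (GE c) k (A\<^sub>3 j) \<B> \<and> \<B> \<noteq> {} \<and> real (card (A\<^sub>3 j - block_cover k \<B>)) \<le> \<delta> * real (card (A\<^sub>3 j))" if "j < k" for j
    using good_blocks[OF fin(5)[OF that] _ cr(3)[OF that]] Npos card3[OF that] by metis
  then obtain \<B>\<^sub>3 where b3: "\<And>j. j < k \<Longrightarrow> block_family (GE c) k (A\<^sub>3 j) (\<B>\<^sub>3 j) \<and> \<B>\<^sub>3 j \<noteq> {} \<and>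
      real (card (A\<^sub>3 j - block_cover k (\<B>\<^sub>3 j))) \<le> \<delta> * real (card (A\<^sub>3 j))" by metis
  interpret fr: saturation_frame V "GE c" s k R \<delta> A\<^sub>1 A\<^sub>2 A\<^sub>3 B "light c" \<B>\<^sub>1 \<B>\<^sub>2 \<B>\<^sub>3
  proof
    show "GE c \<subseteq> [V]\<^bsup>2\<^esup>" by (auto simp: graph_edges_def)
    show "light c \<subseteq> B" by (auto simp: light_def)
  qed (fact V len sorted pos k symR irrR \<delta> freeR denseR V_eq disj disj3 b1 b2 b3[THEN conjunct1]
        b3[THEN conjunct2, THEN conjunct1] b3[THEN conjunct2, THEN conjunct2])+
  have cu: "card (\<Union>j<k. A\<^sub>3 j) = k * N\<^sub>3"
  proof -
    have "card (\<Union>j<k. A\<^sub>3 j) = (\<Sum>j<k. card (A\<^sub>3 j))" using fin(5) disj3 by (intro card_UN_disjoint) auto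
    also have "\<dots> = (\<Sum>j<k. N\<^sub>3)" using card3 by (intro sum.cong) auto
    finally show ?thesis by simp
  qed
  have cA: "real (card fr.A) = core_size"
  proof -
    have "card fr.A = card (A\<^sub>1 \<union> A\<^sub>2) + card (\<Union>j<k. A\<^sub>3 j)"
      unfolding fr.A_def using fin disj(2,4) by (intro card_Un_disjoint) auto
    also have "card (A\<^sub>1 \<union> A\<^sub>2) = card A\<^sub>1 + card A\<^sub>2" using fin disj(1) by (intro card_Un_disjoint) auto
    finally show ?thesis by (simp add: core_size_def cu card1 card2)
  qed
  have first: "real (card fr.first_edges) \<le> n * ((1 + \<epsilon>) * p * real N\<^sub>1) + \<epsilon> * n * real N\<^sub>1"
  proof -
    have "fr.first_edges = (\<lambda>(v, a). (a, v)) ` (SIGMA v:B. {x\<in>A\<^sub>1. {v, x} \<in> GE c})"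
      by (auto simp: fr.first_edges_def insert_commute image_iff)
    then have "card fr.first_edges \<le> card (SIGMA v:B. {x\<in>A\<^sub>1. {v, x} \<in> GE c})"
      using card_image_le[of "SIGMA v:B. {x\<in>A\<^sub>1. {v, x} \<in> GE c}" "\<lambda>(v, a). (a, v)"] fin by force
    also have "\<dots> = (\<Sum>v\<in>B. deg c v)" using fin by (simp add: card_SigmaI deg_def)
    finally have "real (card fr.first_edges) \<le> (\<Sum>v\<in>B. real (deg c v))" by (metis of_nat_le_iff of_nat_sum)
    also have "\<dots> \<le> (\<Sum>v\<in>B. (1 + \<epsilon>) * p * real N\<^sub>1 + (if v \<in> heavy c then real N\<^sub>1 else 0))"
    proof (rule sum_mono)
      fix v assume v: "v \<in> B"
      have "deg c v \<le> N\<^sub>1" unfolding deg_def card1[symmetric] using fin by (intro card_mono) auto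
      moreover have "0 \<le> (1 + \<epsilon>) * p * real N\<^sub>1" using p \<epsilon> by simp
      ultimately show "real (deg c v) \<le> (1 + \<epsilon>) * p * real N\<^sub>1 + (if v \<in> heavy c then real N\<^sub>1 else 0)"
        using v by (auto simp: heavy_def)
    qed
    also have "\<dots> = real (card B) * ((1 + \<epsilon>) * p * real N\<^sub>1) + real (card (heavy c)) * real N\<^sub>1"
    proof -
      have "B \<inter> {v. v \<in> heavy c} = heavy c" by (auto simp: heavy_def)
      then show ?thesis using fin by (simp add: sum.distrib sum.If_cases)
    qed
    also have "\<dots> \<le> n * ((1 + \<epsilon>) * p * real N\<^sub>1) + \<epsilon> * n * real N\<^sub>1"
      using c card_B p \<epsilon> by (intro add_mono mult_right_mono) (auto simp: good_def)
    finally show ?thesis .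
  qed
  have "fr.bad_first = bad\<^sub>1 c"
    unfolding fr.bad_first_def by (auto simp: bad\<^sub>1_def pairs_def light_def card1 not_less)
  moreover have "fr.bad_second = bad\<^sub>2 c"
    unfolding fr.bad_second_def by (auto simp: bad\<^sub>2_def pairs_def card2)
  moreover have "fr.bad_third = bad\<^sub>3 c"
    unfolding fr.bad_third_def bad\<^sub>3_def using card3 by auto
  moreover have "real N\<^sub>2 * real (card (light c)) \<le> real N\<^sub>2 * (\<gamma> * n)" using c by (intro mult_left_mono) (auto simp: good_def)
  ultimately show ?thesis
    using fr.sat_upper_bound first c unfolding cA cu card2 upper_def good_def fr.leaf_bound_def by simp
qed

text \<open>One summand per condition of \<open>good\<close>, in the same order. The counts are
  handled by Markov: at most n^2 ordered pairs with the allowance n give the factor n in the terms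
  for \<open>bad\<^sub>1\<close> and \<open>bad\<^sub>2\<close>, and for \<open>bad\<^sub>3\<close>
  the factor n cancels.\<close>

lemma prob_not_good:
  "measure_pmf.prob M {c. \<not> good c} \<le>
     exp (- (p * \<epsilon>\<^sup>2 / 4) * real N\<^sub>1) / \<epsilon> + exp (- (p * (\<epsilon> / 8)\<^sup>2 / 2) * real N\<^sub>1) / \<gamma>
     + n * (exp (t * (2 * \<delta> * real N\<^sub>1)) * (1 - p * (1 - exp (- t))) ^ L) + n * exp (- (p\<^sup>2 / 4) * real N\<^sub>2)
     + real N\<^sub>2 * (real k * exp (- (p\<^sup>2 / 4) * real N\<^sub>3)) / (\<gamma> * z)
     + 2 ^ N\<^sub>1 * exp (- (p / 16) * ((p / 16) ^ k * \<delta> * real N\<^sub>1) ^ 2)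
     + 2 ^ N\<^sub>2 * exp (- (p / 16) * ((p / 16) ^ k * \<delta> * real N\<^sub>2) ^ 2)
     + real k * (2 ^ N\<^sub>3 * exp (- (p / 16) * ((p / 16) ^ k * \<delta> * real N\<^sub>3) ^ 2))"
  (is "_ \<le> ?q1 + ?q2 + ?q3 + ?q4 + ?q5 + ?q6 + ?q7 + ?q8")
proof -
  let ?P = "\<lambda>X. measure_pmf.prob M X"
  define S where "S = [{c. real (card (heavy c)) > \<epsilon> * n}, {c. real (card (light c)) > \<gamma> * n}, {c. real (card (bad\<^sub>1 c)) > n},
      {c. real (card (bad\<^sub>2 c)) > n}, {c. real (card (bad\<^sub>3 c)) > \<gamma> * z * n}, {c. \<not> clique_rich (GE c) k \<delta> A\<^sub>1},
      {c. \<not> clique_rich (GE c) k \<delta> A\<^sub>2}, {c. \<exists>j\<in>{..<k}. \<not> clique_rich (GE c) k \<delta> (A\<^sub>3 j)}]"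
  have n0: "n > 0" using V_ne by simp
  have vB: "v \<in> V - A\<^sub>1" "v \<in> V - A\<^sub>2" if "v \<in> B" for v using that sub disj by auto
  have vB3: "v \<in> V - A\<^sub>3 j" if "v \<in> B" "j < k" for v j using that sub disj(6) by auto
  have v2: "v \<in> V - A\<^sub>3 j" if "v \<in> A\<^sub>2" "j < k" for v j using that sub disj(4) by auto
  have finp: "finite pairs" unfolding pairs_def using fin by auto
  have cp: "real (card pairs) \<le> n * n"
  proof -
    have "card pairs \<le> card (B \<times> B)" unfolding pairs_def using fin by (intro card_mono) auto
    then have "real (card pairs) \<le> real (card B) * real (card B)" by (simp add: card_cartesian_product flip: of_nat_mult)
    also have "\<dots> \<le> n * n" using card_B by (intro mult_mono) auto
    finally show ?thesis .
  qed
  have 1: "?P (S ! 0) \<le> ?q1"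
  proof -
    have "?P (S ! 0) \<le> real (card B) * exp (- (p * \<epsilon>\<^sup>2 / 4) * real N\<^sub>1) / (\<epsilon> * n)"
      unfolding S_def heavy_def nth_Cons_0
    proof (rule prob_count_gt_le[OF finite_M fin(3)])
      show "measure_pmf.prob M {c. (1 + \<epsilon>) * p * real N\<^sub>1 \<le> real (deg c v)} \<le> exp (- (p * \<epsilon>\<^sup>2 / 4) * real N\<^sub>1)" if "v \<in> B" for v
        using prob_degree_large[OF sub(1) vB(1)[OF that]] \<epsilon> unfolding deg_def card1 by simp
    qed (use \<epsilon> n0 in simp)
    also have "\<dots> \<le> n * exp (- (p * \<epsilon>\<^sup>2 / 4) * real N\<^sub>1) / (\<epsilon> * n)"
      using card_B \<epsilon> n0 by (intro divide_right_mono mult_right_mono) auto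
    finally show ?thesis using n0 by simp
  qed
  have 2: "?P (S ! 1) \<le> ?q2"
  proof -
    have "?P (S ! 1) \<le> real (card B) * exp (- (p * (\<epsilon> / 8)\<^sup>2 / 2) * real N\<^sub>1) / (\<gamma> * n)"
      unfolding S_def light_def nth_Cons_0 nth_Cons_Suc One_nat_def
    proof (rule prob_count_gt_le[OF finite_M fin(3)])
      fix v assume v: "v \<in> B"
      have "measure_pmf.prob M {c. deg c v < L} \<le> measure_pmf.prob M {c. real (card {x\<in>A\<^sub>1. {v, x} \<in> GE c}) \<le> (1 - \<epsilon> / 8) * p * real (card A\<^sub>1)}"
        using L by (intro measure_pmf.finite_measure_mono) (auto simp: deg_def card1)
      also have "\<dots> \<le> exp (- (p * (\<epsilon> / 8)\<^sup>2 / 2) * real N\<^sub>1)"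
        using prob_degree_small[OF sub(1) vB(1)[OF v], of "\<epsilon> / 8"] \<epsilon> unfolding card1 by simp
      finally show "measure_pmf.prob M {c. deg c v < L} \<le> exp (- (p * (\<epsilon> / 8)\<^sup>2 / 2) * real N\<^sub>1)" .
    qed (use \<gamma> n0 in simp)
    also have "\<dots> \<le> n * exp (- (p * (\<epsilon> / 8)\<^sup>2 / 2) * real N\<^sub>1) / (\<gamma> * n)"
      using card_B \<gamma> n0 by (intro divide_right_mono mult_right_mono) auto
    finally show ?thesis using n0 by simp
  qed
  have pair_bound: "real (card pairs) * q / n \<le> n * q" if "q \<ge> 0" for q
  proof -
    have "real (card pairs) * q / n \<le> (n * n) * q / n" using cp that n0 by (intro divide_right_mono mult_right_mono) auto
    then show ?thesis using n0 by simp
  qed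
  have y: "0 \<le> 1 - p * (1 - exp (- t))"
  proof -
    have "p * (1 - exp (- t)) \<le> 1 * 1" using p t by (intro mult_mono) auto
    then show ?thesis by simp
  qed
  have 3: "?P (S ! 2) \<le> ?q3"
  proof -
    have "?P (S ! 2) \<le> real (card pairs) * (exp (t * (2 * \<delta> * real N\<^sub>1)) * (1 - p * (1 - exp (- t))) ^ L) / n"
      unfolding S_def bad\<^sub>1_def nth_Cons_0 nth_Cons_Suc numeral_2_eq_2
    proof (rule prob_count_gt_le[OF finite_M finp n0])
      fix w assume "w \<in> pairs"
      then show "measure_pmf.prob M {c. L \<le> deg c (fst w) \<and> real (common_nbrs (GE c) A\<^sub>1 (fst w) (snd w)) < 2 * \<delta> * real N\<^sub>1}
          \<le> exp (t * (2 * \<delta> * real N\<^sub>1)) * (1 - p * (1 - exp (- t))) ^ L"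
        unfolding deg_def using vB t by (intro prob_degree_large_common_small[OF sub(1)]) (auto simp: pairs_def)
    qed
    also have "\<dots> \<le> ?q3" using y by (intro pair_bound) auto
    finally show ?thesis .
  qed
  have 4: "?P (S ! 3) \<le> ?q4"
  proof -
    have "?P (S ! 3) \<le> real (card pairs) * exp (- (p\<^sup>2 / 4) * real N\<^sub>2) / n"
      unfolding S_def bad\<^sub>2_def nth_Cons_0 nth_Cons_Suc numeral_3_eq_3
    proof (rule prob_count_gt_le[OF finite_M finp n0])
      fix w assume "w \<in> pairs"
      then show "measure_pmf.prob M {c. real (common_nbrs (GE c) A\<^sub>2 (fst w) (snd w)) < 2 * \<delta> * real N\<^sub>2} \<le> exp (- (p\<^sup>2 / 4) * real N\<^sub>2)"
        unfolding card2[symmetric] using vB \<delta> by (intro prob_common_small[OF sub(2)]) (auto simp: pairs_def)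
    qed
    also have "\<dots> \<le> ?q4" by (intro pair_bound) auto
    finally show ?thesis .
  qed
  have 5: "?P (S ! 4) \<le> ?q5"
  proof -
    have S4: "S ! 4 = {c. real (card (bad\<^sub>3 c)) > \<gamma> * z * n}" by (simp add: S_def)
    have "?P (S ! 4) \<le> real (card (A\<^sub>2 \<times> B)) * (real k * exp (- (p\<^sup>2 / 4) * real N\<^sub>3)) / (\<gamma> * z * n)"
      unfolding S4 bad\<^sub>3_def
    proof (rule prob_count_gt_le[OF finite_M])
      fix w assume w: "w \<in> A\<^sub>2 \<times> B"
      have "measure_pmf.prob M {c. \<exists>j\<in>{..<k}. real (common_nbrs (GE c) (A\<^sub>3 j) (fst w) (snd w)) < 2 * \<delta> * real N\<^sub>3}
          \<le> real (card {..<k}) * exp (- (p\<^sup>2 / 4) * real N\<^sub>3)"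
      proof (rule prob_UN_le)
        fix j assume j: "j \<in> {..<k}"
        have "fst w \<noteq> snd w" using w disj(5) by auto
        then show "measure_pmf.prob M {c. real (common_nbrs (GE c) (A\<^sub>3 j) (fst w) (snd w)) < 2 * \<delta> * real N\<^sub>3} \<le> exp (- (p\<^sup>2 / 4) * real N\<^sub>3)"
          using prob_common_small[OF sub(4), of j "fst w" "snd w" \<delta>] vB3[of "snd w" j] v2[of "fst w" j] w j \<delta> card3[of j] by auto
      qed auto
      then show "measure_pmf.prob M {c. \<exists>j\<in>{..<k}. real (common_nbrs (GE c) (A\<^sub>3 j) (fst w) (snd w)) < 2 * \<delta> * real N\<^sub>3}
          \<le> real k * exp (- (p\<^sup>2 / 4) * real N\<^sub>3)" by simp
    qed (use \<gamma> z n0 fin in auto)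
    also have "\<dots> = real (card B) * (real N\<^sub>2 * (real k * exp (- (p\<^sup>2 / 4) * real N\<^sub>3))) / (\<gamma> * z * n)"
      by (simp add: card_cartesian_product card2)
    also have "\<dots> \<le> n * (real N\<^sub>2 * (real k * exp (- (p\<^sup>2 / 4) * real N\<^sub>3))) / (\<gamma> * z * n)"
      using card_B \<gamma> z n0 by (intro divide_right_mono mult_right_mono) auto
    finally show ?thesis using n0 by simp
  qed
  have 6: "?P (S ! 5) \<le> ?q6"
    using prob_not_clique_rich[OF sub(1) \<delta>(1), of k] big(1) by (simp add: S_def card1)
  have 7: "?P (S ! 6) \<le> ?q7"
    using prob_not_clique_rich[OF sub(2) \<delta>(1), of k] big(2) by (simp add: S_def card2)
  have 8: "?P (S ! 7) \<le> ?q8"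
  proof -
    have "?P {c. \<exists>j\<in>{..<k}. \<not> clique_rich (GE c) k \<delta> (A\<^sub>3 j)} \<le> real (card {..<k}) * (2 ^ N\<^sub>3 * exp (- (p / 16) * ((p / 16) ^ k * \<delta> * real N\<^sub>3) ^ 2))"
    proof (rule prob_UN_le)
      fix j assume "j \<in> {..<k}"
      then show "?P {c. \<not> clique_rich (GE c) k \<delta> (A\<^sub>3 j)} \<le> 2 ^ N\<^sub>3 * exp (- (p / 16) * ((p / 16) ^ k * \<delta> * real N\<^sub>3) ^ 2)"
        using prob_not_clique_rich[OF sub(4) \<delta>(1), of j k] big(3) card3[of j] by simp
    qed auto
    then show ?thesis by (simp add: S_def)
  qed
  have "{c. \<not> good c} \<subseteq> (\<Union>i<8. S ! i)"
  proof
    fix c assume "c \<in> {c. \<not> good c}"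
    then have "c \<in> S ! 0 \<or> c \<in> S ! 1 \<or> c \<in> S ! 2 \<or> c \<in> S ! 3 \<or> c \<in> S ! 4 \<or> c \<in> S ! 5 \<or> c \<in> S ! 6 \<or> c \<in> S ! 7"
      by (auto simp: S_def good_def not_le)
    then show "c \<in> (\<Union>i<8. S ! i)" by (elim disjE) (auto intro!: bexI[rotated])
  qed
  then have "?P {c. \<not> good c} \<le> ?P (\<Union>i<8. S ! i)" by (intro measure_pmf.finite_measure_mono) auto
  also have "\<dots> \<le> (\<Sum>i<8. ?P (S ! i))" by (intro measure_pmf.finite_measure_subadditive_finite) auto
  also have "\<dots> = ?P (S ! 0) + ?P (S ! 1) + ?P (S ! 2) + ?P (S ! 3) + ?P (S ! 4) + ?P (S ! 5) + ?P (S ! 6) + ?P (S ! 7)"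
    by (simp add: eval_nat_numeral lessThan_Suc)
  also have "\<dots> \<le> ?q1 + ?q2 + ?q3 + ?q4 + ?q5 + ?q6 + ?q7 + ?q8"
    by (intro add_mono 1 2 3 4 5 6 7 8)
  finally show ?thesis .
qed

end

section \<open>Asymptotics\<close>

lemma prob_random_graph:
  "measure_pmf.prob (random_graph n p) {G. P G} = measure_pmf.prob (edge_pmf {1..n} p) {c. P ({1..n}, graph_edges {1..n} c)}"
  by (simp add: random_graph_eq vimage_def)

lemma eventually_ln_ge: "eventually (\<lambda>n. ln (real n) \<ge> c) sequentially"
  by real_asymp

lemma filterlim_ln_nat: "filterlim (\<lambda>n. ln (real n)) at_top sequentially"
  by real_asymp

lemma nat_ceiling_bounds: "x \<ge> 0 \<Longrightarrow> x \<le> real (nat \<lceil>x\<rceil>) \<and> real (nat \<lceil>x\<rceil>) \<le> x + 1"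
  by linarith

lemma tendsto_nat_ceiling_ratio:
  fixes c :: real
  assumes c: "c \<ge> 0" and f: "filterlim f at_top F"
  shows "((\<lambda>x. real (nat \<lceil>c * f x\<rceil>) / f x) \<longlongrightarrow> c) F"
proof (rule tendsto_sandwich)
  have ev: "eventually (\<lambda>x. f x > 0) F" using f by (simp add: filterlim_at_top_dense)
  show "eventually (\<lambda>x. c \<le> real (nat \<lceil>c * f x\<rceil>) / f x) F"
    using ev by eventually_elim (use c nat_ceiling_bounds in \<open>simp add: field_simps\<close>)
  show "eventually (\<lambda>x. real (nat \<lceil>c * f x\<rceil>) / f x \<le> c + 1 / f x) F"
  proof (use ev in eventually_elim)
    fix x assume x: "f x > 0"
    have "real (nat \<lceil>c * f x\<rceil>) \<le> c * f x + 1" using nat_ceiling_bounds[of "c * f x"] c x by simp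
    then show "real (nat \<lceil>c * f x\<rceil>) / f x \<le> c + 1 / f x" using x by (simp add: field_simps)
  qed
  have "((\<lambda>x. 1 / f x) \<longlongrightarrow> 0) F"
    using tendsto_inverse_0_at_top[OF f] by (simp add: inverse_eq_divide)
  then show "((\<lambda>x. c + 1 / f x) \<longlongrightarrow> c) F" using tendsto_add[of "\<lambda>_. c" c F "\<lambda>x. 1 / f x" 0] by simp
qed auto

lemma filterlim_nat_ceiling:
  fixes c :: real
  assumes c: "c > 0" and f: "filterlim f at_top F"
  shows "filterlim (\<lambda>x. nat \<lceil>c * f x\<rceil>) at_top F"
proof -
  have "filterlim (\<lambda>x. c * f x) at_top F" using filterlim_tendsto_pos_mult_at_top[OF tendsto_const c f] .
  then have "filterlim (\<lambda>x. real (nat \<lceil>c * f x\<rceil>)) at_top F"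
    by (rule filterlim_at_top_mono) (auto intro!: always_eventually real_nat_ceiling_ge)
  then show ?thesis by (simp add: filterlim_sequentially_iff_filterlim_real)
qed

text \<open>\<open>K\<close> slightly below log n keeps n (1 - p)^K above n^(\<epsilon> / 2), which
  beats the exp (O((ln n)^2)) choices of a vertex and a set. \<open>d\<close> about (ln n)^2 is
  large enough that O(n log n) edges leave only o(n) vertices of degree at least \<open>d\<close>,
  and small enough that d + d^2 is negligible against n^(\<epsilon> / 2).\<close>

lemma sat_lower_whp:
  fixes p \<epsilon> :: real
  assumes len: "length s \<ge> 3" and pos: "\<forall>a\<in>set s. 0 < a" and p: "0 < p" "p < 1" and \<epsilon>: "0 < \<epsilon>" "\<epsilon> \<le> 1"
  shows "(\<lambda>n. measure_pmf.prob (random_graph n p)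
      {G. real (sat G (complete_multipartite s)) < (1 - \<epsilon>) * (real n * log (1 / (1 - p)) (real n))}) \<longlonglongrightarrow> 0"
proof -
  define \<kappa> where "\<kappa> = ln (1 / (1 - p))"
  have \<kappa>: "\<kappa> > 0" using p by (simp add: \<kappa>_def)
  have ln1p: "ln (1 - p) = - \<kappa>" using p by (simp add: \<kappa>_def ln_div)
  \<comment> \<open>The union bound in terms of x = ln n: the first term is for n^(K + 1), the next
    two for the threshold d + d^2, and the last for the expected count, using n - K - 1 \<ge> n /
    2.\<close>
  define \<Phi> where "\<Phi> x = exp ((x / \<kappa> + 1) * x + (x\<^sup>2 + 1) + (x\<^sup>2 + 1)\<^sup>2 - p / 4 * exp (\<epsilon> / 2 * x))" for x :: real
  have "(\<Phi> \<longlongrightarrow> 0) at_top" unfolding \<Phi>_def using \<kappa> p \<epsilon> by real_asymp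
  then have \<Phi>: "(\<lambda>n. \<Phi> (ln (real n))) \<longlonglongrightarrow> 0" using filterlim_ln_nat by (rule filterlim_compose)
  have ev: "eventually (\<lambda>n. ln (real n) / \<kappa> + 1 \<le> real n / 2) sequentially" using \<kappa> by real_asymp
  have "eventually (\<lambda>n. measure_pmf.prob (random_graph n p)
      {G. real (sat G (complete_multipartite s)) < (1 - \<epsilon>) * (real n * log (1 / (1 - p)) (real n))} \<le> \<Phi> (ln (real n))) sequentially"
    using eventually_ln_ge[of 1] eventually_ln_ge[of "2 / \<kappa>"] eventually_ln_ge[of "(1 + 2 / \<kappa>\<^sup>2) * (2 * \<kappa> / \<epsilon>)"] ev eventually_gt_at_top[of 1]
  proof eventually_elim
    case (elim n)
    define x where "x = ln (real n)"
    define K where "K = nat \<lfloor>(1 - \<epsilon> / 2) * x / \<kappa>\<rfloor>"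
    define d where "d = nat \<lceil>x\<^sup>2\<rceil>"
    have n: "real n = exp x" "n > 1" using elim by (auto simp: x_def)
    have x: "x \<ge> 1" "x \<ge> 2 / \<kappa>" "x \<ge> (1 + 2 / \<kappa>\<^sup>2) * (2 * \<kappa> / \<epsilon>)" "x / \<kappa> + 1 \<le> real n / 2" using elim by (auto simp: x_def)
    have nn: "(1 - \<epsilon> / 2) * x / \<kappa> \<ge> 0" using \<epsilon> x \<kappa> by simp
    have K: "real K \<le> (1 - \<epsilon> / 2) * x / \<kappa>" "real K \<ge> (1 - \<epsilon> / 2) * x / \<kappa> - 1"
      using nn unfolding K_def by linarith+
    have K': "real K \<le> x / \<kappa>"
    proof -
      have "(1 - \<epsilon> / 2) * x / \<kappa> \<le> 1 * x / \<kappa>" using \<epsilon> x \<kappa> by (intro divide_right_mono mult_right_mono) auto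
      then show ?thesis using K by simp
    qed
    have x2: "x\<^sup>2 \<ge> 1" using x by simp
    have d: "real d \<ge> x\<^sup>2" "real d \<le> x\<^sup>2 + 1" "d > 0" using x2 unfolding d_def by linarith+
    interpret random_edges "{1..n}" p using p by unfold_locales auto
    have "real K < real n" using K' x(4) by linarith
    then have Kn: "K < card {1..n}" by simp
    define T where "T = real d + real d * real d"
    define fail where "fail c \<longleftrightarrow> (\<exists>v\<in>{1..n}. \<exists>S\<subseteq>{1..n} - {v}. card S \<le> K \<and>
            real (card {u \<in> {1..n} - S - {v}. {u, v} \<in> GE c \<and> (\<forall>x\<in>S. {u, x} \<notin> GE c)}) \<le> T)" for c
    have "measure_pmf.prob (random_graph n p)
      {G. real (sat G (complete_multipartite s)) < (1 - \<epsilon>) * (real n * log (1 / (1 - p)) (real n))} \<le> measure_pmf.prob M {c. fail c}"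
      unfolding prob_random_graph
    proof (intro measure_pmf.finite_measure_mono subsetI CollectI)
      fix c assume c: "c \<in> {c. real (sat ({1..n}, GE c) (complete_multipartite s)) < (1 - \<epsilon>) * (real n * log (1 / (1 - p)) (real n))}"
      show "fail c"
      proof (rule ccontr)
        assume nf: "\<not> fail c"
        have GE: "GE c \<subseteq> [{1..n}]\<^bsup>2\<^esup>" by (auto simp: graph_edges_def)
        obtain H where H: "saturated_in ({1..n}, GE c) (complete_multipartite s) H"
            "sat ({1..n}, GE c) (complete_multipartite s) = card (edges H)"
          using sat_attained[OF _ GE len pos] by blast
        define e where "e = real (card (edges H))"
        have "real K * (real (card {1..n}) - 2 * real (card (edges H)) / real d) \<le> real (card (edges H))"
        proof (rule saturated_edges_lower_bound[OF _ GE H(1) len pos d(3)])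
          fix v S assume vS: "v \<in> {1..n}" "S \<subseteq> {1..n} - {v}" "card S \<le> K"
          then have "\<not> real (card {u \<in> {1..n} - S - {v}. {u, v} \<in> GE c \<and> (\<forall>x\<in>S. {u, x} \<notin> GE c)}) \<le> T"
            using nf unfolding fail_def by blast
          then have "real (d + d * d) < real (card {u \<in> {1..n} - S - {v}. {u, v} \<in> GE c \<and> (\<forall>x\<in>S. {u, x} \<notin> GE c)})"
            by (simp add: T_def)
          then show "d + d * d < card {u \<in> {1..n} - S - {v}. {u, v} \<in> GE c \<and> (\<forall>x\<in>S. {u, x} \<notin> GE c)}"
            by (simp only: of_nat_less_iff)
        qed auto
        then have main: "real K * (real n - 2 * e / real d) \<le> e" by (simp add: e_def)
        have eY: "e < (1 - \<epsilon>) * (real n * (x / \<kappa>))"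
          using c H(2) by (simp add: e_def x_def log_def \<kappa>_def)
        have "e \<le> real n * (x / \<kappa>)"
        proof -
          have "(1 - \<epsilon>) * (real n * (x / \<kappa>)) \<le> 1 * (real n * (x / \<kappa>))"
            using \<epsilon> x \<kappa> by (intro mult_right_mono) auto
          then show ?thesis using eY by linarith
        qed
        then have "2 * e / real d \<le> 2 * (real n * (x / \<kappa>)) / x\<^sup>2"
          using d x2 \<kappa> x by (intro frac_le) auto
        also have "\<dots> = real n * (2 / (\<kappa> * x))" using x \<kappa> by (simp add: power2_eq_square field_simps)
        finally have sub: "real n * (1 - 2 / (\<kappa> * x)) \<le> real n - 2 * e / real d" by (simp add: algebra_simps)
        have f0: "2 / (\<kappa> * x) \<le> 1" using x \<kappa> by (simp add: field_simps)
        have "((1 - \<epsilon> / 2) * x / \<kappa> - 1) * (real n * (1 - 2 / (\<kappa> * x))) \<le> real K * (real n * (1 - 2 / (\<kappa> * x)))"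
          using K(2) f0 by (intro mult_right_mono) auto
        also have "\<dots> \<le> real K * (real n - 2 * e / real d)" using sub by (intro mult_left_mono) auto
        also have "\<dots> < (1 - \<epsilon>) * (real n * (x / \<kappa>))" using main eY by linarith
        finally have "real n * (((1 - \<epsilon> / 2) * x / \<kappa> - 1) * (1 - 2 / (\<kappa> * x))) < real n * ((1 - \<epsilon>) * (x / \<kappa>))"
          by (simp only: mult_ac)
        then have lt: "((1 - \<epsilon> / 2) * x / \<kappa> - 1) * (1 - 2 / (\<kappa> * x)) < (1 - \<epsilon>) * (x / \<kappa>)"
          by (rule mult_left_less_imp_less) simp
        \<comment> \<open>The losses are 1 for rounding \<open>K\<close> and at most 2 / \<kappa>^2
          for the vertices of large degree. The gain \<epsilon> x / (2 \<kappa>) over the assumed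
          upper bound outweighs them by the third lower bound on \<open>x\<close>.\<close>
        have "((1 - \<epsilon> / 2) * x / \<kappa> - 1) * (1 - 2 / (\<kappa> * x))
            = (1 - \<epsilon> / 2) * x / \<kappa> - 1 - (1 - \<epsilon> / 2) * (2 / \<kappa>\<^sup>2) + 2 / (\<kappa> * x)"
          using x \<kappa> by (simp add: field_simps power2_eq_square)
        moreover have "(1 - \<epsilon> / 2) * (2 / \<kappa>\<^sup>2) \<le> 1 * (2 / \<kappa>\<^sup>2)" using \<epsilon> by (intro mult_right_mono) auto
        moreover have "2 / (\<kappa> * x) \<ge> 0" using x \<kappa> by simp
        moreover have "(1 - \<epsilon> / 2) * x / \<kappa> = (1 - \<epsilon>) * (x / \<kappa>) + \<epsilon> / (2 * \<kappa>) * x" using \<kappa> by (simp add: field_simps)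
        moreover have "\<epsilon> / (2 * \<kappa>) * x \<ge> 1 + 2 / \<kappa>\<^sup>2"
        proof -
          have "\<epsilon> / (2 * \<kappa>) * x \<ge> \<epsilon> / (2 * \<kappa>) * ((1 + 2 / \<kappa>\<^sup>2) * (2 * \<kappa> / \<epsilon>))" using x(3) \<epsilon> \<kappa> by (intro mult_left_mono) auto
          then show ?thesis using \<epsilon> \<kappa> by simp
        qed
        ultimately show False using lt by linarith
      qed
    qed auto
    also have "\<dots> \<le> real n * real n ^ K * exp (T - p * (1 - p) ^ K / 2 * (real n - real K - 1))"
      using prob_few_nonneighbours[OF Kn, of T] unfolding fail_def by simp
    also have "\<dots> \<le> \<Phi> x"
    proof -
      have "real n * real n ^ K = exp (x * (real K + 1))"
        by (simp add: n exp_of_nat2_mult[symmetric] exp_add[symmetric] algebra_simps)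
      moreover have "x * (real K + 1) \<le> (x / \<kappa> + 1) * x" using K' x by (simp add: mult.commute)
      moreover have "T \<le> (x\<^sup>2 + 1) + (x\<^sup>2 + 1)\<^sup>2"
        unfolding T_def power2_eq_square[of "x\<^sup>2 + 1"] using d by (intro add_mono mult_mono) auto
      moreover have "p * (1 - p) ^ K / 2 * (real n - real K - 1) \<ge> p / 4 * exp (\<epsilon> / 2 * x)"
      proof -
        have half: "exp x / 2 \<le> real n - real K - 1" using x(4) K' n(1) by linarith
        have "(1 - p) ^ K = exp (real K * ln (1 - p))" using p by (simp add: exp_of_nat_mult)
        also have "\<dots> = exp (- (real K * \<kappa>))" by (simp add: ln1p)
        also have "\<dots> \<ge> exp (- ((1 - \<epsilon> / 2) * x))"
          using K(1) \<kappa> by (simp add: field_simps)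
        finally have "p * (1 - p) ^ K / 2 * (real n - real K - 1) \<ge> p * exp (- ((1 - \<epsilon> / 2) * x)) / 2 * (exp x / 2)"
          using p half by (intro mult_mono divide_right_mono mult_left_mono) auto
        also have "p * exp (- ((1 - \<epsilon> / 2) * x)) / 2 * (exp x / 2) = p / 4 * exp (\<epsilon> / 2 * x)"
          by (simp add: exp_add[symmetric] algebra_simps)
        finally show ?thesis .
      qed
      ultimately show ?thesis unfolding \<Phi>_def by (simp add: exp_add[symmetric])
    qed
    finally show ?case by (simp add: x_def)
  qed
  then show ?thesis
    by (intro tendsto_sandwich[OF _ _ tendsto_const \<Phi>]) auto
qed

text \<open>The argument of the logarithm tends to 1 - p, and since ln (1 - p) is negative the
  larger factor 1 + \<epsilon> / 2 leaves a strict margin in the limit.\<close>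

lemma tilt_parameter_exists:
  fixes p \<epsilon> :: real
  assumes p: "0 < p" "p < 1" and \<epsilon>: "0 < \<epsilon>"
  obtains t where "t > 0" "(1 + \<epsilon> / 2) * ln (1 - p * (1 - exp (- t))) \<le> (1 + \<epsilon> / 4) * ln (1 - p)"
proof -
  have "((\<lambda>t. (1 + \<epsilon> / 2) * ln (1 - p * (1 - exp (- t)))) \<longlongrightarrow> (1 + \<epsilon> / 2) * ln (1 - p * (1 - 0))) at_top"
    using p by (intro tendsto_intros) (auto, real_asymp)
  moreover have "(1 + \<epsilon> / 2) * ln (1 - p * (1 - 0)) < (1 + \<epsilon> / 4) * ln (1 - p)"
    using p \<epsilon> by (simp add: mult_less_cancel_right)
  ultimately have "eventually (\<lambda>t. (1 + \<epsilon> / 2) * ln (1 - p * (1 - exp (- t))) < (1 + \<epsilon> / 4) * ln (1 - p)) at_top"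
    by (rule order_tendstoD)
  then have "eventually (\<lambda>t. (1 + \<epsilon> / 2) * ln (1 - p * (1 - exp (- t))) < (1 + \<epsilon> / 4) * ln (1 - p) \<and> t > 0) at_top"
    using eventually_gt_at_top[of 0] by (rule eventually_conj)
  then show ?thesis using that by (metis (mono_tags, lifting) eventually_happens trivial_limit_at_top_linorder less_imp_le)
qed

text \<open>The order of the choices matters: \<open>\<epsilon>\<^sub>1\<close>, then the tilt
  \<open>t\<close>, then \<delta>, which must be small in terms of \<open>t\<close>, and only then
  the gadget. Its size \<open>k\<close> may be huge, but in the edge count it appears only next to
  \<open>N\<^sub>3\<close>, of order o(ln n), and in the constant \<open>m\<close> of an O(n)
  term.\<close>

lemma sat_upper_whp:
  fixes p \<epsilon> :: real
  assumes len: "length s \<ge> 3" and sorted: "sorted s" and pos: "\<forall>a\<in>set s. 0 < a"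
    and p: "0 < p" "p < 1" and \<epsilon>: "0 < \<epsilon>"
  shows "(\<lambda>n. measure_pmf.prob (random_graph n p)
      {G. real (sat G (complete_multipartite s)) > (1 + \<epsilon>) * (real n * log (1 / (1 - p)) (real n))}) \<longlonglongrightarrow> 0"
proof -
  define \<kappa> where "\<kappa> = ln (1 / (1 - p))"
  have \<kappa>: "\<kappa> > 0" using p by (simp add: \<kappa>_def)
  have ln1p: "ln (1 - p) = - \<kappa>" using p by (simp add: \<kappa>_def ln_div)
  \<comment> \<open>The factor p compensates the 1 / p in \<alpha>: heavy vertices are charged
    \<open>\<epsilon>\<^sub>1 * \<alpha>\<close>, which must stay a small multiple of \<epsilon> /
    \<kappa>.\<close>
  define \<epsilon>\<^sub>1 where "\<epsilon>\<^sub>1 = min 1 (\<epsilon> * p / 32)"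
  have \<epsilon>1: "0 < \<epsilon>\<^sub>1" "\<epsilon>\<^sub>1 \<le> 1" "\<epsilon>\<^sub>1 \<le> \<epsilon> * p / 32" using \<epsilon> p by (auto simp: \<epsilon>\<^sub>1_def)
  \<comment> \<open>Makes exp (- p^2 / 4 * \<open>N\<^sub>2\<close>) at most n^(-2), so that even
    after the factor n the term for \<open>bad\<^sub>2\<close> vanishes.\<close>
  define C where "C = 8 / p\<^sup>2"
  have C: "C > 0" using p by (simp add: C_def)
  \<comment> \<open>The pairs between \<open>A\<^sub>2\<close> and \<open>W\<close> cost about
    \<gamma> C n ln n and the allowance for \<open>bad\<^sub>3\<close> is \<gamma> n ln n: together
    a share \<epsilon> / 8 of the main term.\<close>
  define \<gamma> where "\<gamma> = \<epsilon> / (8 * \<kappa> * (C + 1))"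
  have \<gamma>: "\<gamma> > 0" using \<epsilon> \<kappa> C by (simp add: \<gamma>_def)
  obtain t where t: "t > 0" "(1 + \<epsilon>\<^sub>1 / 2) * ln (1 - p * (1 - exp (- t))) \<le> (1 + \<epsilon>\<^sub>1 / 4) * ln (1 - p)"
    using tilt_parameter_exists[OF p \<epsilon>1(1)] by blast
  \<comment> \<open>Since log n = ln n / \<kappa>, this gives \<open>A\<^sub>1\<close> about
    \<open>(1 + \<epsilon>\<^sub>1) / p\<close> times log n vertices.\<close>
  define \<alpha> where "\<alpha> = (1 + \<epsilon>\<^sub>1) / (p * \<kappa>)"
  have \<alpha>: "\<alpha> > 0" using \<epsilon>1 p \<kappa> by (simp add: \<alpha>_def)
  \<comment> \<open>The three bounds serve \<open>prob_common_small\<close>, the edges at uncovered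
    vertices, and the factor \<open>exp (t * (2 * \<delta> * N\<^sub>1))\<close> in the estimate for
    \<open>bad\<^sub>1\<close>, in this order.\<close>
  define \<delta> where "\<delta> = min (p\<^sup>2 / 8) (min (\<epsilon> / (8 * \<kappa> * (\<alpha> + C))) (\<epsilon>\<^sub>1 / (16 * t * (\<alpha> + 1))))"
  have \<delta>0: "\<delta> > 0" using p \<epsilon> \<epsilon>1 t \<kappa> \<alpha> C by (auto simp: \<delta>_def)
  have \<delta>1: "\<delta> \<le> p\<^sup>2 / 8" unfolding \<delta>_def by linarith
  have \<delta>2: "\<delta> * (\<alpha> + C) \<le> \<epsilon> / (8 * \<kappa>)"
  proof -
    have "\<delta> \<le> \<epsilon> / (8 * \<kappa> * (\<alpha> + C))" unfolding \<delta>_def by linarith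
    then have "\<delta> * (\<alpha> + C) \<le> \<epsilon> / (8 * \<kappa> * (\<alpha> + C)) * (\<alpha> + C)" using \<alpha> C by (intro mult_right_mono) auto
    then show ?thesis using \<alpha> C by simp
  qed
  have \<delta>3: "t * (2 * \<delta>) * (\<alpha> + 1) \<le> \<epsilon>\<^sub>1 / 8"
  proof -
    have "\<delta> \<le> \<epsilon>\<^sub>1 / (16 * t * (\<alpha> + 1))" unfolding \<delta>_def by linarith
    then have "(2 * t * (\<alpha> + 1)) * \<delta> \<le> (2 * t * (\<alpha> + 1)) * (\<epsilon>\<^sub>1 / (16 * t * (\<alpha> + 1)))"
      using t \<alpha> by (intro mult_left_mono) auto
    also have "\<dots> = \<epsilon>\<^sub>1 / 8"
    proof -
      have "t * (\<alpha> + 1) \<noteq> 0" using t \<alpha> by simp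
      then show ?thesis by (simp add: field_simps)
    qed
    finally show ?thesis by (simp add: mult_ac)
  qed
  have "p\<^sup>2 \<le> 1" using p by (simp add: power_le_one)
  then have \<delta>h: "\<delta> / 2 \<le> 1" using \<delta>1 by linarith
  have sb: "length (butlast s) \<ge> 2" "sorted (butlast s)" "\<forall>a\<in>set (butlast s). 0 < a"
    using len sorted pos by (auto simp: sorted_butlast dest: in_set_butlastD)
  obtain k R where k: "k > 0" and R: "symp R" "irreflp R" "\<And>Q. \<not> multipartite_copy R {..<k} (butlast s) Q"
    and dense: "\<And>D. D \<subseteq> {..<k} \<Longrightarrow> real (card D) \<ge> \<delta> / 2 * real k \<Longrightarrow>
        \<exists>Q. multipartite_copy R D ((butlast s)[0 := butlast s ! 0 - 1]) Q"
    using erdos_rogers_multipartite[OF sb half_gt_zero[OF \<delta>0] \<delta>h] by blast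
  define x where "x n = ln (real n)" for n :: nat
  define N\<^sub>1 where "N\<^sub>1 n = nat \<lceil>\<alpha> * x n\<rceil>" for n
  define N\<^sub>2 where "N\<^sub>2 n = nat \<lceil>C * x n\<rceil>" for n
  \<comment> \<open>The square root tends to infinity, so that failures become rare, but is o(ln n),
    so that all edges at the third layer are affordable.\<close>
  define N\<^sub>3 where "N\<^sub>3 n = nat \<lceil>1 * sqrt (x n)\<rceil>" for n
  \<comment> \<open>Between two constraints: above log n, so that a pair fails with probability
    below n^(-1), and below the typical degree of about \<open>(1 + \<epsilon>\<^sub>1)\<close> log
    n, so that few vertices are light.\<close>
  define L where "L n = nat \<lceil>(1 + \<epsilon>\<^sub>1 / 2) / \<kappa> * x n\<rceil>" for n
  define a where "a n = real (N\<^sub>1 n) + real (N\<^sub>2 n) + real k * real (N\<^sub>3 n)" for n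
  define m where "m = 2 ^ (k + 1) * real (last s) / \<delta>"
  define w where "w = (p / 16) ^ k * \<delta>"
  have w: "w > 0" using p \<delta>0 by (simp add: w_def)
  have xlim: "filterlim x at_top sequentially" unfolding x_def by (rule filterlim_ln_nat)
  have sqlim: "filterlim (\<lambda>n. sqrt (x n)) at_top sequentially" using sqrt_at_top xlim by (rule filterlim_compose)
  have xinv: "(\<lambda>n. 1 / x n) \<longlonglongrightarrow> 0"
    using tendsto_inverse_0_at_top[OF xlim] by (simp add: inverse_eq_divide)
  have sqinv: "(\<lambda>n. 1 / sqrt (x n)) \<longlonglongrightarrow> 0"
    using tendsto_inverse_0_at_top[OF sqlim] by (simp add: inverse_eq_divide)
  have xpos: "eventually (\<lambda>n. x n \<ge> 1) sequentially" unfolding x_def by (rule eventually_ln_ge)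
  have N1lim: "filterlim N\<^sub>1 at_top sequentially" unfolding N\<^sub>1_def using \<alpha> xlim by (rule filterlim_nat_ceiling)
  have N2lim: "filterlim N\<^sub>2 at_top sequentially" unfolding N\<^sub>2_def using C xlim by (rule filterlim_nat_ceiling)
  have N3lim: "filterlim N\<^sub>3 at_top sequentially" unfolding N\<^sub>3_def using zero_less_one sqlim by (rule filterlim_nat_ceiling)
  have N1r: "(\<lambda>n. real (N\<^sub>1 n) / x n) \<longlonglongrightarrow> \<alpha>" unfolding N\<^sub>1_def using \<alpha> xlim by (intro tendsto_nat_ceiling_ratio) auto
  have N2r: "(\<lambda>n. real (N\<^sub>2 n) / x n) \<longlonglongrightarrow> C" unfolding N\<^sub>2_def using C xlim by (intro tendsto_nat_ceiling_ratio) auto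
  have N3r: "(\<lambda>n. real (N\<^sub>3 n) / x n) \<longlonglongrightarrow> 0"
  proof -
    have "(\<lambda>n. real (N\<^sub>3 n) / sqrt (x n) * (1 / sqrt (x n))) \<longlonglongrightarrow> 1 * 0"
      unfolding N\<^sub>3_def using sqlim sqinv by (intro tendsto_mult tendsto_nat_ceiling_ratio) auto
    moreover have "eventually (\<lambda>n. real (N\<^sub>3 n) / sqrt (x n) * (1 / sqrt (x n)) = real (N\<^sub>3 n) / x n) sequentially"
      using xpos by eventually_elim (simp add: real_sqrt_mult_self)
    ultimately have "(\<lambda>n. real (N\<^sub>3 n) / x n) \<longlonglongrightarrow> 1 * 0" by (rule Lim_transform_eventually)
    then show ?thesis by simp
  qed
  have ar: "(\<lambda>n. a n / x n) \<longlonglongrightarrow> \<alpha> + C + real k * 0"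
    using tendsto_add[OF tendsto_add[OF N1r N2r] tendsto_mult[OF tendsto_const N3r, of "real k"]]
    by (simp add: a_def add_divide_distrib)
  have xn: "(\<lambda>n. x n / real n) \<longlonglongrightarrow> 0" unfolding x_def by real_asymp
  have ninv: "(\<lambda>n. 1 / real n) \<longlonglongrightarrow> 0" by real_asymp

  define U where "U n = real n * ((1 + \<epsilon>\<^sub>1) * p * real (N\<^sub>1 n)) + \<epsilon>\<^sub>1 * real n * real (N\<^sub>1 n) + \<delta> * a n * real n + a n ^ 2
     + real (N\<^sub>2 n) * (\<gamma> * real n) + real k * real (N\<^sub>3 n) * real n + m * (a n + 2 * real n)
     + real n + real n + \<gamma> * x n * real n" for n
  \<comment> \<open>The limit keeps its vanishing factors explicit, so as to match the sum of limits
    term by term.\<close>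
  define \<Lambda> where "\<Lambda> = (1 + \<epsilon>\<^sub>1) * p * \<alpha> + \<epsilon>\<^sub>1 * \<alpha> + \<delta> * (\<alpha> + C + real k * 0) + (\<alpha> + C + real k * 0)\<^sup>2 * 0 + \<gamma> * C + real k * 0
     + m * ((\<alpha> + C + real k * 0) * 0 + 2 * 0) + 2 * 0 + \<gamma>"
  have "(\<lambda>n. (1 + \<epsilon>\<^sub>1) * p * (real (N\<^sub>1 n) / x n) + \<epsilon>\<^sub>1 * (real (N\<^sub>1 n) / x n) + \<delta> * (a n / x n) + (a n / x n)\<^sup>2 * (x n / real n)
      + \<gamma> * (real (N\<^sub>2 n) / x n) + real k * (real (N\<^sub>3 n) / x n) + m * (a n / x n * (1 / real n) + 2 * (1 / x n)) + 2 * (1 / x n) + \<gamma>) \<longlonglongrightarrow> \<Lambda>"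
    unfolding \<Lambda>_def by (intro tendsto_intros N1r N2r N3r ar xn ninv xinv)
  moreover have "eventually (\<lambda>n. (1 + \<epsilon>\<^sub>1) * p * (real (N\<^sub>1 n) / x n) + \<epsilon>\<^sub>1 * (real (N\<^sub>1 n) / x n) + \<delta> * (a n / x n) + (a n / x n)\<^sup>2 * (x n / real n)
      + \<gamma> * (real (N\<^sub>2 n) / x n) + real k * (real (N\<^sub>3 n) / x n) + m * (a n / x n * (1 / real n) + 2 * (1 / x n)) + 2 * (1 / x n) + \<gamma>
      = U n / (real n * x n)) sequentially"
    using xpos eventually_gt_at_top[of 0]
    by eventually_elim (simp add: U_def add_divide_distrib distrib_left power2_eq_square mult_ac)
  ultimately have Ulim: "(\<lambda>n. U n / (real n * x n)) \<longlonglongrightarrow> \<Lambda>" by (rule Lim_transform_eventually)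
  have "\<Lambda> < (1 + \<epsilon>) / \<kappa>"
  proof -
    have "(1 + \<epsilon>\<^sub>1) * p * \<alpha> + \<epsilon>\<^sub>1 * \<alpha> = ((1 + \<epsilon>\<^sub>1) * (1 + \<epsilon>\<^sub>1) + \<epsilon>\<^sub>1 * (1 + \<epsilon>\<^sub>1) / p) / \<kappa>"
      using p \<kappa> by (simp add: \<alpha>_def field_simps)
    also have "\<dots> \<le> (1 + \<epsilon> / 4) / \<kappa>"
    proof (intro divide_right_mono)
      have e: "\<epsilon>\<^sub>1 * (1 + \<epsilon>\<^sub>1) \<le> \<epsilon>\<^sub>1 * 2" using \<epsilon>1 by (intro mult_left_mono) auto
      then have "\<epsilon>\<^sub>1 * (1 + \<epsilon>\<^sub>1) / p \<le> \<epsilon>\<^sub>1 * 2 / p" using p by (intro divide_right_mono) auto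
      also have "\<dots> \<le> (\<epsilon> * p / 32) * 2 / p" using p \<epsilon>1 by (intro divide_right_mono mult_right_mono) auto
      also have "\<dots> = \<epsilon> / 16" using p by simp
      finally have 1: "\<epsilon>\<^sub>1 * (1 + \<epsilon>\<^sub>1) / p \<le> \<epsilon> / 16" .
      have "\<epsilon> * p \<le> \<epsilon> * 1" using p \<epsilon> by (intro mult_left_mono) auto
      then have "\<epsilon>\<^sub>1 \<le> \<epsilon> / 32" using \<epsilon>1(3) by linarith
      moreover have "(1 + \<epsilon>\<^sub>1) * (1 + \<epsilon>\<^sub>1) \<le> 1 + 3 * \<epsilon>\<^sub>1" using e by (simp add: algebra_simps)
      ultimately show "(1 + \<epsilon>\<^sub>1) * (1 + \<epsilon>\<^sub>1) + \<epsilon>\<^sub>1 * (1 + \<epsilon>\<^sub>1) / p \<le> 1 + \<epsilon> / 4"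
        using 1 \<epsilon> by linarith
    qed (use \<kappa> in simp)
    finally have 1: "(1 + \<epsilon>\<^sub>1) * p * \<alpha> + \<epsilon>\<^sub>1 * \<alpha> \<le> (1 + \<epsilon> / 4) / \<kappa>" .
    have "\<gamma> * C + \<gamma> = \<gamma> * (C + 1)" by (simp add: algebra_simps)
    also have "\<dots> = \<epsilon> / (8 * \<kappa>)" using C by (simp add: \<gamma>_def)
    finally have "\<Lambda> \<le> (1 + \<epsilon> / 4) / \<kappa> + \<epsilon> / (8 * \<kappa>) + \<epsilon> / (8 * \<kappa>)"
      using 1 \<delta>2 by (simp add: \<Lambda>_def)
    also have "\<dots> < (1 + \<epsilon>) / \<kappa>" using \<kappa> \<epsilon> by (simp add: field_simps)
    finally show ?thesis .
  qed
  then have evU: "eventually (\<lambda>n. U n / (real n * x n) < (1 + \<epsilon>) / \<kappa>) sequentially"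
    using Ulim by (simp add: order_tendstoD)

  define q where "q n = exp (- (p * \<epsilon>\<^sub>1\<^sup>2 / 4) * real (N\<^sub>1 n)) / \<epsilon>\<^sub>1 + exp (- (p * (\<epsilon>\<^sub>1 / 8)\<^sup>2 / 2) * real (N\<^sub>1 n)) / \<gamma>
     + exp (- (\<epsilon>\<^sub>1 / 8) * x n) + exp (- x n)
     + (real (N\<^sub>2 n) / x n) * (real k * exp (- (p\<^sup>2 / 4) * real (N\<^sub>3 n))) / \<gamma>
     + 2 ^ N\<^sub>1 n * exp (- (p / 16) * (w * real (N\<^sub>1 n)) ^ 2) + 2 ^ N\<^sub>2 n * exp (- (p / 16) * (w * real (N\<^sub>2 n)) ^ 2)
     + real k * (2 ^ N\<^sub>3 n * exp (- (p / 16) * (w * real (N\<^sub>3 n)) ^ 2))" for n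
  have expN: "(\<lambda>n. exp (- b * real (N n))) \<longlonglongrightarrow> 0" if "b > 0" "filterlim N at_top sequentially" for b :: real and N :: "nat \<Rightarrow> nat"
  proof -
    have "(\<lambda>i. exp (- b * real i)) \<longlonglongrightarrow> 0" using that(1) by real_asymp
    then show ?thesis using that(2) by (rule filterlim_compose)
  qed
  have expx: "(\<lambda>n. exp (- b * x n)) \<longlonglongrightarrow> 0" if "b > 0" for b :: real
  proof -
    have "((\<lambda>y. exp (- b * y)) \<longlongrightarrow> 0) at_top" using that by real_asymp
    then show ?thesis using xlim by (rule filterlim_compose)
  qed
  have crN: "(\<lambda>n. 2 ^ N n * exp (- (p / 16) * (w * real (N n)) ^ 2)) \<longlonglongrightarrow> 0" if "filterlim N at_top sequentially" for N :: "nat \<Rightarrow> nat"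
  proof -
    have "(\<lambda>i::nat. 2 ^ i * exp (- (p / 16) * (w * real i) ^ 2)) \<longlonglongrightarrow> 0" using p w by real_asymp
    then show ?thesis using that by (rule filterlim_compose)
  qed
  have "q \<longlonglongrightarrow> 0 / \<epsilon>\<^sub>1 + 0 / \<gamma> + 0 + 0 + C * (real k * 0) / \<gamma> + 0 + 0 + real k * 0"
    unfolding q_def
  proof (intro tendsto_add tendsto_divide tendsto_mult tendsto_const)
    show "(\<lambda>n. exp (- x n)) \<longlonglongrightarrow> 0" using expx[of 1] by simp
    show "(\<lambda>n. exp (- (p * \<epsilon>\<^sub>1\<^sup>2 / 4) * real (N\<^sub>1 n))) \<longlonglongrightarrow> 0" by (rule expN[OF _ N1lim]) (use p \<epsilon>1 in simp)
    show "(\<lambda>n. exp (- (p * (\<epsilon>\<^sub>1 / 8)\<^sup>2 / 2) * real (N\<^sub>1 n))) \<longlonglongrightarrow> 0" by (rule expN[OF _ N1lim]) (use p \<epsilon>1 in simp)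
    show "(\<lambda>n. exp (- (p\<^sup>2 / 4) * real (N\<^sub>3 n))) \<longlonglongrightarrow> 0" by (rule expN[OF _ N3lim]) (use p in simp)
    show "(\<lambda>n. exp (- (\<epsilon>\<^sub>1 / 8) * x n)) \<longlonglongrightarrow> 0" by (rule expx) (use \<epsilon>1 in simp)
  qed (fact crN[OF N1lim] crN[OF N2lim] crN[OF N3lim] N2r | use \<epsilon>1 \<gamma> in simp)+
  then have qlim: "q \<longlonglongrightarrow> 0" by simp
  have evN: "eventually (\<lambda>n. real (N n) \<ge> c) sequentially" if "filterlim N at_top sequentially" for N :: "nat \<Rightarrow> nat" and c :: real
    using that filterlim_compose[OF filterlim_real_sequentially that] by (auto simp: filterlim_at_top)
  have eva: "eventually (\<lambda>n. a n \<le> real n) sequentially"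
  proof -
    have "(\<lambda>n. a n / x n * (x n / real n)) \<longlonglongrightarrow> (\<alpha> + C + real k * 0) * 0" by (intro tendsto_mult ar xn)
    then have "eventually (\<lambda>n. a n / x n * (x n / real n) < 1) sequentially" by (rule order_tendstoD) simp
    then show ?thesis using xpos eventually_gt_at_top[of 0] by eventually_elim simp
  qed
  have "eventually (\<lambda>n. measure_pmf.prob (random_graph n p)
      {G. real (sat G (complete_multipartite s)) > (1 + \<epsilon>) * (real n * log (1 / (1 - p)) (real n))} \<le> q n) sequentially"
    using xpos eventually_ln_ge[of "4 * \<kappa> / \<epsilon>\<^sub>1"] evU evN[OF N1lim, of "max 1 (2 / w)"] evN[OF N2lim, of "max 1 (2 / w)"]
      evN[OF N3lim, of "max 1 (2 / w)"] eva eventually_gt_at_top[of 0]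
  proof eventually_elim
    case (elim n)
    have x: "x n \<ge> 1" "x n \<ge> 4 * \<kappa> / \<epsilon>\<^sub>1" and n: "real n = exp (x n)" using elim by (auto simp: x_def)
    have an: "N\<^sub>1 n + N\<^sub>2 n + k * N\<^sub>3 n \<le> card {1..n}"
    proof -
      have "real (N\<^sub>1 n + N\<^sub>2 n + k * N\<^sub>3 n) \<le> real n" using elim by (simp add: a_def)
      then have "N\<^sub>1 n + N\<^sub>2 n + k * N\<^sub>3 n \<le> n" by (simp only: of_nat_le_iff)
      then show ?thesis by simp
    qed
    obtain A\<^sub>1 A\<^sub>2 :: "nat set" and A\<^sub>3 B where lay: "{1..n} = A\<^sub>1 \<union> A\<^sub>2 \<union> (\<Union>j<k. A\<^sub>3 j) \<union> B"
      "A\<^sub>1 \<inter> A\<^sub>2 = {}" "A\<^sub>1 \<inter> (\<Union>j<k. A\<^sub>3 j) = {}" "A\<^sub>1 \<inter> B = {}" "A\<^sub>2 \<inter> (\<Union>j<k. A\<^sub>3 j) = {}"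
      "A\<^sub>2 \<inter> B = {}" "(\<Union>j<k. A\<^sub>3 j) \<inter> B = {}"
      "\<And>i j. i < k \<Longrightarrow> j < k \<Longrightarrow> i \<noteq> j \<Longrightarrow> A\<^sub>3 i \<inter> A\<^sub>3 j = {}"
      "card A\<^sub>1 = N\<^sub>1 n" "card A\<^sub>2 = N\<^sub>2 n" "\<And>j. j < k \<Longrightarrow> card (A\<^sub>3 j) = N\<^sub>3 n"
      using exists_layers[OF finite_atLeastAtMost an] by metis
    have big: "w * real (N\<^sub>1 n) \<ge> 2" "w * real (N\<^sub>2 n) \<ge> 2" "w * real (N\<^sub>3 n) \<ge> 2" "N\<^sub>1 n > 0" "N\<^sub>2 n > 0" "N\<^sub>3 n > 0"
      using elim w by (auto simp: field_simps)
    have N1lo: "real (N\<^sub>1 n) \<ge> \<alpha> * x n" and N1hi: "real (N\<^sub>1 n) \<le> \<alpha> * x n + 1"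
      using nat_ceiling_bounds[of "\<alpha> * x n"] \<alpha> x by (auto simp: N\<^sub>1_def)
    have N2lo: "real (N\<^sub>2 n) \<ge> C * x n" using nat_ceiling_bounds[of "C * x n"] C x by (auto simp: N\<^sub>2_def)
    have Llo: "real (L n) \<ge> (1 + \<epsilon>\<^sub>1 / 2) / \<kappa> * x n" and Lhi: "real (L n) \<le> (1 + \<epsilon>\<^sub>1 / 2) / \<kappa> * x n + 1"
      using nat_ceiling_bounds[of "(1 + \<epsilon>\<^sub>1 / 2) / \<kappa> * x n"] \<epsilon>1 \<kappa> x by (auto simp: L_def)
    have L: "real (L n) \<le> (1 - \<epsilon>\<^sub>1 / 8) * p * real (N\<^sub>1 n)"
    proof -
      \<comment> \<open>Absorbs the rounding of \<open>L\<close>, raising the coefficient from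
        \<open>1 + \<epsilon>\<^sub>1 / 2\<close> to \<open>1 + 3 * \<epsilon>\<^sub>1 / 4\<close>,
        still below \<open>(1 - \<epsilon>\<^sub>1 / 8) * (1 + \<epsilon>\<^sub>1)\<close>.\<close>
      have "1 \<le> \<epsilon>\<^sub>1 / 4 / \<kappa> * x n" using x(2) \<epsilon>1 \<kappa> by (simp add: field_simps)
      then have "real (L n) \<le> (1 + \<epsilon>\<^sub>1 / 2) / \<kappa> * x n + \<epsilon>\<^sub>1 / 4 / \<kappa> * x n" using Lhi by linarith
      also have "\<dots> = (1 + 3 * \<epsilon>\<^sub>1 / 4) / \<kappa> * x n" using \<kappa> by (simp add: field_simps)
      also have "\<dots> \<le> ((1 - \<epsilon>\<^sub>1 / 8) * (1 + \<epsilon>\<^sub>1)) / \<kappa> * x n"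
      proof (intro mult_right_mono divide_right_mono)
        have "\<epsilon>\<^sub>1 * \<epsilon>\<^sub>1 \<le> \<epsilon>\<^sub>1 * 1" using \<epsilon>1 by (intro mult_left_mono) auto
        then show "1 + 3 * \<epsilon>\<^sub>1 / 4 \<le> (1 - \<epsilon>\<^sub>1 / 8) * (1 + \<epsilon>\<^sub>1)" by (simp add: field_simps)
      qed (use \<kappa> x in auto)
      also have "\<dots> = (1 - \<epsilon>\<^sub>1 / 8) * p * (\<alpha> * x n)" using p \<kappa> by (simp add: \<alpha>_def)
      also have "\<dots> \<le> (1 - \<epsilon>\<^sub>1 / 8) * p * real (N\<^sub>1 n)" using N1lo \<epsilon>1 p by (intro mult_left_mono) auto
      finally show ?thesis .
    qed
    have t0: "t \<ge> 0" and x0: "x n > 0" and cV: "card {1..n} > 0" using t x elim by auto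
    interpret fr: random_frame "{1..n}" p s k R \<delta> "N\<^sub>1 n" "N\<^sub>2 n" "N\<^sub>3 n" "L n" \<epsilon>\<^sub>1 \<gamma> t "x n" A\<^sub>1 A\<^sub>2 A\<^sub>3 B
      by unfold_locales
        (fact finite_atLeastAtMost p len sorted pos k R dense \<delta>0 \<delta>1 \<epsilon>1 \<gamma> t0 x0 lay big(4-6) cV big(1-3)[unfolded w_def] L)+
    have up: "fr.upper = U n" unfolding fr.upper_def fr.core_size_def U_def a_def m_def by simp
    have "U n \<le> (1 + \<epsilon>) * (real n * log (1 / (1 - p)) (real n))"
    proof -
      have "real n * x n > 0" using x n by simp
      then have "U n \<le> (1 + \<epsilon>) / \<kappa> * (real n * x n)" using elim by (simp add: pos_divide_less_eq)
      then show ?thesis by (simp add: x_def log_def \<kappa>_def)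
    qed
    then have "measure_pmf.prob (random_graph n p)
        {G. real (sat G (complete_multipartite s)) > (1 + \<epsilon>) * (real n * log (1 / (1 - p)) (real n))} \<le> measure_pmf.prob fr.M {c. \<not> fr.good c}"
      unfolding prob_random_graph using fr.good_imp_sat_le up
      by (intro measure_pmf.finite_measure_mono) force+
    also have "\<dots> \<le> q n"
    proof -
      have y0: "0 < 1 - p * (1 - exp (- t))"
      proof -
        have "p * (1 - exp (- t)) \<le> p * 1" using p by (intro mult_left_mono) auto
        then show ?thesis using p by linarith
      qed
      have y1: "ln (1 - p * (1 - exp (- t))) \<le> 0"
        using y0 p t by (subst ln_le_zero_iff) auto
      \<comment> \<open>In multiples of ln n the exponents are 1 from the factor n, at most
        \<open>\<epsilon>\<^sub>1 / 8\<close> from the tilt by the choice of \<delta>, and at most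
        \<open>- (1 + \<epsilon>\<^sub>1 / 4)\<close> from the power \<open>L\<close>.\<close>
      have "real n * (exp (t * (2 * \<delta> * real (N\<^sub>1 n))) * (1 - p * (1 - exp (- t))) ^ L n) \<le> exp (- (\<epsilon>\<^sub>1 / 8) * x n)"
      proof -
        have "(1 - p * (1 - exp (- t))) ^ L n = exp (real (L n) * ln (1 - p * (1 - exp (- t))))"
          using y0 by (simp add: exp_of_nat_mult)
        moreover have "real (L n) * ln (1 - p * (1 - exp (- t))) \<le> - (1 + \<epsilon>\<^sub>1 / 4) * x n"
        proof -
          have "real (L n) * ln (1 - p * (1 - exp (- t))) \<le> (1 + \<epsilon>\<^sub>1 / 2) / \<kappa> * x n * ln (1 - p * (1 - exp (- t)))"
            using Llo y1 by (rule mult_right_mono_neg)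
          also have "\<dots> = x n / \<kappa> * ((1 + \<epsilon>\<^sub>1 / 2) * ln (1 - p * (1 - exp (- t))))" by simp
          also have "\<dots> \<le> x n / \<kappa> * ((1 + \<epsilon>\<^sub>1 / 4) * ln (1 - p))" using t(2) x \<kappa> by (intro mult_left_mono) auto
          also have "\<dots> = - (1 + \<epsilon>\<^sub>1 / 4) * x n" using \<kappa> by (simp add: ln1p field_simps)
          finally show ?thesis .
        qed
        moreover have "t * (2 * \<delta> * real (N\<^sub>1 n)) \<le> \<epsilon>\<^sub>1 / 8 * x n"
        proof -
          have "real (N\<^sub>1 n) \<le> (\<alpha> + 1) * x n" using N1hi x by (simp add: algebra_simps)
          then have "t * (2 * \<delta>) * real (N\<^sub>1 n) \<le> t * (2 * \<delta>) * ((\<alpha> + 1) * x n)" using t \<delta>0 by (intro mult_left_mono) auto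
          also have "\<dots> = t * (2 * \<delta>) * (\<alpha> + 1) * x n" by simp
          also have "\<dots> \<le> \<epsilon>\<^sub>1 / 8 * x n" using \<delta>3 x by (intro mult_right_mono) auto
          finally show ?thesis by (simp add: mult_ac)
        qed
        ultimately show ?thesis unfolding n exp_add[symmetric] by (simp add: exp_add[symmetric] algebra_simps)
      qed
      moreover have "real n * exp (- (p\<^sup>2 / 4) * real (N\<^sub>2 n)) \<le> exp (- x n)"
      proof -
        have "p\<^sup>2 / 4 * (C * x n) \<le> p\<^sup>2 / 4 * real (N\<^sub>2 n)" using N2lo by (intro mult_left_mono) auto
        moreover have "p\<^sup>2 / 4 * (C * x n) = 2 * x n" using p by (simp add: C_def)
        ultimately have "x n - p\<^sup>2 / 4 * real (N\<^sub>2 n) \<le> - x n" by linarith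
        moreover have "real n * exp (- (p\<^sup>2 / 4) * real (N\<^sub>2 n)) = exp (x n - p\<^sup>2 / 4 * real (N\<^sub>2 n))"
          unfolding n exp_add[symmetric] by simp
        ultimately show ?thesis by simp
      qed
      moreover have "real (N\<^sub>2 n) * (real k * exp (- (p\<^sup>2 / 4) * real (N\<^sub>3 n))) / (\<gamma> * x n)
          = (real (N\<^sub>2 n) / x n) * (real k * exp (- (p\<^sup>2 / 4) * real (N\<^sub>3 n))) / \<gamma>" by simp
      moreover have card_n: "card {1..n} = n" by simp
      ultimately show ?thesis
        using fr.prob_not_good[unfolded card_n] unfolding q_def w_def by linarith
    qed
    finally show ?case .
  qed
  then show ?thesis
    by (intro tendsto_sandwich[OF _ _ tendsto_const qlim]) auto
qed

theorem theorem1p6: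
  fixes s :: "nat list" and p :: real
  assumes "length s \<ge> 3" and "sorted s" and "\<forall>k\<in>set s. 0 < k"
    and "1 / 2 \<le> p" and "p < 1"
  shows "\<forall>\<epsilon>>0. (\<lambda>n. measure_pmf.prob (random_graph n p)
            {G. \<bar>real (sat G (complete_multipartite s)) - real n * log (1 / (1 - p)) (real n)\<bar>
                  \<le> \<epsilon> * (real n * log (1 / (1 - p)) (real n))})
          \<longlonglongrightarrow> 1"
proof (intro allI impI)
  fix \<epsilon> :: real assume \<epsilon>: "\<epsilon> > 0"
  define X where "X n = real n * log (1 / (1 - p)) (real n)" for n
  define S where "S G = real (sat G (complete_multipartite s))" for G :: "nat ugraph"
  let ?P = "\<lambda>n A. measure_pmf.prob (random_graph n p) A"
  \<comment> \<open>The lower estimate is stated for deviations at most 1; truncating only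
    strengthens the bound.\<close>
  define \<epsilon>' where "\<epsilon>' = min \<epsilon> 1"
  have "(\<lambda>n. ?P n {G. S G < (1 - \<epsilon>') * X n}) \<longlonglongrightarrow> 0"
    unfolding S_def X_def using assms \<epsilon> by (intro sat_lower_whp) (auto simp: \<epsilon>'_def)
  moreover have "(\<lambda>n. ?P n {G. S G > (1 + \<epsilon>) * X n}) \<longlonglongrightarrow> 0"
    unfolding S_def X_def using assms \<epsilon> by (intro sat_upper_whp) auto
  ultimately have lim: "(\<lambda>n. 1 - (?P n {G. S G < (1 - \<epsilon>') * X n} + ?P n {G. S G > (1 + \<epsilon>) * X n})) \<longlonglongrightarrow> 1 - (0 + 0)"
    by (intro tendsto_intros)
  have "eventually (\<lambda>n. 1 - (?P n {G. S G < (1 - \<epsilon>') * X n} + ?P n {G. S G > (1 + \<epsilon>) * X n})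
      \<le> ?P n {G. \<bar>S G - X n\<bar> \<le> \<epsilon> * X n}) sequentially"
    using eventually_ge_at_top[of 1]
  proof eventually_elim
    case (elim n)
    have X: "X n \<ge> 0" using elim assms by (auto simp: X_def log_def intro!: mult_nonneg_nonneg divide_nonneg_nonneg)
    have "\<epsilon>' * X n \<le> \<epsilon> * X n" using X by (intro mult_right_mono) (auto simp: \<epsilon>'_def)
    then have "- {G. \<bar>S G - X n\<bar> \<le> \<epsilon> * X n} \<subseteq> {G. S G < (1 - \<epsilon>') * X n} \<union> {G. S G > (1 + \<epsilon>) * X n}"
      by (auto simp: abs_le_iff algebra_simps)
    then have "?P n (- {G. \<bar>S G - X n\<bar> \<le> \<epsilon> * X n}) \<le> ?P n ({G. S G < (1 - \<epsilon>') * X n} \<union> {G. S G > (1 + \<epsilon>) * X n})"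
      by (intro measure_pmf.finite_measure_mono) auto
    also have "\<dots> \<le> ?P n {G. S G < (1 - \<epsilon>') * X n} + ?P n {G. S G > (1 + \<epsilon>) * X n}"
      by (intro measure_Un_le) auto
    finally show ?case
      using measure_pmf.prob_compl[of "{G. \<bar>S G - X n\<bar> \<le> \<epsilon> * X n}" "random_graph n p"] by (simp add: Compl_eq_Diff_UNIV)
  qed
  then have "(\<lambda>n. ?P n {G. \<bar>S G - X n\<bar> \<le> \<epsilon> * X n}) \<longlonglongrightarrow> 1"
    by (intro tendsto_sandwich[OF _ _ lim[simplified] tendsto_const]) auto
  then show "(\<lambda>n. ?P n {G. \<bar>real (sat G (complete_multipartite s)) - real n * log (1 / (1 - p)) (real n)\<bar>
      \<le> \<epsilon> * (real n * log (1 / (1 - p)) (real n))}) \<longlonglongrightarrow> 1"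
    unfolding S_def X_def .
qed

end
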